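(* Assume the standing setup below and that $\beta_n n^{-\alpha}\to\gamma\in(0,\infty)$. Let $\mathcal N$ be a Poisson point process on $\mathbb R_+=[0,\infty)$ with intensity measure $\Lambda$ given by $\Lambda([0,y])=C(q)(y/\gamma)^{1/\alpha}$ for $y\ge0$, and let $0<Y_1<Y_2<\cdots$ be its atoms in increasing order. Then for every fixed $k\ge1$, $(A_{(1)},\dots,A_{(k)})\to(W_1,\dots,W_k)$ in distribution, where $W_i=e^{-Y_i}/\sum_{j=1}^\infty e^{-Y_j}$.
   Context: Standing setup: Fix an integer $d\ge 2$; let $\mathbb S^{d-1}\subset\mathbb R^d$ be the unit sphere with surface measure $\sigma$. Fix $q\in\mathbb S^{d-1}$. Let $x_1,x_2,\dots$ be i.i.d. random vectors on $\mathbb S^{d-1}$ with law $\rho(x)\,d\sigma(x)$, where $\rho$ is a $C^2$ probability density on $\mathbb S^{d-1}$ with $\rho(q)>0$. Let $(\beta_n)_{n\ge1}$ be positive reals and set $\alpha=2/(d-1)$. Define $T_i=1-\langle q,x_i\rangle\in[0,2]$, $Z_n=\sum_{j=1}^n e^{-\beta_nT_j}$, attention weights $A_i=e^{-\beta_nT_i}/Z_n$ ($1\le i\le n$), and let $A_{(1)}\ge\cdots\ge A_{(n)}$ be their decreasing rearrangement. Let $C(q)=\frac{2^{1/\alpha}\sigma_{d-2}}{d-1}\rho(q)$, where $\sigma_{d-2}$ is the surface area of $\mathbb S^{d-2}$. *)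

theory Defs
  imports "HOL-Analysis.Analysis" "HOL-Probability.Probability"
begin

text \<open>Surface measure on the unit sphere of a Euclidean space of dimension d:
  the cone measure, sigma(A) = d * Lebesgue({t x | x in A, 0 < t <= 1}).\<close>
definition sphere_surface :: "('a::euclidean_space) measure" where
  "sphere_surface = scale_measure (of_nat DIM('a))
     (distr (restrict_space lborel (ball 0 1)) borel (\<lambda>x. x /\<^sub>R norm x))"

text \<open>Surface area of the unit sphere S^(m-1) in R^m (m >= 1).\<close>
definition sphere_area :: "nat \<Rightarrow> real" where
  "sphere_area m = 2 * pi powr (real m / 2) / Gamma (real m / 2)"

definition C2_on :: "('a::euclidean_space) set \<Rightarrow> ('a \<Rightarrow> real) \<Rightarrow> bool" where
  "C2_on U f \<longleftrightarrow> open U \<and>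
     (\<exists>(f' :: 'a \<Rightarrow> ('a \<Rightarrow>\<^sub>L real)) (f'' :: 'a \<Rightarrow> ('a \<Rightarrow>\<^sub>L ('a \<Rightarrow>\<^sub>L real))).
        (\<forall>x\<in>U. (f has_derivative blinfun_apply (f' x)) (at x)) \<and>
        (\<forall>x\<in>U. (f' has_derivative blinfun_apply (f'' x)) (at x)) \<and>
        continuous_on U f'')"

definition C2_on_sphere :: "('a::euclidean_space \<Rightarrow> real) \<Rightarrow> bool" where
  "C2_on_sphere \<rho> \<longleftrightarrow> (\<exists>U g. C2_on U g \<and> sphere 0 1 \<subseteq> U \<and> (\<forall>x\<in>sphere 0 1. g x = \<rho> x))"

definition attn :: "'a::real_inner \<Rightarrow> real \<Rightarrow> (nat \<Rightarrow> 'a) \<Rightarrow> nat \<Rightarrow> nat \<Rightarrow> real" where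
  "attn q b x n i = exp (- b * (1 - inner q (x i))) /
                    (\<Sum>j=1..n. exp (- b * (1 - inner q (x j))))"

definition desc_stat :: "nat \<Rightarrow> real list \<Rightarrow> real" where
  "desc_stat k xs = (if 1 \<le> k \<and> k \<le> length xs then rev (sort xs) ! (k - 1) else 0)"

definition conv_in_distr ::
  "'m measure \<Rightarrow> (nat \<Rightarrow> 'm \<Rightarrow> (nat \<Rightarrow> real)) \<Rightarrow> 'p measure \<Rightarrow> ('p \<Rightarrow> (nat \<Rightarrow> real)) \<Rightarrow> bool" where
  "conv_in_distr M V P W \<longleftrightarrow>
     (\<forall>f :: (nat \<Rightarrow> real) \<Rightarrow> real. continuous_on UNIV f \<longrightarrow> bounded (range f) \<longrightarrow>
        (\<lambda>n. integral\<^sup>L M (\<lambda>\<omega>. f (V n \<omega>))) \<longlonglongrightarrow> integral\<^sup>L P (\<lambda>\<omega>. f (W \<omega>)))"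

definition poisson_pp_atoms :: "'p measure \<Rightarrow> real measure \<Rightarrow> (nat \<Rightarrow> 'p \<Rightarrow> real) \<Rightarrow> bool" where
  "poisson_pp_atoms P Lam Y \<longleftrightarrow> prob_space P \<and>
     (\<forall>i. Y i \<in> borel_measurable P) \<and>
     (AE \<omega> in P. 0 < Y 1 \<omega> \<and> (\<forall>i\<ge>1. Y i \<omega> < Y (Suc i) \<omega>) \<and>
                  filterlim (\<lambda>i. Y i \<omega>) at_top sequentially) \<and>
     (\<forall>(J :: nat set) (B :: nat \<Rightarrow> real set). finite J \<longrightarrow> disjoint_family_on B J \<longrightarrow>
        (\<forall>j\<in>J. B j \<in> sets borel \<and> B j \<subseteq> {0..} \<and> bounded (B j)) \<longrightarrow>
        prob_space.indep_vars P (\<lambda>_. count_space UNIV)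
            (\<lambda>j \<omega>. card {i. 1 \<le> i \<and> Y i \<omega> \<in> B j}) J \<and>
        (\<forall>j\<in>J. \<forall>m::nat. measure P {\<omega>\<in>space P. card {i. 1 \<le> i \<and> Y i \<omega> \<in> B j} = m}
                  = exp (- measure Lam (B j)) * measure Lam (B j) ^ m / fact m))"

end

theory Submission
  imports Defs "HOL-Real_Asymp.Real_Asymp"
begin

text \<open>The weights of the sample and of the limit are both of the form \<open>w i / sum w\<close> for a decreasing
  sequence \<open>w i = exp (- s i)\<close>, where \<open>s\<close> enumerates the points \<open>\<beta> n T\<close> of the sample, respectively
  the atoms of the Poisson process.
  Cutting \<open>{0..L}\<close> into cells of length \<open>h\<close>, the vector of cell counts determines these weights up to
  \<open>O(h)\<close> and the contribution of the points beyond \<open>L\<close>. The latter is uniformly small because the mean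
  of \<open>sum (exp (- s i / 2))\<close> is bounded uniformly in \<open>n\<close>.
  The joint probability generating function of the cell counts of the sample is
  \<open>(1 + sum (p j (z j - 1))) ^ n\<close> by independence, with \<open>n p j\<close> converging to the intensity of cell \<open>j\<close>; so it
  converges to that of independent Poisson variables, and the counts converge in law.
  That \<open>n p j\<close> converges amounts to the asymptotics of the area of small spherical caps, which are squeezed
  between truncated cones. The cone volume is reduced to an axis-parallel one by a rotation,
  written as a product of shears.\<close>

section \<open>Volume of cones and area of spherical caps\<close>

text \<open>The obstacle is that a share depends on unboundedly many points: its denominator sums
  over all of them, while counts in finitely many bounded cells are silent about the far ones.
  Square roots of the weights solve this: a weight below \<open>exp (- L)\<close> is at most
  \<open>exp (- L / 2)\<close> times its square root, so a mean bound for the sum of the roots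
  controls the far mass and leaves a factor that vanishes as \<open>L\<close> grows. That mean bound
  rests on a polynomial bound, uniform in \<open>n\<close>, for the expected number of points in
  \<open>{0..y}\<close>. A second danger is a small denominator. It is at least the largest weight,
  and smallness of the largest weight is an event about finitely many cell counts, so the limit
  theorem for counts controls it as well. Generating functions are taken only at arguments strictly
  between 0 and 1; there the tails of the series are geometric, so point probabilities can be
  extracted one after the other by elementary estimates. No tightness has to be shown beforehand,
  because the limit is a probability.\<close>

lemma nn_integral_lborel_split:
  fixes b :: "'a::euclidean_space"
  assumes b: "b \<in> Basis" and f[measurable]: "f \<in> borel_measurable borel"
  shows "(\<integral>\<^sup>+x. f x \<partial>lborel) =
      (\<integral>\<^sup>+g. \<integral>\<^sup>+s. f (s *\<^sub>R b + (\<Sum>i\<in>Basis-{b}. g i *\<^sub>R i)) \<partial>lborel \<partial>(\<Pi>\<^sub>M i\<in>Basis-{b}. lborel))"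
    and "(\<integral>\<^sup>+x. f x \<partial>lborel) =
      (\<integral>\<^sup>+s. \<integral>\<^sup>+g. f (s *\<^sub>R b + (\<Sum>i\<in>Basis-{b}. g i *\<^sub>R i)) \<partial>(\<Pi>\<^sub>M i\<in>Basis-{b}. lborel) \<partial>lborel)"
proof -
  interpret product_sigma_finite "\<lambda>i::'a. lborel :: real measure"
    by (simp add: product_sigma_finite_def sigma_finite_lborel)
  have ins: "insert b (Basis - {b}) = Basis" using b by auto
  have fm: "(\<lambda>g. f (\<Sum>i\<in>Basis. g i *\<^sub>R i)) \<in> borel_measurable (\<Pi>\<^sub>M i\<in>insert b (Basis-{b}). lborel)"
    unfolding ins by measurable
  have eq: "(\<Sum>i\<in>Basis. (g(b := s)) i *\<^sub>R i) = s *\<^sub>R b + (\<Sum>i\<in>Basis-{b}. g i *\<^sub>R i)"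
    for g :: "'a \<Rightarrow> real" and s
  proof -
    have "(\<Sum>i\<in>Basis. (g(b := s)) i *\<^sub>R i) = (g(b := s)) b *\<^sub>R b + (\<Sum>i\<in>Basis-{b}. (g(b := s)) i *\<^sub>R i)"
      using b by (simp add: sum.remove)
    also have "(\<Sum>i\<in>Basis-{b}. (g(b := s)) i *\<^sub>R i) = (\<Sum>i\<in>Basis-{b}. g i *\<^sub>R i)"
      by (rule sum.cong) auto
    finally show ?thesis by simp
  qed
  have 1: "(\<integral>\<^sup>+x. f x \<partial>lborel) = (\<integral>\<^sup>+g. f (\<Sum>i\<in>Basis. g i *\<^sub>R i) \<partial>(\<Pi>\<^sub>M i\<in>insert b (Basis-{b}). lborel))"
    unfolding ins by (subst lborel_eq) (simp add: nn_integral_distr)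
  show "(\<integral>\<^sup>+x. f x \<partial>lborel) =
      (\<integral>\<^sup>+g. \<integral>\<^sup>+s. f (s *\<^sub>R b + (\<Sum>i\<in>Basis-{b}. g i *\<^sub>R i)) \<partial>lborel \<partial>(\<Pi>\<^sub>M i\<in>Basis-{b}. lborel))"
    unfolding 1 by (subst product_nn_integral_insert[OF _ _ fm]) (auto simp del: fun_upd_apply simp: eq)
  show "(\<integral>\<^sup>+x. f x \<partial>lborel) =
      (\<integral>\<^sup>+s. \<integral>\<^sup>+g. f (s *\<^sub>R b + (\<Sum>i\<in>Basis-{b}. g i *\<^sub>R i)) \<partial>(\<Pi>\<^sub>M i\<in>Basis-{b}. lborel) \<partial>lborel)"
    unfolding 1 by (subst product_nn_integral_insert_rev[OF _ _ fm]) (auto simp del: fun_upd_apply simp: eq)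
qed

text \<open>The condition \<open>a \<bullet> b = 0\<close> makes the offset
  \<open>a \<bullet> x\<close> constant along each line in direction \<open>b\<close>, so on each
  such line the map is a translation; Fubini does the rest.\<close>

lemma lborel_distr_shear:
  fixes a b :: "'a::euclidean_space"
  assumes b: "b \<in> Basis" and ab: "a \<bullet> b = 0"
  shows "distr lborel borel (\<lambda>x. x + (a \<bullet> x) *\<^sub>R b) = lborel"
proof (rule measure_eqI)
  fix A :: "'a set" assume "A \<in> sets (distr lborel borel (\<lambda>x. x + (a \<bullet> x) *\<^sub>R b))"
  then have [measurable]: "A \<in> sets borel" by simp
  let ?R = "\<lambda>g. \<Sum>i\<in>Basis-{b}. g i *\<^sub>R i"
  have "emeasure (distr lborel borel (\<lambda>x. x + (a \<bullet> x) *\<^sub>R b)) A =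
      (\<integral>\<^sup>+x. indicator A (x + (a \<bullet> x) *\<^sub>R b) \<partial>lborel)"
    by (simp add: nn_integral_distr flip: nn_integral_indicator)
  also have "\<dots> = (\<integral>\<^sup>+g. \<integral>\<^sup>+s. indicator A (s *\<^sub>R b + ?R g + (a \<bullet> (s *\<^sub>R b + ?R g)) *\<^sub>R b) \<partial>lborel \<partial>(\<Pi>\<^sub>M i\<in>Basis-{b}. lborel))"
    by (rule nn_integral_lborel_split(1)[OF b]) measurable
  also have "\<dots> = (\<integral>\<^sup>+g. \<integral>\<^sup>+s. indicator A (s *\<^sub>R b + ?R g) \<partial>lborel \<partial>(\<Pi>\<^sub>M i\<in>Basis-{b}. lborel))"
  proof (rule nn_integral_cong)
    fix g
    have "(\<integral>\<^sup>+s. indicator A (s *\<^sub>R b + ?R g) \<partial>lborel) =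
        (\<integral>\<^sup>+s. indicator A ((a \<bullet> ?R g + 1 * s) *\<^sub>R b + ?R g) \<partial>lborel)"
      by (subst nn_integral_real_affine[where c=1 and t="a \<bullet> ?R g"]) auto
    then show "(\<integral>\<^sup>+s. indicator A (s *\<^sub>R b + ?R g + (a \<bullet> (s *\<^sub>R b + ?R g)) *\<^sub>R b) \<partial>lborel) =
        (\<integral>\<^sup>+s. indicator A (s *\<^sub>R b + ?R g) \<partial>lborel)"
      by (simp add: inner_add_right ab scaleR_add_left add_ac)
  qed
  also have "\<dots> = (\<integral>\<^sup>+x. indicator A x \<partial>lborel)"
    by (rule nn_integral_lborel_split(1)[OF b, symmetric]) measurable
  finally show "emeasure (distr lborel borel (\<lambda>x. x + (a \<bullet> x) *\<^sub>R b)) A = emeasure lborel A" by simp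
qed simp

text \<open>The shear along \<open>v\<close> is a composition of shears along the basis vectors
  other than \<open>b\<close>: none of them changes \<open>b \<bullet> x\<close>, so their
  displacements add up.\<close>

lemma lborel_distr_shear':
  fixes b v :: "'a::euclidean_space"
  assumes b: "b \<in> Basis" and vb: "v \<bullet> b = 0"
  shows "distr lborel borel (\<lambda>x. x + (b \<bullet> x) *\<^sub>R v) = lborel"
proof -
  have *: "distr lborel borel (\<lambda>x. x + (b \<bullet> x) *\<^sub>R (\<Sum>i\<in>I. (v \<bullet> i) *\<^sub>R i)) = lborel"
    if "finite I" "I \<subseteq> Basis - {b}" for I
    using that
  proof (induction I rule: finite_induct)
    case empty
    then show ?case by (simp add: distr_id2)
  next
    case (insert j I)
    let ?w = "\<Sum>i\<in>I. (v \<bullet> i) *\<^sub>R i"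
    have jb: "j \<in> Basis" "b \<bullet> j = 0" using insert b by (auto simp: inner_not_same_Basis)
    have bw: "b \<bullet> ?w = 0" unfolding inner_sum_right
      using insert b by (intro sum.neutral) (auto simp: inner_not_same_Basis subset_iff)
    have "distr lborel borel (\<lambda>x. x + (b \<bullet> x) *\<^sub>R (\<Sum>i\<in>insert j I. (v \<bullet> i) *\<^sub>R i)) =
        distr (distr lborel borel (\<lambda>x. x + (b \<bullet> x) *\<^sub>R ?w)) borel (\<lambda>x. x + (((v \<bullet> j) *\<^sub>R b) \<bullet> x) *\<^sub>R j)"
      by (subst distr_distr) (use insert in \<open>auto simp: comp_def inner_add_right bw algebra_simps\<close>)
    also have "\<dots> = lborel"
      using insert lborel_distr_shear[OF jb(1), of "(v \<bullet> j) *\<^sub>R b"] jb(2) by simp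
    finally show ?case .
  qed
  have "(\<Sum>i\<in>Basis-{b}. (v \<bullet> i) *\<^sub>R i) = v"
    using euclidean_representation[of v] b vb by (simp add: sum.remove)
  with *[of "Basis-{b}"] show ?thesis by simp
qed

text \<open>A plane rotation taking \<open>b\<close> to \<open>q\<close> is a product of three shears.\<close>

lemma lborel_rotation:
  fixes b q :: "'a::euclidean_space"
  assumes b: "b \<in> Basis" and q: "norm q = 1" and qb: "q \<noteq> - b"
  obtains R :: "'a \<Rightarrow> 'a" where "R \<in> borel_measurable borel" "distr lborel borel R = lborel"
    "\<And>x. q \<bullet> R x = b \<bullet> x" "\<And>x. norm (R x) = norm x"
proof -
  define c where "c = q \<bullet> b"
  define u where "u = q - c *\<^sub>R b"
  have bb: "b \<bullet> b = 1" using b by simp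
  have qq: "q \<bullet> q = 1" using q by (simp add: dot_square_norm)
  have ub: "u \<bullet> b = 0" by (simp add: u_def c_def inner_diff_left bb)
  have uu: "u \<bullet> u = 1 - c\<^sup>2"
    by (simp add: u_def inner_diff_left inner_diff_right bb qq c_def inner_commute power2_eq_square)
  have "1 + c > 0"
  proof -
    have "(q + b) \<bullet> (q + b) > 0" using qb by (simp add: inner_gt_zero_iff eq_neg_iff_add_eq_0)
    then show ?thesis by (simp add: inner_add_left inner_add_right bb qq c_def inner_commute)
  qed
  \<comment> \<open>With \<open>c\<close> the cosine of the angle between \<open>b\<close> and
    \<open>q\<close>, the vector \<open>u\<close> has the sine as its length. So \<open>S\<close>
    shears by minus the tangent of the half angle, which is sine / (1 + cosine), and
    \<open>S'\<close> shears by the sine.\<close>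
  define S where "S = (\<lambda>x::'a. x + (((-1 / (1 + c)) *\<^sub>R u) \<bullet> x) *\<^sub>R b)"
  define S' where "S' = (\<lambda>x::'a. x + (b \<bullet> x) *\<^sub>R u)"
  have S: "distr lborel borel S = lborel" unfolding S_def
    by (rule lborel_distr_shear[OF b]) (simp add: ub)
  have S': "distr lborel borel S' = lborel" unfolding S'_def
    by (rule lborel_distr_shear'[OF b ub])
  have [measurable]: "S \<in> borel_measurable borel" "S' \<in> borel_measurable borel"
    by (auto simp: S_def S'_def)
  have S_eq: "S x = x - ((u \<bullet> x) / (1 + c)) *\<^sub>R b" for x by (simp add: S_def)
  have S_q: "u \<bullet> S x = u \<bullet> x" "b \<bullet> S x = b \<bullet> x - (u \<bullet> x) / (1 + c)" for x
    by (auto simp: S_eq inner_diff_right ub bb)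
  have S_n: "S x \<bullet> S x = x \<bullet> x - 2 * ((u \<bullet> x) / (1 + c)) * (b \<bullet> x) + ((u \<bullet> x) / (1 + c))\<^sup>2" for x
  proof -
    have "(x - k *\<^sub>R b) \<bullet> (x - k *\<^sub>R b) = x \<bullet> x - 2 * k * (b \<bullet> x) + k\<^sup>2" for k
      by (simp add: inner_diff_left inner_diff_right bb inner_commute[of x b] power2_eq_square algebra_simps)
    then show ?thesis unfolding S_eq .
  qed
  have S'_q: "b \<bullet> S' x = b \<bullet> x" "u \<bullet> S' x = u \<bullet> x + (b \<bullet> x) * (1 - c\<^sup>2)"
    "S' x \<bullet> S' x = x \<bullet> x + 2 * (b \<bullet> x) * (u \<bullet> x) + (b \<bullet> x)\<^sup>2 * (1 - c\<^sup>2)" for x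
    by (auto simp: S'_def inner_add_left inner_add_right ub bb uu inner_commute[of b u] inner_commute[of x b] inner_commute[of x u] power2_eq_square algebra_simps)
  define R where "R = (\<lambda>x. S (S' (S x)))"
  show ?thesis
  proof (rule that[of R])
    show "R \<in> borel_measurable borel" by (simp add: R_def)
    have "distr lborel borel R = distr (distr (distr lborel borel S) borel S') borel S"
      by (simp add: distr_distr R_def comp_def)
    then show "distr lborel borel R = lborel" by (simp add: S S')
    fix x
    have qq: "q \<bullet> y = u \<bullet> y + c * (b \<bullet> y)" for y by (simp add: u_def inner_diff_left)
    \<comment> \<open>Writing \<open>c = e - 1\<close> leaves the single denominator
      \<open>e\<close> for the algebra.\<close>
    define e where "e = 1 + c"
    have e: "e > 0" "c = e - 1" using \<open>1 + c > 0\<close> by (auto simp: e_def)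
    show "q \<bullet> R x = b \<bullet> x" unfolding R_def qq S_q S'_q using e(1)
      by (simp add: e(2) field_simps power2_eq_square)
    have "R x \<bullet> R x = x \<bullet> x" unfolding R_def S_n S_q S'_q using e(1)
      by (simp add: e(2) field_simps power2_eq_square)
    then show "norm (R x) = norm x" by (simp add: norm_eq_sqrt_inner)
  qed
qed

text \<open>The quadratic condition says that the part of \<open>x\<close> orthogonal to
  \<open>b\<close> has norm at most \<open>r * (b \<bullet> x)\<close>, so the slice at height
  \<open>s\<close> is a ball of radius \<open>r * s\<close> in one dimension less. Integrating the
  slice volumes over the height gives the formula.\<close>

lemma emeasure_cone_basis:
  fixes b :: "'a::euclidean_space"
  assumes b: "b \<in> Basis" and r: "r > 0" and H: "H > 0"
  shows "emeasure lborel {x. 0 < b \<bullet> x \<and> b \<bullet> x < H \<and> (norm x)\<^sup>2 \<le> (1 + r\<^sup>2) * (b \<bullet> x)\<^sup>2} =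
     ennreal (unit_ball_vol (real DIM('a) - 1) * r ^ (DIM('a) - 1) * H ^ DIM('a) / DIM('a))"
    (is "emeasure lborel ?C = _")
proof -
  let ?n = "DIM('a) - 1" let ?K = "unit_ball_vol (real DIM('a) - 1)"
  let ?R = "\<lambda>g. \<Sum>i\<in>Basis-{b}. g i *\<^sub>R i"
  let ?P = "\<Pi>\<^sub>M i\<in>Basis-{b}. (lborel :: real measure)"
  have card: "card (Basis - {b}) = ?n" using b by simp
  have n1: "real ?n = real DIM('a) - 1" using DIM_positive[where 'a='a] by linarith
  have Suc: "Suc ?n = DIM('a)" using DIM_positive[where 'a='a] by linarith
  have [measurable]: "?C \<in> sets borel" by measurable
  have bR: "b \<bullet> ?R g = 0" for g unfolding inner_sum_right
    using b by (intro sum.neutral) (auto simp: inner_Basis)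
  have iR: "i \<bullet> ?R g = g i" if "i \<in> Basis - {b}" for i g
  proof -
    have "i \<bullet> ?R g = (\<Sum>j\<in>Basis-{b}. if j = i then g i else 0)"
      unfolding inner_sum_right using that by (intro sum.cong) (auto simp: inner_Basis)
    then show ?thesis using that by simp
  qed
  have RR: "?R g \<bullet> ?R g = (\<Sum>i\<in>Basis-{b}. (g i)\<^sup>2)" for g
    by (subst inner_sum_left) (simp add: iR power2_eq_square)
  have nrm: "(norm (s *\<^sub>R b + ?R g))\<^sup>2 = s\<^sup>2 + (\<Sum>i\<in>Basis-{b}. (g i)\<^sup>2)" for s g
  proof -
    have "(norm (s *\<^sub>R b + ?R g))\<^sup>2 = s * s * (b \<bullet> b) + 2 * s * (b \<bullet> ?R g) + ?R g \<bullet> ?R g"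
      unfolding power2_norm_eq_inner inner_add_left inner_add_right
      by (simp add: inner_commute[of "?R g" b])
    then show ?thesis using b unfolding bR RR by (simp add: power2_eq_square)
  qed
  have "emeasure lborel ?C = (\<integral>\<^sup>+x. indicator ?C x \<partial>lborel)" by simp
  also have "\<dots> = (\<integral>\<^sup>+s. \<integral>\<^sup>+g. indicator ?C (s *\<^sub>R b + ?R g) \<partial>?P \<partial>lborel)"
    by (rule nn_integral_lborel_split(2)[OF b]) measurable
  also have "\<dots> = (\<integral>\<^sup>+s. ennreal (?K * r ^ ?n * s ^ ?n) * indicator {0..H} s \<partial>lborel)"
  proof (rule nn_integral_cong_AE, rule AE_mp[OF AE_lborel_singleton[of 0]], rule AE_mp[OF AE_lborel_singleton[of H]], intro AE_I2 impI)
    \<comment> \<open>The slices at \<open>0\<close> and \<open>H\<close> are empty although the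
      right side is taken on the closed interval; these two heights are null.\<close>
    fix s :: real assume s: "s \<noteq> 0" "s \<noteq> H"
    show "(\<integral>\<^sup>+g. indicator ?C (s *\<^sub>R b + ?R g) \<partial>?P) = ennreal (?K * r ^ ?n * s ^ ?n) * indicator {0..H} s"
    proof (cases "0 < s \<and> s < H")
      case True
      have "(\<integral>\<^sup>+g. indicator ?C (s *\<^sub>R b + ?R g) \<partial>?P) =
          (\<integral>\<^sup>+g. indicator ({f. sqrt (\<Sum>i\<in>Basis-{b}. (f i)\<^sup>2) \<le> r * s} \<inter> space ?P) g \<partial>?P)"
      proof (rule nn_integral_cong)
        fix g assume "g \<in> space ?P"
        have "(\<Sum>i\<in>Basis - {b}. (g i)\<^sup>2) \<le> r\<^sup>2 * s\<^sup>2 \<longleftrightarrow> sqrt (\<Sum>i\<in>Basis-{b}. (g i)\<^sup>2) \<le> r * s"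
          using True r by (simp add: real_sqrt_le_iff' sum_nonneg power_mult_distrib)
        then show "indicator ?C (s *\<^sub>R b + ?R g) = (indicator ({f. sqrt (\<Sum>i\<in>Basis-{b}. (f i)\<^sup>2) \<le> r * s} \<inter> space ?P) g :: ennreal)"
          using True b \<open>g \<in> space ?P\<close>
          by (simp add: indicator_def inner_add_right bR nrm distrib_right)
      qed
      also have "\<dots> = emeasure ?P ({f. sqrt (\<Sum>i\<in>Basis-{b}. (f i)\<^sup>2) \<le> r * s} \<inter> space ?P)"
        by (rule nn_integral_indicator) measurable
      also have "\<dots> = ennreal (?K * (r * s) ^ ?n)"
        using emeasure_cball_aux[of "Basis - {b}" "r * s"] True r by (simp only: card n1) auto
      finally show ?thesis using True by (simp add: power_mult_distrib mult_ac)
    next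
      case False
      then have "s \<notin> {0..H}" "\<And>g. s *\<^sub>R b + ?R g \<notin> ?C" using s b by (auto simp: inner_add_right bR)
      then show ?thesis by simp
    qed
  qed
  also have "\<dots> = ennreal (?K * r ^ ?n * H ^ Suc ?n / Suc ?n - ?K * r ^ ?n * 0 ^ Suc ?n / Suc ?n)"
  proof (rule nn_integral_FTC_Icc[where F="\<lambda>s. ?K * r ^ ?n * s ^ Suc ?n / Suc ?n"])
    fix s :: real assume s: "s \<in> {0..H}"
    show "((\<lambda>s. ?K * r ^ ?n * s ^ Suc ?n / Suc ?n) has_real_derivative ?K * r ^ ?n * s ^ ?n) (at s)"
      by (auto intro!: derivative_eq_intros simp del: power_Suc of_nat_Suc)
    show "0 \<le> ?K * r ^ ?n * s ^ ?n" using s r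
      by (auto intro!: mult_nonneg_nonneg unit_ball_vol_nonneg simp: n1[symmetric] simp del: of_nat_diff)
  qed (use H in auto)
  finally show ?thesis unfolding Suc using DIM_positive[where 'a='a] by (simp add: power_0_left)
qed

lemma emeasure_cone:
  fixes q :: "'a::euclidean_space"
  assumes d: "DIM('a) \<ge> 2" and q: "norm q = 1" and r: "r > 0" and H: "H > 0"
  shows "emeasure lborel {x. 0 < q \<bullet> x \<and> q \<bullet> x < H \<and> (norm x)\<^sup>2 \<le> (1 + r\<^sup>2) * (q \<bullet> x)\<^sup>2} =
     ennreal (unit_ball_vol (real DIM('a) - 1) * r ^ (DIM('a) - 1) * H ^ DIM('a) / DIM('a))"
    (is "emeasure lborel ?C = _")
proof -
  \<comment> \<open>In dimension at least 2 some basis vector differs from \<open>- q\<close>, the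
    one position that the rotation excludes.\<close>
  have "\<not> Basis \<subseteq> {- q}" using card_mono[of "{-q}" Basis] d by auto
  then obtain b where b: "b \<in> Basis" "q \<noteq> - b" by force
  obtain R where R: "R \<in> borel_measurable borel" "distr lborel borel R = lborel"
    "\<And>x. q \<bullet> R x = b \<bullet> x" "\<And>x. norm (R x) = norm x" using lborel_rotation[OF b(1) q b(2)] by blast
  have C: "?C \<in> sets borel" by measurable
  have "emeasure lborel ?C = emeasure (distr lborel borel R) ?C" using R(2) by simp
  also have "\<dots> = emeasure lborel (R -` ?C)"
    using R(1) C by (subst emeasure_distr) auto
  also have "R -` ?C = {x. 0 < b \<bullet> x \<and> b \<bullet> x < H \<and> (norm x)\<^sup>2 \<le> (1 + r\<^sup>2) * (b \<bullet> x)\<^sup>2}"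
    by (auto simp: R(3,4))
  finally show ?thesis using emeasure_cone_basis[OF b(1) r H] by simp
qed

section \<open>Surface measure and the area of small caps\<close>

lemma sets_sphere_surface [simp, measurable_cong]:
  "sets (sphere_surface :: 'a::euclidean_space measure) = sets borel"
  by (simp add: sphere_surface_def)

lemma space_sphere_surface [simp]: "space (sphere_surface :: 'a::euclidean_space measure) = UNIV"
  by (simp add: sphere_surface_def space_scale_measure)

lemma emeasure_sphere_surface:
  assumes [measurable]: "A \<in> sets borel"
  shows "emeasure (sphere_surface :: 'a::euclidean_space measure) A =
    of_nat DIM('a) * emeasure lborel {x \<in> ball 0 1. x /\<^sub>R norm x \<in> A}"
proof -
  have "(\<lambda>x. x /\<^sub>R norm x) -` A \<inter> ball 0 1 = {x \<in> ball 0 1. x /\<^sub>R norm x \<in> A}" by auto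
  moreover have "(\<lambda>x::'a. x /\<^sub>R norm x) \<in> borel_measurable (restrict_space lborel (ball 0 1))"
    by (intro measurable_restrict_space1) measurable
  ultimately show ?thesis
    by (simp add: sphere_surface_def emeasure_distr space_restrict_space, subst emeasure_restrict_space) auto
qed

text \<open>Normalisation fails only at the origin, which division by zero sends to 0, and a point
  is null.\<close>

lemma AE_sphere_surface: "AE x in (sphere_surface :: 'a::euclidean_space measure). x \<in> sphere 0 1"
proof (rule AE_I)
  show "emeasure sphere_surface (- sphere (0::'a) 1) = 0"
  proof -
    have "{x \<in> ball 0 1. x /\<^sub>R norm x \<in> - sphere (0::'a) 1} \<subseteq> {0}"
      by (auto simp: field_simps)
    then have "emeasure lborel {x \<in> ball 0 1. x /\<^sub>R norm x \<in> - sphere (0::'a) 1} \<le> emeasure lborel {0::'a}"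
      by (rule emeasure_mono) simp
    then show ?thesis by (simp add: emeasure_sphere_surface)
  qed
qed auto

lemma finite_measure_sphere_surface: "finite_measure (sphere_surface :: 'a::euclidean_space measure)"
proof
  have "emeasure (sphere_surface :: 'a measure) UNIV \<le> of_nat DIM('a) * emeasure lborel (ball (0::'a) 1)"
    by (auto simp: emeasure_sphere_surface intro!: mult_left_mono emeasure_mono)
  also have "\<dots> < \<top>" using emeasure_lborel_ball_finite[of "0::'a" 1]
    by (simp add: ennreal_mult_less_top of_nat_less_top)
  finally show "emeasure (sphere_surface :: 'a measure) (space sphere_surface) \<noteq> \<infinity>" by simp
qed

text \<open>The area of the cap is \<open>DIM('a)\<close> times the volume of the sector
  \<open>D\<close> of the unit ball that it spans. The sector lies between two cones with flat
  bases, of heights \<open>1 - t\<close> and \<open>1\<close>; \<open>s\<close> is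
  \<open>DIM('a)\<close> times the volume of the taller one.\<close>

lemma cap_area_bounds:
  fixes q :: "'a::euclidean_space"
  assumes d: "DIM('a) \<ge> 2" and q: "norm q = 1" and t: "0 < t" "t < 1"
  defines "s \<equiv> unit_ball_vol (real DIM('a) - 1) * ((1 / (1 - t)\<^sup>2 - 1) powr ((real DIM('a) - 1) / 2))"
  shows "measure sphere_surface {x. 1 - q \<bullet> x \<le> t} \<le> s"
    and "s * (1 - t) ^ DIM('a) \<le> measure sphere_surface {x. 1 - q \<bullet> x \<le> t}"
proof -
  let ?S = "sphere_surface :: 'a measure"
  interpret finite_measure ?S by (rule finite_measure_sphere_surface)
  define A where "A = {x. 1 - q \<bullet> x \<le> t}"
  define D where "D = {x \<in> ball 0 1. x /\<^sub>R norm x \<in> A}"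
  \<comment> \<open>\<open>r\<close> is the tangent of the opening angle of the sector, whose cosine
    is \<open>1 - t\<close>.\<close>
  define r where "r = sqrt (1 / (1 - t)\<^sup>2 - 1)"
  define C where "C = (\<lambda>H. {x. 0 < q \<bullet> x \<and> q \<bullet> x < H \<and> (norm x)\<^sup>2 \<le> (1 + r\<^sup>2) * (q \<bullet> x)\<^sup>2})"
  have A[measurable]: "A \<in> sets borel" unfolding A_def by measurable
  have D[measurable]: "D \<in> sets borel" unfolding D_def by measurable
  have C[measurable]: "C H \<in> sets borel" for H unfolding C_def by measurable
  have "(1 - t)\<^sup>2 < 1" using t by (simp add: power_less_one_iff abs_square_less_1)
  then have r2: "1 / (1 - t)\<^sup>2 - 1 > 0" using t by simp
  then have r: "r > 0" "1 + r\<^sup>2 = 1 / (1 - t)\<^sup>2" by (auto simp: r_def)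
  have n1: "real (DIM('a) - 1) = real DIM('a) - 1" using d by linarith
  have rs: "r ^ (DIM('a) - 1) = (1 / (1 - t)\<^sup>2 - 1) powr ((real DIM('a) - 1) / 2)"
    using r r2 by (simp add: powr_realpow[symmetric] n1 r_def powr_half_sqrt[symmetric] powr_powr)
  have cone: "(norm x)\<^sup>2 \<le> (1 + r\<^sup>2) * (q \<bullet> x)\<^sup>2 \<longleftrightarrow> (1 - t) * norm x \<le> q \<bullet> x" if "0 < q \<bullet> x" for x
  proof -
    have "(norm x)\<^sup>2 \<le> (1 + r\<^sup>2) * (q \<bullet> x)\<^sup>2 \<longleftrightarrow> ((1 - t) * norm x)\<^sup>2 \<le> (q \<bullet> x)\<^sup>2"
      unfolding r power_mult_distrib using t by (simp add: pos_le_divide_eq mult.commute)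
    also have "\<dots> \<longleftrightarrow> (1 - t) * norm x \<le> q \<bullet> x"
      using that t by (auto intro: power2_le_imp_le power_mono)
    finally show ?thesis .
  qed
  \<comment> \<open>The origin normalises to 0, which is not in \<open>A\<close> because
    \<open>t < 1\<close>; hence the strict inequality \<open>0 < q \<bullet> x\<close> holds on all
    of \<open>D\<close>.\<close>
  have Dx: "x \<in> D \<longleftrightarrow> norm x < 1 \<and> 0 < q \<bullet> x \<and> (1 - t) * norm x \<le> q \<bullet> x" for x
  proof (cases "x = 0")
    case True
    then show ?thesis using t by (auto simp: D_def A_def)
  next
    case False
    then have "norm x > 0" by simp
    have "0 < q \<bullet> x" if "(1 - t) * norm x \<le> q \<bullet> x"
      by (rule less_le_trans[OF _ that]) (use t \<open>norm x > 0\<close> in auto)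
    moreover have "1 - q \<bullet> (x /\<^sub>R norm x) \<le> t \<longleftrightarrow> (1 - t) * norm x \<le> q \<bullet> x"
      using \<open>norm x > 0\<close> by (simp add: field_simps)
    ultimately show ?thesis by (auto simp: D_def A_def)
  qed
  have "D \<subseteq> C 1"
  proof
    fix x assume "x \<in> D"
    moreover have "q \<bullet> x \<le> norm x" using norm_cauchy_schwarz[of q x] q by simp
    ultimately show "x \<in> C 1" using cone[of x] unfolding Dx C_def by auto
  qed
  moreover have "C (1 - t) \<subseteq> D"
  proof
    fix x assume x: "x \<in> C (1 - t)"
    then have "(1 - t) * norm x \<le> q \<bullet> x" "q \<bullet> x < 1 - t" using cone[of x] by (auto simp: C_def)
    then have "(1 - t) * norm x < (1 - t) * 1" by simp
    then have "norm x < 1" using t by (simp add: mult_less_cancel_left_pos)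
    with x show "x \<in> D" using cone[of x] unfolding Dx C_def by auto
  qed
  ultimately have le: "emeasure lborel (C (1 - t)) \<le> emeasure lborel D" "emeasure lborel D \<le> emeasure lborel (C 1)"
    by (auto intro!: emeasure_mono)
  have s0: "s \<ge> 0" using d by (auto simp: s_def intro!: mult_nonneg_nonneg)
  have vol: "of_nat DIM('a) * emeasure lborel (C H) = ennreal (s * H ^ DIM('a))" if "H > 0" for H
  proof -
    have "of_nat DIM('a) * emeasure lborel (C H) = of_nat DIM('a) * ennreal (s * H ^ DIM('a) / DIM('a))"
      unfolding C_def emeasure_cone[OF d q r(1) that] rs s_def ..
    also have "\<dots> = ennreal (s * H ^ DIM('a))"
      unfolding ennreal_of_nat_eq_real_of_nat using s0 that by (subst ennreal_mult[symmetric]) auto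
    finally show ?thesis .
  qed
  have eq: "ennreal (measure ?S A) = of_nat DIM('a) * emeasure lborel D"
    using emeasure_sphere_surface[OF A] by (simp add: emeasure_eq_measure D_def)
  have "ennreal (measure ?S A) \<le> ennreal (s * 1 ^ DIM('a))"
    unfolding eq vol[OF zero_less_one, symmetric] by (intro mult_left_mono le) auto
  then show "measure ?S {x. 1 - q \<bullet> x \<le> t} \<le> s" using s0 by (simp add: A_def)
  have "ennreal (s * (1 - t) ^ DIM('a)) \<le> ennreal (measure ?S A)"
    unfolding eq using t by (subst vol[symmetric]) (auto intro!: mult_left_mono le)
  then show "s * (1 - t) ^ DIM('a) \<le> measure ?S {x. 1 - q \<bullet> x \<le> t}" by (simp add: A_def)
qed

text \<open>Both bounds of \<open>cap_area_bounds\<close> contain the power of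
  \<open>1 / (1 - t)^2 - 1 = t * (2 - t) / (1 - t)^2\<close>. Dividing by the power of
  \<open>t\<close> leaves a factor tending to a power of 2, and the extra
  \<open>(1 - t) ^ DIM('a)\<close> tends to 1.\<close>

lemma cap_area_asymp:
  fixes q :: "'a::euclidean_space"
  assumes d: "DIM('a) \<ge> 2" and q: "norm q = 1"
  shows "((\<lambda>t. measure sphere_surface {x. 1 - q \<bullet> x \<le> t} / t powr ((real DIM('a) - 1) / 2))
     \<longlongrightarrow> 2 powr ((real DIM('a) - 1) / 2) * unit_ball_vol (real DIM('a) - 1)) (at_right 0)"
proof -
  define p where "p = (real DIM('a) - 1) / 2"
  let ?K = "unit_ball_vol (real DIM('a) - 1)"
  let ?m = "\<lambda>t. measure sphere_surface {x. 1 - q \<bullet> x \<le> t}"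
  let ?g = "\<lambda>t::real. (2 - t) / (1 - t)\<^sup>2"
  have ev: "eventually (\<lambda>t::real. 0 < t \<and> t < 1) (at_right 0)"
    using eventually_at_right_real[of 0 1] by (auto elim!: eventually_mono)
  have key: "(1 / (1 - t)\<^sup>2 - 1) powr p / t powr p = ?g t powr p" if "0 < t" "t < 1" for t :: real
  proof -
    have "1 / (1 - t)\<^sup>2 - 1 = (1 - (1 - t)\<^sup>2) / (1 - t)\<^sup>2" using that by (simp add: diff_divide_distrib)
    also have "1 - (1 - t)\<^sup>2 = t * (2 - t)" by (simp add: power2_eq_square algebra_simps)
    finally have "1 / (1 - t)\<^sup>2 - 1 = t * ?g t" by simp
    then show ?thesis using that by (simp add: powr_mult powr_divide)
  qed
  have g: "((\<lambda>t. ?g t powr p) \<longlongrightarrow> 2 powr p) (at_right 0)"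
  proof -
    have "((\<lambda>t. ?g t powr p) \<longlongrightarrow> ((2 - 0) / (1 - 0)\<^sup>2) powr p) (at_right 0)"
      by (intro tendsto_intros) auto
    then show ?thesis by simp
  qed
  show ?thesis unfolding p_def[symmetric]
  proof (rule tendsto_sandwich)
    show "eventually (\<lambda>t. ?K * ?g t powr p * (1 - t) ^ DIM('a) \<le> ?m t / t powr p) (at_right 0)"
      using ev
    proof eventually_elim
      case (elim t)
      have "?K * ?g t powr p * (1 - t) ^ DIM('a) = (?K * (1 / (1 - t)\<^sup>2 - 1) powr p * (1 - t) ^ DIM('a)) / t powr p"
        using key[of t] elim by (simp add: field_simps)
      also have "\<dots> \<le> ?m t / t powr p"
        using cap_area_bounds(2)[OF d q, of t] elim unfolding p_def by (intro divide_right_mono) auto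
      finally show ?case .
    qed
    show "eventually (\<lambda>t. ?m t / t powr p \<le> ?K * ?g t powr p) (at_right 0)"
      using ev
    proof eventually_elim
      case (elim t)
      have "?m t / t powr p \<le> (?K * (1 / (1 - t)\<^sup>2 - 1) powr p) / t powr p"
        using cap_area_bounds(1)[OF d q, of t] elim unfolding p_def by (intro divide_right_mono) auto
      also have "\<dots> = ?K * ?g t powr p"
        using key[of t] elim by (simp add: field_simps)
      finally show ?case .
    qed
    have "((\<lambda>t. ?K * ?g t powr p * (1 - t) ^ DIM('a)) \<longlongrightarrow> ?K * 2 powr p * (1 - 0) ^ DIM('a)) (at_right 0)"
      by (intro tendsto_intros g)
    then show "((\<lambda>t. ?K * ?g t powr p * (1 - t) ^ DIM('a)) \<longlongrightarrow> 2 powr p * ?K) (at_right 0)"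
      by (simp add: mult.commute)
    have "((\<lambda>t. ?K * ?g t powr p) \<longlongrightarrow> ?K * 2 powr p) (at_right 0)"
      by (intro tendsto_intros g)
    then show "((\<lambda>t. ?K * ?g t powr p) \<longlongrightarrow> 2 powr p * ?K) (at_right 0)"
      by (simp add: mult.commute)
  qed
qed

text \<open>This translates the constant of the theorem, stated by the area of a sphere, into the
  volume of the ball that is the cross-section of the cones.\<close>

lemma sphere_area_eq_unit_ball_vol:
  assumes "m \<ge> 1"
  shows "sphere_area m / real m = unit_ball_vol (real m)"
proof -
  have *: "Gamma (real m / 2 + 1) = real m / 2 * Gamma (real m / 2)"
    using assms by (intro Gamma_plus1) (auto elim!: nonpos_Ints_cases)
  show ?thesis unfolding sphere_area_def unit_ball_vol_def * by (simp add: mult.commute)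
qed

section \<open>Mass of small caps under a continuous density\<close>

lemma C2_on_sphere_continuous:
  assumes "C2_on_sphere \<rho>" shows "continuous_on (sphere 0 1) \<rho>"
proof -
  obtain U g where U: "C2_on U g" "sphere 0 1 \<subseteq> U" "\<forall>x\<in>sphere 0 1. g x = \<rho> x"
    using assms unfolding C2_on_sphere_def by blast
  have "continuous_on U g"
    using U(1) unfolding C2_on_def
    by (intro continuous_at_imp_continuous_on) (auto dest: has_derivative_continuous)
  then have "continuous_on (sphere 0 1) g" using U(2) by (rule continuous_on_subset)
  then show ?thesis using U(3) by (metis (no_types, lifting) continuous_on_cong)
qed

text \<open>Off the sphere \<open>\<rho>\<close> may fail to be measurable, but the complement of the sphere is null.\<close>

lemma density_sphere_surface_restrict:
  fixes \<rho> :: "'a::euclidean_space \<Rightarrow> real"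
  shows "density sphere_surface (\<lambda>x. ennreal (\<rho> x)) =
     density sphere_surface (\<lambda>x. ennreal (indicator (sphere 0 1) x * \<rho> x))"
  \<comment> \<open>The comparison is made on the underlying set functions, where almost everywhere
    equality of the integrands is enough.\<close>
  unfolding density_def
proof (rule arg_cong[where f="measure_of _ _"], rule ext)
  fix A :: "'a set"
  show "(\<integral>\<^sup>+x. ennreal (\<rho> x) * indicator A x \<partial>sphere_surface) =
      (\<integral>\<^sup>+x. ennreal (indicator (sphere 0 1) x * \<rho> x) * indicator A x \<partial>sphere_surface)"
    by (rule nn_integral_cong_AE, rule AE_mp[OF AE_sphere_surface]) (simp add: indicator_def)
qed

text \<open>On the sphere \<open>(dist x q)^2 = 2 * (1 - q \<bullet> x)\<close>, so the caps shrink
  to \<open>q\<close>. By continuity \<open>\<rho>\<close> is eventually within \<open>e\<close> of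
  \<open>\<rho> q\<close> on the cap, and the mass differs from \<open>\<rho> q\<close> times the
  area by at most \<open>e\<close> times the area.\<close>

lemma cap_density_asymp:
  fixes q :: "'a::euclidean_space"
  assumes d: "DIM('a) \<ge> 2" and q: "q \<in> sphere 0 1" and rho0: "\<forall>x\<in>sphere 0 1. \<rho> x \<ge> 0"
    and cont: "continuous_on (sphere 0 1) \<rho>"
  shows "((\<lambda>t. measure (density sphere_surface (\<lambda>x. ennreal (\<rho> x))) {x. 1 - q \<bullet> x \<le> t}
           / t powr ((real DIM('a) - 1) / 2))
     \<longlongrightarrow> 2 powr ((real DIM('a) - 1) / 2) * unit_ball_vol (real DIM('a) - 1) * \<rho> q) (at_right 0)"
proof -
  let ?S = "sphere_surface :: 'a measure"
  interpret finite_measure ?S by (rule finite_measure_sphere_surface)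
  define f where "f = (\<lambda>x. indicator (sphere 0 1) x * \<rho> x)"
  define A where "A = (\<lambda>t. {x. 1 - q \<bullet> x \<le> t})"
  define p where "p = (real DIM('a) - 1) / 2"
  let ?m = "\<lambda>t. measure ?S (A t)" and ?\<mu> = "\<lambda>t. measure (density ?S (\<lambda>x. ennreal (f x))) (A t)"
  let ?K = "2 powr p * unit_ball_vol (real DIM('a) - 1)"
  have [measurable]: "A t \<in> sets borel" for t unfolding A_def by measurable
  have f[measurable]: "f \<in> borel_measurable borel"
    using borel_measurable_continuous_on_indicator[OF _ cont] by (simp add: f_def)
  have f0: "f x \<ge> 0" for x using rho0 by (auto simp: f_def indicator_def)
  have nq: "norm q = 1" using q by simp
  have lim: "((\<lambda>t. ?m t / t powr p) \<longlongrightarrow> ?K) (at_right 0)"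
    using cap_area_asymp[OF d nq] by (simp add: A_def p_def)
  have close: "eventually (\<lambda>t. \<bar>?\<mu> t - \<rho> q * ?m t\<bar> \<le> e * ?m t) (at_right 0)" if e: "e > 0" for e
  proof -
    obtain \<delta> where \<delta>: "\<delta> > 0" "\<And>x. x \<in> sphere 0 1 \<Longrightarrow> dist x q < \<delta> \<Longrightarrow> dist (\<rho> x) (\<rho> q) < e"
      using cont q e unfolding continuous_on_iff by meson
    have "eventually (\<lambda>t. 0 < t \<and> t < \<delta>\<^sup>2 / 2) (at_right 0)"
      by (rule eventually_mono[OF eventually_at_right_real[of 0 "\<delta>\<^sup>2 / 2"]]) (use \<delta>(1) in auto)
    then show ?thesis
    proof eventually_elim
      case (elim t)
      have near: "\<bar>f x - \<rho> q\<bar> \<le> e" if "x \<in> sphere 0 1" "x \<in> A t" for x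
      proof -
        have "(dist x q)\<^sup>2 = 2 - 2 * (q \<bullet> x)"
          using that q unfolding dist_norm power2_norm_eq_inner inner_diff_left inner_diff_right
          by (simp add: dot_square_norm inner_commute[of x q])
        also have "\<dots> < \<delta>\<^sup>2" using that(2) elim unfolding A_def by simp
        finally have "dist x q < \<delta>" using \<delta>(1) by (rule power2_less_imp_less[OF _ less_imp_le])
        then show ?thesis using \<delta>(2)[of x] that by (auto simp: f_def dist_real_def)
      qed
      have I: "integrable ?S (\<lambda>x. c * indicator (A t) x)" for c :: real
        by (intro integrable_mult_right integrable_real_indicator) (auto simp: emeasure_eq_measure)
      have If: "integrable ?S (\<lambda>x. f x * indicator (A t) x)"
      proof (rule Bochner_Integration.integrable_bound[OF I[of "\<rho> q + e"]])
        show "AE x in ?S. norm (f x * indicator (A t) x) \<le> norm ((\<rho> q + e) * indicator (A t) x)"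
          using AE_sphere_surface by eventually_elim (use near f0 in \<open>force simp: indicator_def\<close>)
      qed measurable
      have "emeasure (density ?S (\<lambda>x. ennreal (f x))) (A t) = (\<integral>\<^sup>+x. ennreal (f x * indicator (A t) x) \<partial>?S)"
        using f0 by (subst emeasure_density) (auto simp: ennreal_mult' ennreal_indicator)
      also have "\<dots> = ennreal (\<integral>x. f x * indicator (A t) x \<partial>?S)"
        by (rule nn_integral_eq_integral[OF If]) (simp add: f0)
      finally have mu: "?\<mu> t = (\<integral>x. f x * indicator (A t) x \<partial>?S)"
        using f0 by (simp add: measure_def integral_nonneg_AE)
      have "?\<mu> t - \<rho> q * ?m t = (\<integral>x. f x * indicator (A t) x - \<rho> q * indicator (A t) x \<partial>?S)"
        unfolding mu using If I[of "\<rho> q"] by (subst Bochner_Integration.integral_diff) auto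
      also have "\<bar>\<dots>\<bar> \<le> (\<integral>x. \<bar>f x * indicator (A t) x - \<rho> q * indicator (A t) x\<bar> \<partial>?S)"
        by (rule integral_abs_bound)
      also have "\<dots> \<le> (\<integral>x. e * indicator (A t) x \<partial>?S)"
      proof (rule integral_mono_AE)
        show "AE x in ?S. \<bar>f x * indicator (A t) x - \<rho> q * indicator (A t) x\<bar> \<le> e * indicator (A t) x"
          using AE_sphere_surface by eventually_elim (use near in \<open>simp add: indicator_def\<close>)
        show "integrable ?S (\<lambda>x. \<bar>f x * indicator (A t) x - \<rho> q * indicator (A t) x\<bar>)"
          by (intro integrable_abs Bochner_Integration.integrable_diff If I)
      qed (rule I)
      finally show ?case by simp
    qed
  qed
  have "((\<lambda>t. ?\<mu> t / t powr p - \<rho> q * (?m t / t powr p)) \<longlongrightarrow> 0) (at_right 0)"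
  proof (rule tendstoI)
    fix e :: real assume e: "e > 0"
    have K: "?K > 0" using d by simp
    \<comment> \<open>The ratio \<open>?m t / t powr p\<close> tends to \<open>?K\<close> and so is
      eventually below \<open>?K + 1\<close>, which scales the error \<open>e'\<close> back to
      \<open>e\<close>.\<close>
    define e' where "e' = e / (?K + 1)"
    have e': "e' > 0" unfolding e'_def by (rule divide_pos_pos) (use e K in linarith)+
    have "eventually (\<lambda>t. ?m t / t powr p < ?K + 1) (at_right 0)"
      using lim by (rule order_tendstoD) simp
    with close[OF e'] eventually_at_right_less[of 0]
    show "eventually (\<lambda>t. dist (?\<mu> t / t powr p - \<rho> q * (?m t / t powr p)) 0 < e) (at_right 0)"
    proof eventually_elim
      case (elim t)
      have "dist (?\<mu> t / t powr p - \<rho> q * (?m t / t powr p)) 0 = \<bar>?\<mu> t - \<rho> q * ?m t\<bar> / t powr p"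
        using elim by (simp add: dist_real_def flip: diff_divide_distrib)
      also have "\<dots> \<le> e' * ?m t / t powr p" using elim by (intro divide_right_mono) auto
      also have "\<dots> = e' * (?m t / t powr p)" by simp
      also have "\<dots> < e' * (?K + 1)" using elim e' by (intro mult_strict_left_mono)
      also have "\<dots> = e" unfolding e'_def using K by (metis add_pos_pos less_irrefl nonzero_eq_divide_eq zero_less_one)
      finally show ?case .
    qed
  qed
  from tendsto_add[OF this tendsto_mult[OF tendsto_const[of "\<rho> q"] lim]]
  show ?thesis unfolding density_sphere_surface_restrict[of \<rho>]
    by (simp add: A_def f_def p_def mult_ac)
qed

section \<open>Recovering the shares from cell counts\<close>

text \<open>From the number \<open>c j\<close> of weights in the cell between \<open>exp (- h (j + 1))\<close> and \<open>exp (- h j)\<close>,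
  for \<open>j < m\<close>, one recovers the decreasing sequence of weights rounded down to the grid;
  \<open>disc h m c i\<close> is its \<open>i\<close>-th member (from 0), and 0 once the weights have left the grid.\<close>

definition disc :: "real \<Rightarrow> nat \<Rightarrow> (nat \<Rightarrow> nat) \<Rightarrow> nat \<Rightarrow> real" where
  "disc h m c i = Max (insert 0 ((\<lambda>j. exp (- h * (real j + 1))) ` {j. j < m \<and> i < (\<Sum>l\<le>j. c l)}))"

definition disc_share :: "real \<Rightarrow> nat \<Rightarrow> (nat \<Rightarrow> nat) \<Rightarrow> nat \<Rightarrow> real" where
  "disc_share h m c i = disc h m c i / (\<Sum>i'<(\<Sum>l<m. c l). disc h m c i')"

text \<open>Cell 0 has no upper end: it thus contains the weight 1, and the cells up to
  \<open>j\<close> together form a full half-line. The others are half-open and so pairwise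
  disjoint.\<close>

definition wcell :: "real \<Rightarrow> nat \<Rightarrow> real set" where
  "wcell h j = {x. exp (- h * (real j + 1)) \<le> x \<and> (j \<noteq> 0 \<longrightarrow> x < exp (- h * real j))}"

text \<open>Summability is asked of the square roots, the quantity that bounds the tail; since the
  weights are at most 1, it implies that of \<open>w\<close>. Positivity of \<open>w 0\<close> keeps
  the total positive.\<close>

definition weight_seq :: "(nat \<Rightarrow> real) \<Rightarrow> bool" where
  "weight_seq w \<longleftrightarrow> antimono w \<and> (\<forall>i. 0 \<le> w i \<and> w i \<le> 1) \<and> summable (\<lambda>i. sqrt (w i)) \<and> w 0 > 0"

lemma disc_cong:
  assumes "\<And>j. j < m \<Longrightarrow> c j = c' j" shows "disc h m c = disc h m c'"
proof
  fix i
  have "(\<Sum>l\<le>j. c l) = (\<Sum>l\<le>j. c' l)" if "j < m" for j using that assms by (intro sum.cong) auto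
  then have "{j. j < m \<and> i < (\<Sum>l\<le>j. c l)} = {j. j < m \<and> i < (\<Sum>l\<le>j. c' l)}" by auto
  then show "disc h m c i = disc h m c' i" unfolding disc_def by metis
qed

lemma disc_share_cong:
  assumes "\<And>j. j < m \<Longrightarrow> c j = c' j" shows "disc_share h m c = disc_share h m c'"
proof -
  have S: "(\<Sum>l<m. c l) = (\<Sum>l<m. c' l)" using assms by (intro sum.cong) auto
  have "disc h m c = disc h m c'" using assms by (rule disc_cong)
  then show ?thesis unfolding disc_share_def fun_eq_iff S by simp
qed

lemma disc_nonneg: "0 \<le> disc h m c i"
  unfolding disc_def by (rule Max_ge) auto

lemma disc_eq_0: "disc h m c i = 0" if "i \<ge> (\<Sum>l<m. c l)"
proof -
  have "(\<Sum>l\<le>j. c l) \<le> i" if "j < m" for j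
    using sum_mono2[of "{..<m}" "{..j}" c] that \<open>i \<ge> _\<close> by force
  then have *: "{j. j < m \<and> i < (\<Sum>l\<le>j. c l)} = {}" by (auto simp: not_less[symmetric])
  show ?thesis unfolding disc_def * by simp
qed

text \<open>This holds for arbitrary \<open>c\<close>, even with total 0, where division by zero
  gives 0. Grid shares therefore stay in the cube whether or not the counts come from a weight
  sequence.\<close>

lemma disc_share_bounds: "0 \<le> disc_share h m c i" "disc_share h m c i \<le> 1"
proof -
  let ?S = "\<Sum>i'<(\<Sum>l<m. c l). disc h m c i'"
  have S: "0 \<le> ?S" by (intro sum_nonneg disc_nonneg)
  then show "0 \<le> disc_share h m c i" unfolding disc_share_def by (intro divide_nonneg_nonneg disc_nonneg)
  have "disc h m c i \<le> ?S"
  proof (cases "i < (\<Sum>l<m. c l)")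
    case True
    then show ?thesis by (intro member_le_sum disc_nonneg) auto
  next
    case False
    then show ?thesis using S by (simp add: disc_eq_0)
  qed
  then show "disc_share h m c i \<le> 1" unfolding disc_share_def using S
    by (auto simp: divide_le_eq_1 order.order_iff_strict[of 0])
qed

lemma weight_seq_summable:
  assumes "weight_seq w" shows "summable w"
proof (rule summable_comparison_test')
  show "summable (\<lambda>i. sqrt (w i))" using assms by (simp add: weight_seq_def)
  show "norm (w i) \<le> sqrt (w i)" for i
  proof -
    have "0 \<le> w i" "w i \<le> 1" using assms by (auto simp: weight_seq_def)
    then have "w i * w i \<le> w i" by (simp add: mult_left_le)
    then show ?thesis using \<open>0 \<le> w i\<close> by (simp add: real_le_rsqrt power2_eq_square)
  qed
qed

lemma finite_weight_ge:
  assumes "weight_seq w" "t > 0" shows "finite {i. t \<le> w i}"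
proof -
  have "w \<longlonglongrightarrow> 0" using weight_seq_summable[OF assms(1)] by (rule summable_LIMSEQ_zero)
  then have "eventually (\<lambda>i. w i < t) sequentially" using assms(2) by (rule order_tendstoD)
  then obtain N where "\<And>i. i \<ge> N \<Longrightarrow> w i < t" by (auto simp: eventually_sequentially)
  then have "{i. t \<le> w i} \<subseteq> {..<N}" by (force simp: not_le[symmetric])
  then show ?thesis by (rule finite_subset) simp
qed

lemma wcell_disjoint:
  assumes "h > 0" "x \<in> wcell h j" "x \<in> wcell h l" shows "j = l"
proof -
  have False if "a < b" "x \<in> wcell h a" "x \<in> wcell h b" for a b
  proof -
    have "exp (- h * (real a + 1)) \<le> x" "x < exp (- h * real b)" using that by (auto simp: wcell_def)
    then have "- h * (real a + 1) < - h * real b" by (meson exp_less_cancel_iff le_less_trans)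
    then show False using that(1) assms(1) by (simp add: mult_less_cancel_left_pos)
  qed
  then show ?thesis using assms(2,3) by (meson linorder_neqE_nat)
qed

lemma wcell_UN:
  assumes "h > 0" shows "(\<Union>l\<le>j. wcell h l) = {x. exp (- h * (real j + 1)) \<le> x}"
proof (induction j)
  case 0
  then show ?case by (auto simp: wcell_def)
next
  case (Suc j)
  have "exp (- h * (real (Suc j) + 1)) \<le> exp (- h * (real j + 1))" using assms by simp
  then show ?case unfolding atMost_Suc UN_insert Suc
    by (auto simp: wcell_def add.commute intro: order_trans simp del: exp_le_cancel_iff)
qed

text \<open>As \<open>w\<close> decreases, the indices whose weight reaches a given level form an
  initial segment of the naturals. Its length is the sum of the counts of the cells above that
  level, so membership of \<open>i\<close> is a comparison with this sum.\<close>

lemma cumulative_count: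
  assumes w: "weight_seq w" and h: "h > 0" and c: "\<And>j. j < m \<Longrightarrow> c j = card {i. w i \<in> wcell h j}" and j: "j < m"
  shows "i < (\<Sum>l\<le>j. c l) \<longleftrightarrow> exp (- h * (real j + 1)) \<le> w i"
proof -
  let ?A = "{i. exp (- h * (real j + 1)) \<le> w i}"
  have fin: "finite ?A" by (rule finite_weight_ge[OF w]) simp
  have A: "?A = (\<Union>l\<le>j. {i. w i \<in> wcell h l})" using wcell_UN[OF h, of j] by auto
  have "(\<Sum>l\<le>j. c l) = (\<Sum>l\<le>j. card {i. w i \<in> wcell h l})" using c j by (intro sum.cong) auto
  also have "\<dots> = card ?A" unfolding A
  proof (rule card_UN_disjoint[symmetric])
    show "\<forall>l\<in>{..j}. finite {i. w i \<in> wcell h l}"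
      using fin unfolding A by (auto intro: finite_subset[rotated])
    show "\<forall>a\<in>{..j}. \<forall>b\<in>{..j}. a \<noteq> b \<longrightarrow> {i. w i \<in> wcell h a} \<inter> {i. w i \<in> wcell h b} = {}"
      using wcell_disjoint[OF h] by blast
  qed simp
  finally have S: "(\<Sum>l\<le>j. c l) = card ?A" .
  have down: "i' \<in> ?A" if "i \<in> ?A" "i' \<le> i" for i i'
    using that w by (auto simp: weight_seq_def antimono_def intro: order_trans)
  have "?A = {..<card ?A}"
  proof (cases "?A = {}")
    case False
    have "?A = {..Max ?A}"
      using Max_in[OF fin False] Max_ge[OF fin] down by blast
    then show ?thesis by (metis card_atMost lessThan_Suc_atMost)
  qed simp
  then show ?thesis unfolding S by blast
qed

text \<open>By \<open>cumulative_count\<close>, \<open>disc\<close> selects the largest grid value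
  not above \<open>w i\<close>; neighbouring grid values differ by the factor
  \<open>exp (- h)\<close>.\<close>

lemma disc_bounds:
  assumes w: "weight_seq w" and h: "h > 0" and c: "\<And>j. j < m \<Longrightarrow> c j = card {i. w i \<in> wcell h j}"
  shows "disc h m c i \<le> w i"
    and "m \<ge> 1 \<Longrightarrow> exp (- h * real m) \<le> w i \<Longrightarrow> exp (- h) * w i \<le> disc h m c i"
proof -
  let ?J = "{j. j < m \<and> exp (- h * (real j + 1)) \<le> w i}"
  have D: "disc h m c i = Max (insert 0 ((\<lambda>j. exp (- h * (real j + 1))) ` ?J))"
    unfolding disc_def using cumulative_count[OF w h c, of m] by (metis (no_types, lifting))
  show "disc h m c i \<le> w i" unfolding D using w by (subst Max_le_iff) (auto simp: weight_seq_def)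
  assume m: "m \<ge> 1" and ge: "exp (- h * real m) \<le> w i"
  \<comment> \<open>The least such \<open>j\<close> is the cell of \<open>w i\<close>: failure at
    \<open>j - 1\<close> gives the upper bound \<open>exp (- h * j)\<close>, and for
    \<open>j = 0\<close> that bound is \<open>w i \<le> 1\<close>.\<close>
  define j where "j = (LEAST j. exp (- h * (real j + 1)) \<le> w i)"
  have ex: "exp (- h * (real (m - 1) + 1)) \<le> w i" using m ge by (simp add: of_nat_diff)
  have 1: "exp (- h * (real j + 1)) \<le> w i" unfolding j_def using ex by (rule LeastI)
  have "j \<le> m - 1" unfolding j_def using ex by (rule Least_le)
  then have "j < m" using m by simp
  have "w i \<le> exp (- h * real j)"
  proof (cases j)
    case 0
    then show ?thesis using w by (simp add: weight_seq_def)
  next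
    case (Suc l)
    then have "\<not> exp (- h * (real l + 1)) \<le> w i" unfolding j_def by (intro not_less_Least) simp
    then show ?thesis using Suc by (simp add: add.commute)
  qed
  then have "exp (- h) * w i \<le> exp (- h) * exp (- h * real j)" by simp
  also have "\<dots> = exp (- h * (real j + 1))" by (simp add: algebra_simps flip: exp_add)
  also have "\<dots> \<le> disc h m c i" unfolding D using 1 \<open>j < m\<close> by (intro Max_ge) auto
  finally show "exp (- h) * w i \<le> disc h m c i" .
qed

text \<open>Discretisation loses at most the fraction \<open>h\<close> of the total mass \<open>Z\<close>, plus the weights below
  \<open>exp (- h m)\<close>; each such weight is at most \<open>exp (- h m / 2)\<close> times its square root.\<close>

lemma share_disc_share_diff:
  assumes w: "weight_seq w" and h: "h > 0" and c: "\<And>j. j < m \<Longrightarrow> c j = card {i. w i \<in> wcell h j}" and m: "m \<ge> 1"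
  shows "\<bar>w i / suminf w - disc_share h m c i\<bar> \<le> 2 * h + 2 * exp (- h * real m / 2) * (\<Sum>i. sqrt (w i)) / w 0"
proof -
  let ?d = "disc h m c" and ?Z = "suminf w" and ?q = "exp (- h * real m / 2)"
  have sw: "summable w" and sq: "summable (\<lambda>i. sqrt (w i))" and w0: "w 0 > 0" and wi: "\<And>i. 0 \<le> w i"
    using w weight_seq_summable by (auto simp: weight_seq_def)
  have sd: "summable ?d" by (rule summable_finite[of "{..<(\<Sum>l<m. c l)}"]) (auto simp: disc_eq_0)
  define D where "D = suminf ?d"
  have D: "disc_share h m c i = ?d i / D" unfolding disc_share_def D_def
    by (subst suminf_finite[of "{..<(\<Sum>l<m. c l)}"]) (auto simp: disc_eq_0)
  have Z: "?Z \<ge> w 0" using sum_le_suminf[OF sw, of "{0}"] wi by simp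
  then have Zp: "?Z > 0" using w0 by linarith
  have gap: "w i - ?d i \<le> h * w i + ?q * sqrt (w i)" for i
  proof (cases "exp (- h * real m) \<le> w i")
    case True
    have "1 - h \<le> exp (- h)" using exp_ge_add_one_self[of "-h"] by simp
    then have "(1 - h) * w i \<le> exp (- h) * w i" using wi by (intro mult_right_mono)
    also have "\<dots> \<le> ?d i" using disc_bounds(2)[OF w h c m True] .
    finally have "w i - ?d i \<le> h * w i" by (simp add: algebra_simps)
    also have "\<dots> \<le> h * w i + ?q * sqrt (w i)" using wi by simp
    finally show ?thesis .
  next
    case False
    then have "sqrt (w i) \<le> sqrt (exp (- h * real m))" by simp
    also have "\<dots> = ?q" by (rule real_sqrt_unique) (simp_all add: power2_eq_square flip: exp_add)
    finally have "sqrt (w i) * sqrt (w i) \<le> ?q * sqrt (w i)" using wi by (intro mult_right_mono) auto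
    then have "w i \<le> ?q * sqrt (w i)" using wi by simp
    moreover have "0 \<le> ?d i" "0 \<le> h * w i" using disc_nonneg h wi by auto
    ultimately show ?thesis by linarith
  qed
  have dw: "?d i \<le> w i" for i using disc_bounds(1)[OF w h c] .
  have "?Z - D = (\<Sum>i. w i - ?d i)" unfolding D_def using sw sd by (simp add: suminf_diff)
  also have "\<dots> \<le> (\<Sum>i. h * w i + ?q * sqrt (w i))"
    by (intro suminf_le gap summable_diff summable_add summable_mult sw sd sq)
  also have "\<dots> = h * ?Z + ?q * (\<Sum>i. sqrt (w i))"
    by (simp add: suminf_add[symmetric] suminf_mult summable_mult sw sq)
  finally have ZD: "?Z - D \<le> h * ?Z + ?q * (\<Sum>i. sqrt (w i))" .
  have "w i - ?d i \<le> ?Z - D" unfolding D_def suminf_diff[OF sw sd]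
    using sum_le_suminf[OF summable_diff[OF sw sd], of "{i}"] dw by simp
  moreover have dD: "0 \<le> ?d i" "?d i \<le> D" unfolding D_def
    using sum_le_suminf[OF sd, of "{i}"] disc_nonneg by auto
  moreover have DZ: "0 \<le> D" "D \<le> ?Z" unfolding D_def using suminf_le[OF dw sd sw] suminf_nonneg[OF sd disc_nonneg] by auto
  have frac: "0 \<le> ?d i / D" "?d i / D \<le> 1" using dD DZ by (auto simp: divide_le_eq_1)
  \<comment> \<open>The error of the share splits into that of the numerator and that of the
    denominator, each at most \<open>(?Z - D) / ?Z\<close>. For \<open>D = 0\<close> also
    \<open>?d i = 0\<close>, and the identity survives division by zero.\<close>
  have "w i / ?Z - ?d i / D = (w i - ?d i) / ?Z - (?d i / D) * ((?Z - D) / ?Z)"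
  proof (cases "D = 0")
    case True
    then show ?thesis using dD by simp
  next
    case False
    then show ?thesis using Zp by (simp add: field_simps)
  qed
  moreover have "\<bar>(w i - ?d i) / ?Z\<bar> \<le> (?Z - D) / ?Z"
    using Zp dw[of i] calculation by (simp add: divide_right_mono)
  moreover have "\<bar>(?d i / D) * ((?Z - D) / ?Z)\<bar> \<le> 1 * ((?Z - D) / ?Z)"
    unfolding abs_mult using frac DZ Zp by (intro mult_mono) auto
  ultimately have "\<bar>w i / ?Z - disc_share h m c i\<bar> \<le> 2 * ((?Z - D) / ?Z)" unfolding D by linarith
  also have "\<dots> \<le> 2 * ((h * ?Z + ?q * (\<Sum>i. sqrt (w i))) / ?Z)"
    using ZD Zp by (intro mult_left_mono divide_right_mono) auto
  also have "\<dots> = 2 * h + 2 * ?q * (\<Sum>i. sqrt (w i)) / ?Z" using Zp by (simp add: field_simps)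
  also have "\<dots> \<le> 2 * h + 2 * ?q * (\<Sum>i. sqrt (w i)) / w 0"
    using Z w0 Zp suminf_nonneg[OF sq] wi by (intro add_left_mono divide_left_mono mult_nonneg_nonneg) auto
  finally show ?thesis .
qed

section \<open>From generating functions to convergence of counts\<close>

lemma abs_integral_le:
  fixes f g :: "'a \<Rightarrow> real"
  assumes "integrable M f" "integrable M g" "AE x in M. \<bar>f x\<bar> \<le> g x"
  shows "\<bar>\<integral>x. f x \<partial>M\<bar> \<le> (\<integral>x. g x \<partial>M)"
proof -
  have "\<bar>\<integral>x. f x \<partial>M\<bar> \<le> (\<integral>x. \<bar>f x\<bar> \<partial>M)" by (rule integral_abs_bound)
  also have "\<dots> \<le> (\<integral>x. g x \<partial>M)" using assms by (intro integral_mono_AE) auto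
  finally show ?thesis .
qed

lemma (in prob_space) integrable_bounded:
  fixes f :: "'a \<Rightarrow> real"
  assumes "f \<in> borel_measurable M" "\<And>x. \<bar>f x\<bar> \<le> B"
  shows "integrable M f"
  using assms by (intro integrable_const_bound[where B=B]) auto

text \<open>The outcomes with \<open>N x < c\<close> contribute exactly the sum, and on the others
  the integrand is at most \<open>z ^ c\<close>. The weight \<open>U\<close> will carry the
  remaining coordinates of a count vector.\<close>

lemma (in prob_space) pgf_expansion:
  fixes U :: "'a \<Rightarrow> real" and N :: "'a \<Rightarrow> nat"
  assumes [measurable]: "U \<in> borel_measurable M" "N \<in> measurable M (count_space UNIV)"
    and U: "\<And>x. 0 \<le> U x" "\<And>x. U x \<le> 1" and z: "0 < z" "z < 1"
  shows "\<bar>(\<integral>x. U x * z ^ N x \<partial>M) - (\<Sum>l<c. z ^ l * (\<integral>x. U x * of_bool (N x = l) \<partial>M))\<bar> \<le> z ^ c"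
proof -
  have I1: "integrable M (\<lambda>x. U x * z ^ N x)"
    by (rule integrable_bounded[where B=1], measurable) (use U z in \<open>auto simp: abs_mult intro!: mult_le_one power_le_one\<close>)
  have I2: "integrable M (\<lambda>x. z ^ l * (U x * of_bool (N x = l)))" for l
    by (intro integrable_mult_right integrable_bounded[where B=1], measurable) (use U in auto)
  have "(\<integral>x. U x * z ^ N x \<partial>M) - (\<Sum>l<c. z ^ l * (\<integral>x. U x * of_bool (N x = l) \<partial>M))
     = (\<integral>x. U x * z ^ N x - (\<Sum>l<c. z ^ l * (U x * of_bool (N x = l))) \<partial>M)"
    using I1 I2 by (simp add: Bochner_Integration.integral_diff Bochner_Integration.integral_sum Bochner_Integration.integrable_sum)
  also have "\<bar>\<dots>\<bar> \<le> (\<integral>x. z ^ c \<partial>M)"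
  proof (rule abs_integral_le)
    show "integrable M (\<lambda>x. U x * z ^ N x - (\<Sum>l<c. z ^ l * (U x * of_bool (N x = l))))"
      using I1 I2 by (intro Bochner_Integration.integrable_diff Bochner_Integration.integrable_sum)
    have "\<bar>U x * z ^ N x - (\<Sum>l<c. z ^ l * (U x * of_bool (N x = l)))\<bar> \<le> z ^ c" for x
    proof -
      have "(\<Sum>l<c. z ^ l * (U x * of_bool (N x = l))) = (\<Sum>l<c. if l = N x then z ^ l * U x else 0)"
        by (intro sum.cong) auto
      also have "\<dots> = (if N x < c then U x * z ^ N x else 0)" by simp
      finally have "U x * z ^ N x - (\<Sum>l<c. z ^ l * (U x * of_bool (N x = l))) = (if N x < c then 0 else U x * z ^ N x)"
        by simp
      moreover have "U x * z ^ N x \<le> z ^ c" if "\<not> N x < c"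
        using mult_mono[of "U x" 1 "z ^ N x" "z ^ c"] U[of x] z that by (simp add: power_decreasing)
      ultimately show ?thesis
        using U[of x] z by simp
    qed
    then show "AE x in M. \<bar>U x * z ^ N x - (\<Sum>l<c. z ^ l * (U x * of_bool (N x = l)))\<bar> \<le> z ^ c" by simp
  qed simp
  finally show ?thesis by (simp add: prob_space)
qed

text \<open>By strong induction the lower coefficients converge. Subtracting them and dividing by
  \<open>z ^ c\<close> leaves the coefficient at \<open>c\<close> up to an error \<open>z\<close>,
  by \<open>pgf_expansion\<close> with \<open>Suc c\<close>. This error is uniform in
  \<open>n\<close>, so \<open>z\<close> can be fixed small before \<open>n\<close> grows.\<close>

lemma pgf_tendsto_imp_prob_tendsto:
  fixes U :: "nat \<Rightarrow> 'm \<Rightarrow> real" and V :: "'p \<Rightarrow> real" and N :: "nat \<Rightarrow> 'm \<Rightarrow> nat" and R :: "'p \<Rightarrow> nat"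
  assumes M: "prob_space M" and P: "prob_space P"
    and meas: "\<And>n. U n \<in> borel_measurable M" "\<And>n. N n \<in> measurable M (count_space UNIV)"
      "V \<in> borel_measurable P" "R \<in> measurable P (count_space UNIV)"
    and U: "\<And>n x. 0 \<le> U n x" "\<And>n x. U n x \<le> 1" and V: "\<And>x. 0 \<le> V x" "\<And>x. V x \<le> 1"
    and lim: "\<And>z. 0 < z \<Longrightarrow> z < 1 \<Longrightarrow> (\<lambda>n. \<integral>x. U n x * z ^ N n x \<partial>M) \<longlonglongrightarrow> (\<integral>x. V x * z ^ R x \<partial>P)"
  shows "(\<lambda>n. \<integral>x. U n x * of_bool (N n x = c) \<partial>M) \<longlonglongrightarrow> (\<integral>x. V x * of_bool (R x = c) \<partial>P)"
proof (induction c rule: less_induct)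
  case (less c)
  let ?a = "\<lambda>n l. \<integral>x. U n x * of_bool (N n x = l) \<partial>M" and ?b = "\<lambda>l. \<integral>x. V x * of_bool (R x = l) \<partial>P"
  let ?A = "\<lambda>z n. (\<integral>x. U n x * z ^ N n x \<partial>M) - (\<Sum>l<c. z ^ l * ?a n l)"
  let ?B = "\<lambda>z. (\<integral>x. V x * z ^ R x \<partial>P) - (\<Sum>l<c. z ^ l * ?b l)"
  show ?case
  proof (rule tendstoI)
    fix e :: real assume e: "e > 0"
    \<comment> \<open>The coefficients on both sides are off by at most \<open>z \<le> e / 4\<close>
      each, which leaves \<open>e / 2\<close> for the convergence at this fixed
      \<open>z\<close>.\<close>
    define z where "z = min (1/2) (e / 4)"
    have z: "0 < z" "z < 1" "z \<le> e / 4" using e by (auto simp: z_def)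
    have lA: "(\<lambda>n. ?A z n / z ^ c) \<longlonglongrightarrow> ?B z / z ^ c"
      using z by (intro tendsto_intros lim less) auto
    have gen: "\<bar>a - A / y\<bar> \<le> z" if "\<bar>A - y * a\<bar> \<le> y * z" "y > 0" for a A y
    proof -
      have "\<bar>a - A / y\<bar> = \<bar>A - y * a\<bar> / y"
        using that(2) by (subst abs_div_pos) (auto simp: diff_divide_distrib abs_minus_commute)
      then show ?thesis using that by (simp add: divide_le_eq mult.commute)
    qed
    have close: "\<bar>?a n c - ?A z n / z ^ c\<bar> \<le> z" for n
      using prob_space.pgf_expansion[OF M meas(1,2) U z(1,2), of n n "Suc c"] z(1)
      by (intro gen) (simp_all add: diff_diff_eq mult.commute)
    have close': "\<bar>?b c - ?B z / z ^ c\<bar> \<le> z"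
      using prob_space.pgf_expansion[OF P meas(3,4) V z(1,2), of "Suc c"] z(1)
      by (intro gen) (simp_all add: diff_diff_eq mult.commute)
    have "eventually (\<lambda>n. dist (?A z n / z ^ c) (?B z / z ^ c) < e / 2) sequentially"
      using lA e by (intro tendstoD) auto
    then show "eventually (\<lambda>n. dist (?a n c) (?b c) < e) sequentially"
    proof eventually_elim
      case (elim n)
      then show ?case using close[of n] close' z(3) unfolding dist_real_def by linarith
    qed
  qed
qed

text \<open>One coordinate at a time, a power \<open>z j ^ x j\<close> is exchanged for the
  indicator of \<open>x j = c j\<close>; the other factors lie between 0 and 1 and form the weight
  \<open>U\<close>. The induction keeps \<open>z\<close> arbitrary because each exchange needs the
  limit at all values of the argument \<open>z l\<close>.\<close>

lemma joint_pgf_tendsto_imp_prob_tendsto: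
  fixes C :: "nat \<Rightarrow> 'm \<Rightarrow> nat \<Rightarrow> nat" and R :: "'p \<Rightarrow> nat \<Rightarrow> nat"
  assumes M: "prob_space M" and P: "prob_space P"
    and C: "\<And>n j. (\<lambda>\<omega>. C n \<omega> j) \<in> measurable M (count_space UNIV)"
    and R: "\<And>j. (\<lambda>\<omega>. R \<omega> j) \<in> measurable P (count_space UNIV)"
    and lim: "\<And>z::nat \<Rightarrow> real. (\<And>j. 0 < z j \<and> z j < 1) \<Longrightarrow>
      (\<lambda>n. \<integral>\<omega>. (\<Prod>j<m. z j ^ C n \<omega> j) \<partial>M) \<longlonglongrightarrow> (\<integral>\<omega>. (\<Prod>j<m. z j ^ R \<omega> j) \<partial>P)"
  shows "(\<lambda>n. \<integral>\<omega>. (\<Prod>j<m. of_bool (C n \<omega> j = c j)) \<partial>M) \<longlonglongrightarrow> (\<integral>\<omega>. (\<Prod>j<m. of_bool (R \<omega> j = c j) :: real) \<partial>P)"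
proof -
  note [measurable] = C R
  let ?G = "\<lambda>l z x. (\<Prod>j<l. of_bool (x j = c j)) * (\<Prod>j\<in>{l..<m}. z j ^ x j) :: real"
  have "(\<lambda>n. \<integral>\<omega>. ?G l z (C n \<omega>) \<partial>M) \<longlonglongrightarrow> (\<integral>\<omega>. ?G l z (R \<omega>) \<partial>P)"
    if "l \<le> m" "\<And>j. 0 < z j \<and> z j < 1" for l and z :: "nat \<Rightarrow> real"
    using that
  proof (induction l arbitrary: z)
    case 0
    then show ?case using lim[of z] by (simp add: atLeast0LessThan)
  next
    case (Suc l)
    let ?U = "\<lambda>x. (\<Prod>j<l. of_bool (x j = c j)) * (\<Prod>j\<in>{Suc l..<m}. z j ^ x j) :: real"
    have U: "0 \<le> ?U x" "?U x \<le> 1" for x :: "nat \<Rightarrow> nat"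
    proof -
      have z: "0 \<le> z j ^ x j" "z j ^ x j \<le> 1" for j
        using Suc.prems(2)[of j] by (auto intro: zero_le_power power_le_one)
      show "0 \<le> ?U x" by (intro mult_nonneg_nonneg prod_nonneg) (auto simp: z)
      show "?U x \<le> 1" by (intro mult_le_one prod_nonneg prod_le_1) (auto simp: z)
    qed
    have "(\<lambda>n. \<integral>\<omega>. ?U (C n \<omega>) * of_bool (C n \<omega> l = c l) \<partial>M) \<longlonglongrightarrow> (\<integral>\<omega>. ?U (R \<omega>) * of_bool (R \<omega> l = c l) \<partial>P)"
    proof (rule pgf_tendsto_imp_prob_tendsto[OF M P])
      fix y :: real assume y: "0 < y" "y < 1"
      have eq: "?G l (z(l := y)) x = ?U x * y ^ x l" for x :: "nat \<Rightarrow> nat"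
      proof -
        have "{l..<m} = insert l {Suc l..<m}" using Suc.prems by auto
        moreover have "(\<Prod>j\<in>{Suc l..<m}. (z(l := y)) j ^ x j) = (\<Prod>j\<in>{Suc l..<m}. z j ^ x j)"
          by (intro prod.cong) auto
        ultimately show ?thesis by simp
      qed
      show "(\<lambda>n. \<integral>\<omega>. ?U (C n \<omega>) * y ^ C n \<omega> l \<partial>M) \<longlonglongrightarrow> (\<integral>\<omega>. ?U (R \<omega>) * y ^ R \<omega> l \<partial>P)"
        using Suc.IH[of "z(l := y)"] Suc.prems y unfolding eq by auto
    qed (use U in auto)
    moreover have "?U x * of_bool (x l = c l) = ?G (Suc l) z x" for x :: "nat \<Rightarrow> nat" by simp
    ultimately show ?case by simp
  qed
  from this[of m "\<lambda>_. 1/2"] show ?thesis by simp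
qed

text \<open>The value 0 from \<open>m\<close> on makes the set finite and gives each vector of the
  first \<open>m\<close> counts a single representative.\<close>

definition box_funs :: "nat \<Rightarrow> nat \<Rightarrow> (nat \<Rightarrow> nat) set" where
  "box_funs m b = {c. \<forall>j. if j < m then c j \<le> b else c j = 0}"

lemma finite_box_funs: "finite (box_funs m b)"
proof -
  have "box_funs m b \<subseteq> {f. (\<forall>x. (x \<in> {..<m} \<longrightarrow> f x \<in> {..b}) \<and> (x \<notin> {..<m} \<longrightarrow> f x = 0))}"
    by (auto simp: box_funs_def)
  then show ?thesis by (rule finite_subset) (rule finite_set_of_finite_funs, auto)
qed

lemma sum_box_funs:
  fixes g :: "(nat \<Rightarrow> nat) \<Rightarrow> real"
  assumes g: "\<And>c c'. (\<And>j. j < m \<Longrightarrow> c j = c' j) \<Longrightarrow> g c = g c'"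
  shows "(\<Sum>c\<in>box_funs m b. g c * (\<Prod>j<m. of_bool (x j = c j))) = (if \<forall>j<m. x j \<le> b then g x else 0)"
proof -
  let ?c = "\<lambda>j. if j < m then x j else 0"
  have *: "(\<Prod>j<m. of_bool (x j = c j) :: real) = of_bool (c = ?c)" if "c \<in> box_funs m b" for c
  proof (cases "c = ?c")
    case False
    then obtain j where j: "c j \<noteq> ?c j" by (auto simp: fun_eq_iff)
    moreover have "j < m" using j that unfolding box_funs_def by (cases "j < m") auto
    ultimately have "j < m" "c j \<noteq> x j" by auto
    then show ?thesis using False by (auto intro!: prod_zero bexI[of _ j])
  qed simp
  have "(\<Sum>c\<in>box_funs m b. g c * (\<Prod>j<m. of_bool (x j = c j))) = (\<Sum>c\<in>box_funs m b. if c = ?c then g c else 0)"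
    by (intro sum.cong refl) (simp add: *)
  also have "\<dots> = (if ?c \<in> box_funs m b then g ?c else 0)" by (simp add: finite_box_funs)
  also have "g ?c = g x" by (rule g) simp
  also have "?c \<in> box_funs m b \<longleftrightarrow> (\<forall>j<m. x j \<le> b)" by (auto simp: box_funs_def)
  finally show ?thesis .
qed

text \<open>No measurability of \<open>g\<close> is required: it sees finitely many natural numbers
  only, so \<open>g (C \<omega>)\<close> is a pointwise limit of finite combinations of
  indicators.\<close>

lemma measurable_finite_dependence:
  fixes g :: "(nat \<Rightarrow> nat) \<Rightarrow> real"
  assumes g: "\<And>c c'. (\<And>j. j < m \<Longrightarrow> c j = c' j) \<Longrightarrow> g c = g c'"
    and C[measurable]: "\<And>j. (\<lambda>\<omega>. C \<omega> j) \<in> measurable M (count_space UNIV)"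
  shows "(\<lambda>\<omega>. g (C \<omega>)) \<in> borel_measurable M"
proof (rule borel_measurable_LIMSEQ_real)
  show "(\<lambda>b. \<Sum>c\<in>box_funs m b. g c * (\<Prod>j<m. of_bool (C \<omega> j = c j))) \<longlonglongrightarrow> g (C \<omega>)" for \<omega>
  proof (rule tendsto_eventually, rule eventually_sequentiallyI[of "\<Sum>j<m. C \<omega> j"])
    fix b assume "(\<Sum>j<m. C \<omega> j) \<le> b"
    then have "\<forall>j<m. C \<omega> j \<le> b" by (meson finite_lessThan lessThan_iff member_le_sum order_trans zero_le)
    then show "(\<Sum>c\<in>box_funs m b. g c * (\<Prod>j<m. of_bool (C \<omega> j = c j))) = g (C \<omega>)"
      using sum_box_funs[where g=g and m=m and b=b and x="C \<omega>", OF g] by auto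
  qed
qed measurable

text \<open>The two sides differ only where the counts leave the box; this has probability 1 minus
  the sum of \<open>a\<close> over the box, and there \<open>g\<close> is at most \<open>B\<close>
  in absolute value.\<close>

lemma (in prob_space) expectation_box_funs:
  fixes g :: "(nat \<Rightarrow> nat) \<Rightarrow> real"
  assumes g: "\<And>c c'. (\<And>j. j < m \<Longrightarrow> c j = c' j) \<Longrightarrow> g c = g c'" and B: "\<And>c. \<bar>g c\<bar> \<le> B"
    and C[measurable]: "\<And>j. (\<lambda>\<omega>. C \<omega> j) \<in> measurable M (count_space UNIV)"
  defines "a \<equiv> \<lambda>c. \<integral>\<omega>. (\<Prod>j<m. of_bool (C \<omega> j = c j)) \<partial>M"
  shows "\<bar>(\<integral>\<omega>. g (C \<omega>) \<partial>M) - (\<Sum>c\<in>box_funs m b. g c * a c)\<bar> \<le> B * (1 - (\<Sum>c\<in>box_funs m b. a c))"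
proof -
  let ?E = "\<lambda>x. of_bool (\<forall>j<m. x j \<le> b) :: real"
  have B0: "B \<ge> 0" using B[of undefined] by linarith
  have sum_eq: "(\<Sum>c\<in>box_funs m b. g' c * a c) = (\<integral>\<omega>. g' (C \<omega>) * ?E (C \<omega>) \<partial>M)"
    if g': "\<And>c c'. (\<And>j. j < m \<Longrightarrow> c j = c' j) \<Longrightarrow> g' c = g' c'" for g' :: "(nat \<Rightarrow> nat) \<Rightarrow> real"
  proof -
    have I: "integrable M (\<lambda>\<omega>. g' c * (\<Prod>j<m. of_bool (C \<omega> j = c j)))" for c
      by (intro integrable_mult_right integrable_bounded[where B=1], measurable)
         (auto simp: abs_prod intro!: prod_le_1)
    have "(\<Sum>c\<in>box_funs m b. g' c * a c) = (\<integral>\<omega>. (\<Sum>c\<in>box_funs m b. g' c * (\<Prod>j<m. of_bool (C \<omega> j = c j))) \<partial>M)"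
      unfolding a_def by (subst Bochner_Integration.integral_sum) (use I in auto)
    also have "\<dots> = (\<integral>\<omega>. g' (C \<omega>) * ?E (C \<omega>) \<partial>M)"
      using sum_box_funs[where g=g' and m=m and b=b, OF g'] by (intro Bochner_Integration.integral_cong refl) auto
    finally show ?thesis .
  qed
  have Eg: "\<And>c c'. (\<And>j. j < m \<Longrightarrow> c j = c' j) \<Longrightarrow> ?E c = ?E c'" by auto
  have [measurable]: "(\<lambda>\<omega>. g (C \<omega>)) \<in> borel_measurable M"
    by (rule measurable_finite_dependence[OF g C]) auto
  have [measurable]: "(\<lambda>\<omega>. ?E (C \<omega>)) \<in> borel_measurable M"
    by (rule measurable_finite_dependence[OF Eg C]) auto
  have I: "integrable M (\<lambda>\<omega>. g (C \<omega>))" by (rule integrable_bounded[where B=B]) (auto simp: B)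
  have IE: "integrable M (\<lambda>\<omega>. ?E (C \<omega>))" by (rule integrable_bounded[where B=1]) auto
  have IgE: "integrable M (\<lambda>\<omega>. g (C \<omega>) * ?E (C \<omega>))"
    by (rule integrable_bounded[where B=B]) (use B B0 in auto)
  have "(\<integral>\<omega>. g (C \<omega>) \<partial>M) - (\<Sum>c\<in>box_funs m b. g c * a c) = (\<integral>\<omega>. g (C \<omega>) - g (C \<omega>) * ?E (C \<omega>) \<partial>M)"
    using sum_eq[OF g] I IgE by simp
  also have "\<bar>\<dots>\<bar> \<le> (\<integral>\<omega>. B * (1 - ?E (C \<omega>)) \<partial>M)"
    by (rule abs_integral_le) (use I IE IgE B in auto)
  also have "\<dots> = B * (1 - (\<Sum>c\<in>box_funs m b. a c))"
    using sum_eq[of "\<lambda>_. 1"] IE by (simp add: prob_space)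
  finally show ?thesis .
qed

text \<open>Tightness comes from the limit: a box that carries almost all of its mass carries, by
  convergence of finitely many probabilities, almost all of the mass for large \<open>n\<close>
  too.\<close>

lemma prob_tendsto_imp_expectation_tendsto:
  fixes C :: "nat \<Rightarrow> 'm \<Rightarrow> nat \<Rightarrow> nat" and R :: "'p \<Rightarrow> nat \<Rightarrow> nat" and g :: "(nat \<Rightarrow> nat) \<Rightarrow> real"
  assumes M: "prob_space M" and P: "prob_space P"
    and C: "\<And>n j. (\<lambda>\<omega>. C n \<omega> j) \<in> measurable M (count_space UNIV)"
    and R: "\<And>j. (\<lambda>\<omega>. R \<omega> j) \<in> measurable P (count_space UNIV)"
    and lim: "\<And>c. (\<lambda>n. \<integral>\<omega>. (\<Prod>j<m. of_bool (C n \<omega> j = c j)) \<partial>M)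
        \<longlonglongrightarrow> (\<integral>\<omega>. (\<Prod>j<m. of_bool (R \<omega> j = c j) :: real) \<partial>P)"
    and g: "\<And>c c'. (\<And>j. j < m \<Longrightarrow> c j = c' j) \<Longrightarrow> g c = g c'" and B: "\<And>c. \<bar>g c\<bar> \<le> B"
  shows "(\<lambda>n. \<integral>\<omega>. g (C n \<omega>) \<partial>M) \<longlonglongrightarrow> (\<integral>\<omega>. g (R \<omega>) \<partial>P)"
proof (rule tendstoI)
  fix e :: real assume e: "e > 0"
  interpret P: prob_space P by fact
  note [measurable] = C R
  let ?a = "\<lambda>n c. \<integral>\<omega>. (\<Prod>j<m. of_bool (C n \<omega> j = c j)) \<partial>M :: real"
  let ?r = "\<lambda>c. \<integral>\<omega>. (\<Prod>j<m. of_bool (R \<omega> j = c j)) \<partial>P :: real"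
  have B0: "B \<ge> 0" using B[of undefined] by linarith
  have "(\<lambda>b. \<Sum>c\<in>box_funs m b. ?r c) \<longlonglongrightarrow> 1"
  proof -
    have eq: "(\<Sum>c\<in>box_funs m b. ?r c) = (\<integral>\<omega>. of_bool (\<forall>j<m. R \<omega> j \<le> b) \<partial>P)" for b
    proof -
      have I: "integrable P (\<lambda>\<omega>. \<Prod>j<m. of_bool (R \<omega> j = c j) :: real)" for c
        by (intro P.integrable_bounded[where B=1], measurable) (auto simp: abs_prod intro!: prod_le_1)
      have "(\<Sum>c\<in>box_funs m b. ?r c) = (\<integral>\<omega>. (\<Sum>c\<in>box_funs m b. 1 * (\<Prod>j<m. of_bool (R \<omega> j = c j))) \<partial>P)"
        by (subst Bochner_Integration.integral_sum) (use I in auto)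
      also have "\<dots> = (\<integral>\<omega>. of_bool (\<forall>j<m. R \<omega> j \<le> b) \<partial>P)"
        using sum_box_funs[of m "\<lambda>_. 1"] by (intro Bochner_Integration.integral_cong refl) auto
      finally show ?thesis .
    qed
    have "(\<lambda>b. \<integral>\<omega>. of_bool (\<forall>j<m. R \<omega> j \<le> b) \<partial>P) \<longlonglongrightarrow> (\<integral>\<omega>. (1::real) \<partial>P)"
    proof (rule integral_dominated_convergence[where w="\<lambda>_. 1"])
      show "AE \<omega> in P. (\<lambda>b. of_bool (\<forall>j<m. R \<omega> j \<le> b) :: real) \<longlonglongrightarrow> 1"
      proof (rule AE_I2, rule tendsto_eventually)
        fix \<omega>
        show "eventually (\<lambda>b. of_bool (\<forall>j<m. R \<omega> j \<le> b) = (1::real)) sequentially"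
        proof (rule eventually_sequentiallyI[of "\<Sum>j<m. R \<omega> j"])
          fix b assume "(\<Sum>j<m. R \<omega> j) \<le> b"
          then have "\<forall>j<m. R \<omega> j \<le> b" by (meson finite_lessThan lessThan_iff member_le_sum order_trans zero_le)
          then show "of_bool (\<forall>j<m. R \<omega> j \<le> b) = (1::real)" by simp
        qed
      qed
    qed auto
    then show ?thesis by (simp add: eq P.prob_space)
  qed
  \<comment> \<open>The denominator has \<open>B + 1\<close> rather than \<open>B\<close> so that
    \<open>B = 0\<close> is covered.\<close>
  then have "eventually (\<lambda>b. (\<Sum>c\<in>box_funs m b. ?r c) > 1 - e / (4 * (B + 1))) sequentially"
    by (rule order_tendstoD) (use e B0 in simp)
  then obtain b where b: "(\<Sum>c\<in>box_funs m b. ?r c) > 1 - e / (4 * (B + 1))"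
    by (auto simp: eventually_sequentially)
  have bound: "B * (1 - s) \<le> e / 4" if "s > 1 - e / (4 * (B + 1))" for s
  proof -
    have "B * (1 - s) \<le> B * (e / (4 * (B + 1)))" using that B0 by (intro mult_left_mono) auto
    also have "\<dots> = (B / (B + 1)) * (e / 4)" by simp
    also have "\<dots> \<le> 1 * (e / 4)" using B0 e by (intro mult_right_mono) auto
    finally show ?thesis by simp
  qed
  have "(\<lambda>n. \<Sum>c\<in>box_funs m b. ?a n c) \<longlonglongrightarrow> (\<Sum>c\<in>box_funs m b. ?r c)" by (intro tendsto_sum lim)
  then have 1: "eventually (\<lambda>n. (\<Sum>c\<in>box_funs m b. ?a n c) > 1 - e / (4 * (B + 1))) sequentially"
    using b by (rule order_tendstoD)
  have "(\<lambda>n. \<Sum>c\<in>box_funs m b. g c * ?a n c) \<longlonglongrightarrow> (\<Sum>c\<in>box_funs m b. g c * ?r c)"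
    by (intro tendsto_sum tendsto_mult_left lim)
  then have 2: "eventually (\<lambda>n. dist (\<Sum>c\<in>box_funs m b. g c * ?a n c) (\<Sum>c\<in>box_funs m b. g c * ?r c) < e / 2) sequentially"
    using e by (intro tendstoD) auto
  have R_close: "\<bar>(\<integral>\<omega>. g (R \<omega>) \<partial>P) - (\<Sum>c\<in>box_funs m b. g c * ?r c)\<bar> \<le> e / 4"
    using P.expectation_box_funs[of m g B R, OF g B R, where b=b] bound[OF b] by auto
  from 1 2 show "eventually (\<lambda>n. dist (\<integral>\<omega>. g (C n \<omega>) \<partial>M) (\<integral>\<omega>. g (R \<omega>) \<partial>P) < e) sequentially"
  proof eventually_elim
    case (elim n)
    have "\<bar>(\<integral>\<omega>. g (C n \<omega>) \<partial>M) - (\<Sum>c\<in>box_funs m b. g c * ?a n c)\<bar> \<le> e / 4"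
      using prob_space.expectation_box_funs[of M m g B "C n", OF M g B C, where b=b] bound[OF elim(1)] by auto
    with R_close elim(2) show ?case unfolding dist_real_def by linarith
  qed
qed

section \<open>The Poisson process\<close>

text \<open>The preimage of \<open>wcell\<close> under \<open>y \<mapsto> exp (- y)\<close> on the
  nonnegative reals: half-open cells of length \<open>h\<close>, with cell 0 closed at 0. They are
  written as differences because the laws are known on intervals \<open>{0..y}\<close>.\<close>

definition ycell :: "real \<Rightarrow> nat \<Rightarrow> real set" where
  "ycell h j = {0..h * (real j + 1)} - (if j = 0 then {} else {0..h * real j})"

lemma exp_in_wcell_iff:
  assumes "y \<ge> 0" shows "exp (- y) \<in> wcell h j \<longleftrightarrow> y \<in> ycell h j"
  using assms by (auto simp: wcell_def ycell_def not_le)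

lemma ycell_nonneg: "x \<in> ycell h j \<Longrightarrow> 0 \<le> x"
  by (auto simp: ycell_def)

lemma ycell_disjoint:
  assumes "h > 0" shows "disjoint_family_on (ycell h) J"
  unfolding disjoint_family_on_def
proof (intro ballI impI)
  fix a b :: nat assume "a \<noteq> b"
  have "a = b" if "x \<in> ycell h a" "x \<in> ycell h b" for x
    using wcell_disjoint[OF assms, of "exp (- x)" a b] exp_in_wcell_iff ycell_nonneg that by blast
  with \<open>a \<noteq> b\<close> show "ycell h a \<inter> ycell h b = {}" by blast
qed

lemma ycell_borel [measurable, simp]: "ycell h j \<in> sets borel"
  by (simp add: ycell_def)

lemma measure_ycell:
  assumes h: "h > 0" and s: "sets N = sets borel" and fin: "\<And>y. y > 0 \<Longrightarrow> emeasure N {0..y} \<noteq> \<infinity>"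
  shows "measure N (ycell h j) = measure N {0..h * (real j + 1)} - (if j = 0 then 0 else measure N {0..h * real j})"
proof (cases "j = 0")
  case False
  have "0 < h * (real j + 1)" using h by simp
  then have "measure N ({0..h * (real j + 1)} - {0..h * real j}) = measure N {0..h * (real j + 1)} - measure N {0..h * real j}"
    using h by (intro measure_Diff fin) (auto simp: s intro: mult_left_mono order_trans)
  then show ?thesis using False by (simp add: ycell_def)
qed (simp add: ycell_def)

section \<open>Poisson variables and mean bounds by windows\<close>

lemma (in prob_space) poisson_expectation:
  assumes N[measurable]: "N \<in> measurable M (count_space UNIV)" and l: "l \<ge> 0"
    and p: "\<And>m::nat. prob {\<omega> \<in> space M. N \<omega> = m} = exp (- l) * l ^ m / fact m"
  shows "(\<integral>\<^sup>+\<omega>. of_nat (N \<omega>) \<partial>M) = ennreal l"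
proof -
  have "(\<integral>\<^sup>+\<omega>. of_nat (N \<omega>) \<partial>M) = (\<integral>\<^sup>+\<omega>. (\<Sum>m. of_nat m * indicator {\<omega> \<in> space M. N \<omega> = m} \<omega>) \<partial>M)"
  proof (rule nn_integral_cong)
    fix \<omega> assume "\<omega> \<in> space M"
    then have "(\<Sum>m. of_nat m * indicator {\<omega> \<in> space M. N \<omega> = m} \<omega>) = (\<Sum>m\<in>{N \<omega>}. of_nat m * (indicator {\<omega> \<in> space M. N \<omega> = m} \<omega> :: ennreal))"
      by (intro suminf_finite) auto
    then show "of_nat (N \<omega>) = (\<Sum>m. of_nat m * indicator {\<omega> \<in> space M. N \<omega> = m} \<omega> :: ennreal)"
      using \<open>\<omega> \<in> space M\<close> by simp
  qed
  also have "\<dots> = (\<Sum>m. \<integral>\<^sup>+\<omega>. of_nat m * indicator {\<omega> \<in> space M. N \<omega> = m} \<omega> \<partial>M)"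
    by (rule nn_integral_suminf) measurable
  also have "\<dots> = (\<Sum>m. ennreal (real m * (exp (- l) * l ^ m / fact m)))"
  proof (rule suminf_cong)
    fix m
    have "(\<integral>\<^sup>+\<omega>. of_nat m * indicator {\<omega> \<in> space M. N \<omega> = m} \<omega> \<partial>M) = of_nat m * emeasure M {\<omega> \<in> space M. N \<omega> = m}"
      by (rule nn_integral_cmult_indicator) measurable
    also have "\<dots> = ennreal (real m * (exp (- l) * l ^ m / fact m))"
      unfolding emeasure_eq_measure p ennreal_of_nat_eq_real_of_nat using l by (subst ennreal_mult) auto
    finally show "(\<integral>\<^sup>+\<omega>. of_nat m * indicator {\<omega> \<in> space M. N \<omega> = m} \<omega> \<partial>M) = ennreal (real m * (exp (- l) * l ^ m / fact m))" .
  qed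
  also have "\<dots> = ennreal l"
  proof (rule suminf_ennreal_eq)
    have "(\<lambda>m. l ^ m / fact m) sums exp l" using exp_converges[of l] by (simp add: scaleR_conv_of_real field_simps)
    then have "(\<lambda>m. l * exp (- l) * (l ^ m / fact m)) sums (l * exp (- l) * exp l)" by (rule sums_mult)
    moreover have "l * exp (- l) * (l ^ m / fact m) = real (Suc m) * (exp (- l) * l ^ Suc m / fact (Suc m))" for m
      by (simp add: field_simps del: of_nat_Suc)
    moreover have "l * exp (- l) * exp l = l" by (simp add: exp_minus)
    ultimately have "(\<lambda>m. real (Suc m) * (exp (- l) * l ^ Suc m / fact (Suc m))) sums l"
      by (simp only:)
    then show "(\<lambda>m. real m * (exp (- l) * l ^ m / fact m)) sums l"
      by (subst (asm) sums_Suc_iff) simp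
  qed (use l in auto)
  finally show ?thesis .
qed

text \<open>\<open>pgf_expansion\<close> with weight 1 identifies the generating function with the
  series of the point probabilities, here an exponential series.\<close>

lemma (in prob_space) poisson_pgf:
  assumes N[measurable]: "N \<in> measurable M (count_space UNIV)"
    and p: "\<And>m::nat. prob {\<omega> \<in> space M. N \<omega> = m} = exp (- l) * l ^ m / fact m"
    and z: "0 < z" "z < 1"
  shows "(\<integral>\<omega>. z ^ N \<omega> \<partial>M) = exp (l * (z - 1))"
proof -
  have a: "(\<integral>\<omega>. of_bool (N \<omega> = m) \<partial>M) = exp (- l) * l ^ m / fact m" for m
  proof -
    have "(\<integral>\<omega>. of_bool (N \<omega> = m) \<partial>M) = (\<integral>\<omega>. indicator {\<omega> \<in> space M. N \<omega> = m} \<omega> \<partial>M)"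
      by (rule Bochner_Integration.integral_cong) (auto simp: indicator_def)
    also have "\<dots> = prob ({\<omega> \<in> space M. N \<omega> = m} \<inter> space M)"
      by (rule Bochner_Integration.integral_indicator)
    also have "{\<omega> \<in> space M. N \<omega> = m} \<inter> space M = {\<omega> \<in> space M. N \<omega> = m}" by auto
    finally show ?thesis by (simp only: p)
  qed
  have bound: "\<bar>(\<Sum>m<c. z ^ m * (exp (- l) * l ^ m / fact m)) - (\<integral>\<omega>. z ^ N \<omega> \<partial>M)\<bar> \<le> z ^ c" for c
    using pgf_expansion[of "\<lambda>_. 1" N z c] z by (simp add: a abs_minus_commute)
  have zc: "(\<lambda>c. z ^ c) \<longlonglongrightarrow> 0" using z by (intro LIMSEQ_power_zero) simp
  have "(\<lambda>c. (\<Sum>m<c. z ^ m * (exp (- l) * l ^ m / fact m)) - (\<integral>\<omega>. z ^ N \<omega> \<partial>M)) \<longlonglongrightarrow> 0"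
    by (rule Lim_null_comparison[OF _ zc]) (use bound in auto)
  then have 1: "(\<lambda>c. \<Sum>m<c. z ^ m * (exp (- l) * l ^ m / fact m)) \<longlonglongrightarrow> (\<integral>\<omega>. z ^ N \<omega> \<partial>M)"
    by (simp add: LIM_zero_iff)
  have "(\<lambda>m. (z * l) ^ m / fact m) sums exp (z * l)" using exp_converges[of "z * l"] by (simp add: scaleR_conv_of_real field_simps)
  then have "(\<lambda>m. exp (- l) * ((z * l) ^ m / fact m)) sums (exp (- l) * exp (z * l))" by (rule sums_mult)
  moreover have "exp (- l) * ((z * l) ^ m / fact m) = z ^ m * (exp (- l) * l ^ m / fact m)" for m
    by (simp add: power_mult_distrib)
  ultimately have "(\<lambda>c. \<Sum>m<c. z ^ m * (exp (- l) * l ^ m / fact m)) \<longlonglongrightarrow> exp (- l) * exp (z * l)"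
    by (simp only: sums_def)
  with 1 have "(\<integral>\<omega>. z ^ N \<omega> \<partial>M) = exp (- l) * exp (z * l)" by (rule LIMSEQ_unique)
  then show ?thesis by (simp add: exp_add[symmetric] algebra_simps)
qed

text \<open>Each point \<open>x\<close> is counted in the window \<open>{0..j + 1}\<close> with \<open>j\<close> the integer part of \<open>x\<close>.\<close>

lemma exp_half_le_windows:
  assumes "x \<ge> 0"
  shows "ennreal (exp (- x / 2)) \<le> (\<Sum>j. ennreal (exp (- real j / 2)) * indicator {0..real j + 1} x)"
proof -
  let ?f = "\<lambda>j. ennreal (exp (- real j / 2)) * indicator {0..real j + 1} x"
  define j where "j = nat \<lfloor>x\<rfloor>"
  have j: "real j \<le> x" "x \<le> real j + 1" using assms unfolding j_def by linarith+
  have "ennreal (exp (- x / 2)) \<le> ?f j" using j assms by (simp add: ennreal_leI)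
  also have "\<dots> = sum ?f {j}"
    by (simp only: sum.insert sum.empty finite.emptyI empty_iff not_False_eq_True add_0_right)
  also have "\<dots> \<le> suminf ?f" by (rule sum_le_suminf) auto
  finally show ?thesis .
qed

lemma windows_summable: "summable (\<lambda>j. exp (- real j / 2) * (c * (real j + 1) powr a))"
proof -
  have "summable (\<lambda>j. exp (- real j / 2) * (real j + 1) powr a)"
  proof (rule summable_comparison_test_bigo)
    show "summable (\<lambda>j. norm (exp (- real j / 4)))"
    proof -
      have "summable (\<lambda>j. exp (- (1 / 4) :: real) ^ j)" by (rule summable_geometric) simp
      then show ?thesis by (simp add: exp_of_nat_mult[symmetric])
    qed
    show "(\<lambda>j. exp (- real j / 2) * (real j + 1) powr a) \<in> O(\<lambda>j. exp (- real j / 4))"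
      by real_asymp
  qed
  from summable_mult[OF this, of c] show ?thesis by (simp add: mult_ac)
qed

text \<open>\<open>G j\<close> will be the mean number of points in the window
  \<open>{0..j + 1}\<close>; its growth is polynomial, so the exponential factor wins. The same
  estimate serves the sample and the limit.\<close>

lemma windows_bound:
  assumes c: "c \<ge> 0" and G: "\<And>j::nat. G j \<le> ennreal (c * (real j + 1) powr a)"
  shows "(\<Sum>j. ennreal (exp (- real j / 2)) * G j) \<le> ennreal (\<Sum>j. exp (- real j / 2) * (c * (real j + 1) powr a))"
proof -
  have "(\<Sum>j. ennreal (exp (- real j / 2)) * G j) \<le> (\<Sum>j. ennreal (exp (- real j / 2) * (c * (real j + 1) powr a)))"
    using G c by (intro suminf_le) (auto simp: ennreal_mult intro!: mult_left_mono)
  also have "\<dots> = ennreal (\<Sum>j. exp (- real j / 2) * (c * (real j + 1) powr a))"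
    using c by (intro suminf_ennreal2 windows_summable) auto
  finally show ?thesis .
qed

section \<open>The atoms of the limit process\<close>

locale poisson_atoms =
  fixes P :: "'p measure" and Lam :: "real measure" and Y :: "nat \<Rightarrow> 'p \<Rightarrow> real" and c a :: real
  assumes PPP: "poisson_pp_atoms P Lam Y"
    and Lam_sets: "sets Lam = sets borel"
    and Lam_int: "\<And>y. y > 0 \<Longrightarrow> emeasure Lam {0..y} = ennreal (c * y powr a)"
    and c: "c \<ge> 0"
begin

sublocale prob_space P using PPP by (simp add: poisson_pp_atoms_def)

lemma Y_measurable [measurable]: "Y i \<in> borel_measurable P"
  using PPP by (simp add: poisson_pp_atoms_def)

lemma AE_Y: "AE \<omega> in P. 0 < Y 1 \<omega> \<and> (\<forall>i\<ge>1. Y i \<omega> < Y (Suc i) \<omega>) \<and> filterlim (\<lambda>i. Y i \<omega>) at_top sequentially"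
  using PPP by (simp add: poisson_pp_atoms_def)

lemma atoms_pos:
  fixes y :: "nat \<Rightarrow> real"
  assumes "0 < y 1 \<and> (\<forall>i\<ge>1. y i < y (Suc i)) \<and> filterlim y at_top sequentially"
  shows "0 < y (Suc i)"
proof (induction i)
  case (Suc i)
  have "y (Suc i) < y (Suc (Suc i))" using assms by simp
  with Suc show ?case by linarith
qed (use assms in simp)

definition count :: "real set \<Rightarrow> 'p \<Rightarrow> nat" where
  "count B \<omega> = card {i. 1 \<le> i \<and> Y i \<omega> \<in> B}"

lemma
  fixes J :: "nat set"
  assumes "finite J" "disjoint_family_on B J" "\<And>j. j \<in> J \<Longrightarrow> B j \<in> sets borel \<and> B j \<subseteq> {0..} \<and> bounded (B j)"
  shows indep_count: "indep_vars (\<lambda>_. count_space UNIV) (\<lambda>j. count (B j)) J"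
    and prob_count_family: "j \<in> J \<Longrightarrow> prob {\<omega> \<in> space P. count (B j) \<omega> = m} = exp (- measure Lam (B j)) * measure Lam (B j) ^ m / fact m"
proof -
  have "\<forall>j\<in>J. B j \<in> sets borel \<and> B j \<subseteq> {0..} \<and> bounded (B j)" using assms(3) by blast
  note * = PPP[unfolded poisson_pp_atoms_def, THEN conjunct2, THEN conjunct2, THEN conjunct2,
      THEN spec, THEN spec, THEN mp, OF assms(1), THEN mp, OF assms(2), THEN mp, OF this]
  show "indep_vars (\<lambda>_. count_space UNIV) (\<lambda>j. count (B j)) J"
    using conjunct1[OF *] by (simp only: count_def[abs_def])
  show "prob {\<omega> \<in> space P. count (B j) \<omega> = m} = exp (- measure Lam (B j)) * measure Lam (B j) ^ m / fact m" if "j \<in> J"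
    using conjunct2[OF *, THEN bspec, OF that] by (simp only: count_def)
qed

lemma
  assumes "B \<in> sets borel" "B \<subseteq> {0..}" "bounded B"
  shows count_measurable: "count B \<in> measurable P (count_space UNIV)"
    and prob_count: "prob {\<omega> \<in> space P. count B \<omega> = m} = exp (- measure Lam B) * measure Lam B ^ m / fact m"
proof -
  \<comment> \<open>The defining property speaks of families, so a single set is taken as the family
    over \<open>{0}\<close>.\<close>
  have *: "disjoint_family_on (\<lambda>_::nat. B) {0}" by (simp add: disjoint_family_on_def)
  show "count B \<in> measurable P (count_space UNIV)"
    using indep_count[OF _ *] assms by (simp add: indep_vars_def2)
  show "prob {\<omega> \<in> space P. count B \<omega> = m} = exp (- measure Lam B) * measure Lam B ^ m / fact m"
    using prob_count_family[OF _ *, of 0] assms by simp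
qed

lemma ycell_ok: "ycell h j \<in> sets borel" "ycell h j \<subseteq> {0..}" "bounded (ycell h j)"
proof -
  have "ycell h j \<subseteq> {0..h * (real j + 1)}" by (auto simp: ycell_def)
  then show "bounded (ycell h j)" using bounded_subset bounded_closed_interval by blast
qed (auto simp: ycell_nonneg)

lemma joint_pgf:
  assumes h: "h > 0" and z: "\<And>j. 0 < z j \<and> z j < 1"
  shows "(\<integral>\<omega>. (\<Prod>j<m. z j ^ count (ycell h j) \<omega>) \<partial>P) = exp (\<Sum>j<m. measure Lam (ycell h j) * (z j - 1))"
proof (cases "m = 0")
  case False
  have ind: "indep_vars (\<lambda>_. borel) (\<lambda>j \<omega>. z j ^ count (ycell h j) \<omega>) {..<m}"
    by (rule indep_vars_compose2[OF indep_count[OF _ ycell_disjoint[OF h]]]) (use ycell_ok in auto)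
  have "(\<integral>\<omega>. (\<Prod>j<m. z j ^ count (ycell h j) \<omega>) \<partial>P) = (\<Prod>j<m. \<integral>\<omega>. z j ^ count (ycell h j) \<omega> \<partial>P)"
  proof (rule indep_vars_lebesgue_integral[OF _ ind])
    fix j
    have [measurable]: "count (ycell h j) \<in> measurable P (count_space UNIV)" by (intro count_measurable ycell_ok)
    show "integrable P (\<lambda>\<omega>. z j ^ count (ycell h j) \<omega>)"
      by (rule integrable_bounded[where B=1], measurable) (use z[of j] in \<open>auto intro: power_le_one\<close>)
  qed simp
  also have "\<dots> = (\<Prod>j<m. exp (measure Lam (ycell h j) * (z j - 1)))"
    by (intro prod.cong refl poisson_pgf count_measurable prob_count ycell_ok) (use z in auto)
  finally show ?thesis by (simp add: exp_sum)
qed (simp add: prob_space)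

text \<open>Each root is at most the sum of its windows' weights. Exchanging the sums over points
  and windows turns the points into window counts, which are Poisson with known mean.\<close>

lemma expectation_sum_sqrt_weights:
  "(\<integral>\<^sup>+\<omega>. (\<Sum>i. ennreal (sqrt (exp (- Y (i + 1) \<omega>)))) \<partial>P)
     \<le> ennreal (\<Sum>j. exp (- real j / 2) * (c * (real j + 1) powr a))"
proof -
  let ?I = "\<lambda>j::nat. {0..real j + 1}"
  have m[measurable]: "count (?I j) \<in> measurable P (count_space UNIV)" for j by (intro count_measurable) auto
  have "(\<integral>\<^sup>+\<omega>. (\<Sum>i. ennreal (sqrt (exp (- Y (i + 1) \<omega>)))) \<partial>P)
      \<le> (\<integral>\<^sup>+\<omega>. (\<Sum>j. ennreal (exp (- real j / 2)) * of_nat (count (?I j) \<omega>)) \<partial>P)"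
  proof (rule nn_integral_mono_AE, rule AE_mp[OF AE_Y], intro AE_I2 impI)
    fix \<omega> assume Y: "0 < Y 1 \<omega> \<and> (\<forall>i\<ge>1. Y i \<omega> < Y (Suc i) \<omega>) \<and> filterlim (\<lambda>i. Y i \<omega>) at_top sequentially"
    have pos: "Y (Suc i) \<omega> > 0" for i using Y by (rule atoms_pos)
    have cnt: "(\<Sum>i. indicator (?I j) (Y (i + 1) \<omega>)) = (of_nat (count (?I j) \<omega>) :: ennreal)" for j
    proof -
      \<comment> \<open>\<open>card\<close> is 0 on infinite sets, so finiteness matters: the atoms
        tend to infinity and leave the window.\<close>
      obtain N where N: "\<And>i. i \<ge> N \<Longrightarrow> Y i \<omega> > real j + 1"
        using Y unfolding filterlim_at_top_dense eventually_sequentially by blast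
      let ?F = "{i. Y (i + 1) \<omega> \<in> ?I j}"
      have "?F \<subseteq> {..<N}"
      proof
        fix i assume "i \<in> ?F"
        then have "\<not> N \<le> i + 1" using N[of "i + 1"] by force
        then show "i \<in> {..<N}" by simp
      qed
      then have fin: "finite ?F" by (rule finite_subset) simp
      have "(\<Sum>i. indicator (?I j) (Y (i + 1) \<omega>)) = (\<Sum>i\<in>?F. indicator (?I j) (Y (i + 1) \<omega>) :: ennreal)"
        by (rule suminf_finite[OF fin]) (simp add: indicator_def)
      also have "\<dots> = of_nat (card ?F)" by simp
      also have "card ?F = card (Suc ` ?F)" by (simp add: card_image)
      also have "Suc ` ?F = {i. 1 \<le> i \<and> Y i \<omega> \<in> ?I j}"
        by (auto simp: image_iff) (metis Suc_pred' less_eq_Suc_le)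
      finally show ?thesis by (simp add: count_def)
    qed
    have "(\<Sum>i. ennreal (sqrt (exp (- Y (i + 1) \<omega>)))) \<le> (\<Sum>i. \<Sum>j. ennreal (exp (- real j / 2)) * indicator (?I j) (Y (i + 1) \<omega>))"
    proof (rule suminf_le)
      fix i
      have "sqrt (exp (- Y (i + 1) \<omega>)) = exp (- Y (i + 1) \<omega> / 2)"
        by (rule real_sqrt_unique) (simp_all add: power2_eq_square flip: exp_add)
      then show "ennreal (sqrt (exp (- Y (i + 1) \<omega>))) \<le> (\<Sum>j. ennreal (exp (- real j / 2)) * indicator (?I j) (Y (i + 1) \<omega>))"
        using exp_half_le_windows[of "Y (i + 1) \<omega>"] pos[of i] by simp
    qed auto
    also have "\<dots> = (\<Sum>j. \<Sum>i. ennreal (exp (- real j / 2)) * indicator (?I j) (Y (i + 1) \<omega>))"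
      \<comment> \<open>Both sums are integrals over counting measure, so Tonelli exchanges
        them.\<close>
      unfolding nn_integral_count_space_nat[symmetric]
      by (rule pair_sigma_finite.Fubini') (auto intro!: pair_sigma_finite.intro sigma_finite_measure_count_space)
    also have "\<dots> = (\<Sum>j. ennreal (exp (- real j / 2)) * of_nat (count (?I j) \<omega>))"
      by (simp only: ennreal_suminf_cmult cnt)
    finally show "(\<Sum>i. ennreal (sqrt (exp (- Y (i + 1) \<omega>)))) \<le> (\<Sum>j. ennreal (exp (- real j / 2)) * of_nat (count (?I j) \<omega>))" .
  qed
  also have "\<dots> = (\<Sum>j. ennreal (exp (- real j / 2)) * (\<integral>\<^sup>+\<omega>. of_nat (count (?I j) \<omega>) \<partial>P))"
    by (subst nn_integral_suminf) (auto intro!: suminf_cong nn_integral_cmult)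
  also have "\<dots> \<le> ennreal (\<Sum>j. exp (- real j / 2) * (c * (real j + 1) powr a))"
  proof (rule windows_bound[OF c])
    fix j
    have "(\<integral>\<^sup>+\<omega>. of_nat (count (?I j) \<omega>) \<partial>P) = ennreal (measure Lam (?I j))"
      by (intro poisson_expectation m prob_count) auto
    also have "measure Lam (?I j) = c * (real j + 1) powr a"
      using Lam_int[of "real j + 1"] c by (simp add: measure_def)
    finally show "(\<integral>\<^sup>+\<omega>. of_nat (count (?I j) \<omega>) \<partial>P) \<le> ennreal (c * (real j + 1) powr a)" by simp
  qed
  finally show ?thesis .
qed

text \<open>A finite mean makes the sum of the roots finite almost surely; this is also why the
  denominator of the limiting shares converges.\<close>

lemma AE_weight_seq: "AE \<omega> in P. weight_seq (\<lambda>i. exp (- Y (i + 1) \<omega>))"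
proof -
  have "AE \<omega> in P. (\<Sum>i. ennreal (sqrt (exp (- Y (i + 1) \<omega>)))) \<noteq> \<infinity>"
    by (rule nn_integral_noteq_infinite) (use expectation_sum_sqrt_weights in \<open>auto simp: top_unique\<close>)
  then show ?thesis using AE_Y
  proof eventually_elim
    case (elim \<omega>)
    have pos: "Y (Suc i) \<omega> > 0" for i using elim(2) by (rule atoms_pos)
    have "mono (\<lambda>i. Y (Suc i) \<omega>)"
      unfolding mono_iff_le_Suc using elim by (auto intro: less_imp_le)
    then have "antimono (\<lambda>i. exp (- Y (i + 1) \<omega>))" by (auto simp: monotone_def)
    moreover have "summable (\<lambda>i. sqrt (exp (- Y (i + 1) \<omega>)))"
      by (rule summable_suminf_not_top) (use elim in auto)
    ultimately show ?case using pos by (auto simp: weight_seq_def less_imp_le)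
  qed
qed

lemma AE_count_eq:
  "AE \<omega> in P. \<forall>j. count (ycell h j) \<omega> = card {i. exp (- Y (i + 1) \<omega>) \<in> wcell h j}"
  using AE_Y
proof eventually_elim
  case (elim \<omega>)
  have pos: "Y (Suc i) \<omega> > 0" for i using elim by (rule atoms_pos)
  have "{i. 1 \<le> i \<and> Y i \<omega> \<in> ycell h j} = Suc ` {i. exp (- Y (i + 1) \<omega>) \<in> wcell h j}" for j
  proof (intro set_eqI iffI)
    fix i assume i: "i \<in> {i. 1 \<le> i \<and> Y i \<omega> \<in> ycell h j}"
    then obtain i' where i': "i = Suc i'" by (cases i) auto
    then have "exp (- Y (i' + 1) \<omega>) \<in> wcell h j"
      using i pos[of i'] by (simp add: exp_in_wcell_iff)
    then show "i \<in> Suc ` {i. exp (- Y (i + 1) \<omega>) \<in> wcell h j}" using i' by blast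
  next
    fix i assume "i \<in> Suc ` {i. exp (- Y (i + 1) \<omega>) \<in> wcell h j}"
    then obtain i' where "i = Suc i'" "exp (- Y (i' + 1) \<omega>) \<in> wcell h j" by blast
    then show "i \<in> {i. 1 \<le> i \<and> Y i \<omega> \<in> ycell h j}"
      using pos[of i'] by (simp add: exp_in_wcell_iff)
  qed
  then show ?case by (simp add: count_def card_image)
qed

end

section \<open>Order statistics and the sample\<close>

lemma desc_stat_map_divide:
  assumes "Z > 0" shows "desc_stat k (map (\<lambda>x. x / Z) xs) = desc_stat k xs / Z"
proof -
  have "sort (map (\<lambda>x. x / Z) xs) = map (\<lambda>x. x / Z) (sort xs)"
  proof (rule properties_for_sort)
    show "sorted (map (\<lambda>x. x / Z) (sort xs))"
      using assms by (intro sorted_map_mono[OF sorted_sort]) (auto simp: mono_on_def divide_right_mono)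
  qed simp
  then show ?thesis by (auto simp: desc_stat_def rev_map intro!: nth_map)
qed

lemma desc_stat_antimono: "desc_stat (Suc j) xs \<le> desc_stat (Suc i) xs" if "i \<le> j" "j < length xs"
proof -
  have "rev (sort xs) ! j \<le> rev (sort xs) ! i"
    using that by (auto simp: rev_nth intro!: sorted_nth_mono)
  then show ?thesis using that by (simp add: desc_stat_def)
qed

lemma desc_stat_mem: "desc_stat (Suc i) xs \<in> set xs" if "i < length xs"
proof -
  have "rev (sort xs) ! i \<in> set (rev (sort xs))" using that by (intro nth_mem) simp
  then show ?thesis using that by (simp add: desc_stat_def)
qed

lemma sum_desc_stat: "(\<Sum>i<length xs. g (desc_stat (Suc i) xs)) = (\<Sum>x\<leftarrow>xs. g x)"
  for g :: "real \<Rightarrow> 'b::comm_monoid_add"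
proof -
  have "(\<Sum>i<length xs. g (desc_stat (Suc i) xs)) = (\<Sum>i<length xs. map g (rev (sort xs)) ! i)"
    by (intro sum.cong) (auto simp: desc_stat_def)
  also have "\<dots> = sum_list (map g (rev (sort xs)))"
    by (simp add: sum_list_sum_nth atLeast0LessThan)
  also have "\<dots> = sum_mset (image_mset g (mset (rev (sort xs))))"
    by (simp only: sum_mset_sum_list[symmetric] mset_map)
  also have "\<dots> = sum_mset (image_mset g (mset xs))" by simp
  also have "\<dots> = (\<Sum>x\<leftarrow>xs. g x)" by (simp only: sum_mset_sum_list[symmetric] mset_map)
  finally show ?thesis .
qed

text \<open>Indexed from 0 and padded with zeros (the default of \<open>desc_stat\<close>), a finite
  sample becomes an infinite decreasing sequence, comparable with the weights of the atoms.\<close>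

definition order_stat :: "nat \<Rightarrow> (nat \<Rightarrow> real) \<Rightarrow> nat \<Rightarrow> real" where
  "order_stat n a i = desc_stat (Suc i) (map a [1..<n + 1])"

lemma order_stat_0: "order_stat n a i = 0" if "n \<le> i"
  using that by (simp add: order_stat_def desc_stat_def)

lemma sum_order_stat: "(\<Sum>i<n. g (order_stat n a i)) = (\<Sum>j=1..n. g (a j))"
  for g :: "real \<Rightarrow> 'b::comm_monoid_add"
proof -
  have "(\<Sum>i<n. g (order_stat n a i)) = (\<Sum>x\<leftarrow>map a [1..<n + 1]. g x)"
    using sum_desc_stat[of g "map a [1..<n + 1]"] by (simp add: order_stat_def del: upt_Suc)
  also have "\<dots> = (\<Sum>j\<leftarrow>[1..<n + 1]. g (a j))" by (simp add: comp_def del: upt_Suc)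
  also have "\<dots> = (\<Sum>j\<in>{1..<n + 1}. g (a j))"
    by (subst sum_list_distinct_conv_sum_set) (auto simp del: upt_Suc)
  also have "{1..<n + 1} = {1..n}" by auto
  finally show ?thesis .
qed

lemma suminf_order_stat:
  fixes g :: "real \<Rightarrow> 'b::{comm_monoid_add, t2_space}"
  assumes "g 0 = 0" shows "(\<Sum>i. g (order_stat n a i)) = (\<Sum>j=1..n. g (a j))"
  using sum_order_stat[of g n a] assms
  by (subst suminf_finite[of "{..<n}"]) (auto simp: order_stat_0)

text \<open>The condition \<open>0 \<notin> A\<close> keeps out the padding.\<close>

lemma card_order_stat:
  assumes "0 \<notin> A" shows "card {i. order_stat n a i \<in> A} = card {j \<in> {1..n}. a j \<in> A}"
proof -
  have "{i. order_stat n a i \<in> A} = {i \<in> {..<n}. order_stat n a i \<in> A}"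
    using assms order_stat_0[of n _ a] by (force simp: not_le[symmetric])
  then have "card {i. order_stat n a i \<in> A} = (\<Sum>i<n. of_bool (order_stat n a i \<in> A))"
    by (simp add: Int_def)
  also have "\<dots> = (\<Sum>j=1..n. of_bool (a j \<in> A))" by (rule sum_order_stat)
  also have "\<dots> = card {j \<in> {1..n}. a j \<in> A}" by (simp add: Int_def)
  finally show ?thesis .
qed

lemma weight_seq_order_stat:
  assumes n: "n \<ge> 1" and a: "\<And>j. 1 \<le> j \<Longrightarrow> j \<le> n \<Longrightarrow> 0 < a j \<and> a j \<le> 1"
  shows "weight_seq (order_stat n a)"
proof -
  have mem: "\<exists>j. 1 \<le> j \<and> j \<le> n \<and> order_stat n a i = a j" if "i < n" for i
    using desc_stat_mem[of i "map a [1..<n + 1]"] that by (auto simp: order_stat_def simp del: upt_Suc)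
  have nn: "0 \<le> order_stat n a i" "order_stat n a i \<le> 1" for i
    using mem[of i] a order_stat_0[of n i a] by (cases "i < n"; force intro: less_imp_le)+
  moreover have "antimono (order_stat n a)"
  proof (rule antimonoI)
    fix i j :: nat assume ij: "i \<le> j"
    show "order_stat n a j \<le> order_stat n a i"
    proof (cases "j < n")
      case True
      then show ?thesis using ij desc_stat_antimono[of i j "map a [1..<n + 1]"] by (simp add: order_stat_def del: upt_Suc)
    qed (use nn order_stat_0 in auto)
  qed
  moreover have "summable (\<lambda>i. sqrt (order_stat n a i))"
    by (rule summable_finite[of "{..<n}"]) (auto simp: order_stat_0)
  moreover have "order_stat n a 0 > 0" using mem[of 0] n a by force
  ultimately show ?thesis by (simp add: weight_seq_def)
qed

text \<open>In decreasing order the values that reach \<open>t\<close> come first, so their number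
  decides. This writes level sets of order statistics by sums of indicators, from which
  measurability is immediate.\<close>

lemma order_stat_ge_iff:
  assumes "i < n"
  shows "t \<le> order_stat n a i \<longleftrightarrow> real i < (\<Sum>j=1..n. of_bool (t \<le> a j))"
proof -
  have anti: "order_stat n a j \<le> order_stat n a i" if "i \<le> j" "j < n" for i j
    using desc_stat_antimono[of i j "map a [1..<n + 1]"] that by (simp add: order_stat_def del: upt_Suc)
  let ?S = "{l \<in> {..<n}. t \<le> order_stat n a l}"
  have "(\<Sum>j=1..n. of_bool (t \<le> a j)) = (\<Sum>l<n. of_bool (t \<le> order_stat n a l) :: real)"
    by (rule sum_order_stat[symmetric])
  also have "\<dots> = real (card ?S)" by (simp add: Int_def)
  finally have S: "(\<Sum>j=1..n. of_bool (t \<le> a j)) = real (card ?S)" .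
  show ?thesis
  proof
    assume "t \<le> order_stat n a i"
    then have "{..i} \<subseteq> ?S" using anti[of _ i] assms by (auto intro: order_trans)
    then have "card {..i} \<le> card ?S" by (intro card_mono) auto
    then show "real i < (\<Sum>j=1..n. of_bool (t \<le> a j))" unfolding S by simp
  next
    assume *: "real i < (\<Sum>j=1..n. of_bool (t \<le> a j))"
    show "t \<le> order_stat n a i"
    proof (rule ccontr)
      assume "\<not> t \<le> order_stat n a i"
      then have "?S \<subseteq> {..<i}" using anti[of i] by (force simp: not_le[symmetric] intro: order_trans)
      then have "card ?S \<le> card {..<i}" by (intro card_mono) auto
      then show False using * unfolding S by simp
    qed
  qed
qed

lemma measurable_order_stat:
  assumes [measurable]: "\<And>j. (\<lambda>\<omega>. a \<omega> j) \<in> borel_measurable M"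
  shows "(\<lambda>\<omega>. order_stat n (a \<omega>) i) \<in> borel_measurable M"
proof (cases "i < n")
  case True
  show ?thesis unfolding borel_measurable_iff_ge order_stat_ge_iff[OF True] by measurable
qed (simp add: order_stat_0)

text \<open>For \<open>u\<close> and \<open>v\<close> of absolute value at most 1, the
  \<open>n\<close>-th powers differ by at most \<open>n\<close> times the distance of
  \<open>u\<close> and \<open>v\<close>. With \<open>1 + x n / n\<close> and
  \<open>1 + l / n\<close> the factor \<open>n\<close> cancels, and the second power has the
  classical limit.\<close>

lemma one_plus_over_n_power_tendsto_exp:
  fixes x :: "nat \<Rightarrow> real"
  assumes x: "x \<longlonglongrightarrow> l" and b: "\<And>n. n \<ge> 1 \<Longrightarrow> \<bar>1 + x n / n\<bar> \<le> 1"
    and l: "l \<le> 0"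
  shows "(\<lambda>n. (1 + x n / n) ^ n) \<longlonglongrightarrow> exp l"
proof -
  have "(\<lambda>n. (1 + x n / n) ^ n - (1 + l / n) ^ n) \<longlonglongrightarrow> 0"
  proof (rule Lim_null_comparison)
    show "(\<lambda>n. \<bar>x n - l\<bar>) \<longlonglongrightarrow> 0" using x by (simp add: LIM_zero tendsto_rabs_zero)
    have "eventually (\<lambda>n. real n \<ge> - l) sequentially"
      using filterlim_real_sequentially by (auto simp: filterlim_at_top)
    then show "eventually (\<lambda>n. norm ((1 + x n / n) ^ n - (1 + l / n) ^ n) \<le> \<bar>x n - l\<bar>) sequentially"
      using eventually_ge_at_top[of 1]
    proof eventually_elim
      case (elim n)
      have n0: "real n > 0" using elim by simp
      have "- 1 \<le> l / real n" "l / real n \<le> 0"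
        using elim l n0 by (auto simp: pos_le_divide_eq divide_nonpos_pos)
      then have "\<bar>1 + l / n\<bar> \<le> 1" by linarith
      then have "norm ((1 + x n / n) ^ n - (1 + l / n) ^ n) \<le> real n * norm ((1 + x n / n) - (1 + l / n))"
        using b[OF elim(2)] by (intro norm_power_diff) auto
      also have "(1 + x n / n) - (1 + l / n) = (x n - l) / n" by (simp add: diff_divide_distrib)
      also have "real n * norm \<dots> = \<bar>x n - l\<bar>" using n0 by simp
      finally show ?case .
    qed
  qed
  from tendsto_add[OF this tendsto_exp_limit_sequentially[of l]] show ?thesis by simp
qed

section \<open>Cell counts of rare independent points\<close>

lemma prod_power_card:
  assumes "finite I" "finite J"
  shows "(\<Prod>j\<in>J. (z j :: real) ^ card {i \<in> I. Q i j}) = (\<Prod>i\<in>I. \<Prod>j\<in>J. if Q i j then z j else 1)"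
proof -
  have "z j ^ card {i \<in> I. Q i j} = (\<Prod>i\<in>I. if Q i j then z j else 1)" for j
    using assms by (simp add: prod.If_cases Int_def)
  then show ?thesis by (simp add: prod.swap[of _ J I])
qed

text \<open>At most one factor differs from 1. The additive form makes the expectation linear in the
  cell probabilities.\<close>

lemma prod_if_disjoint:
  assumes "finite J" "disjoint_family_on A J"
  shows "(\<Prod>j\<in>J. if x \<in> A j then (z j :: real) else 1) = 1 + (\<Sum>j\<in>J. (z j - 1) * indicator (A j) x)"
  using assms
proof (induction J rule: finite_induct)
  case (insert j J)
  then have dj: "disjoint_family_on A J" by (auto simp: disjoint_family_on_def)
  show ?case
  proof (cases "x \<in> A j")
    case True
    then have "\<And>l. l \<in> J \<Longrightarrow> x \<notin> A l" using insert by (auto simp: disjoint_family_on_def)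
    then have *: "(\<Sum>l\<in>J. (z l - 1) * indicator (A l) x) = 0" by (intro sum.neutral) auto
    show ?thesis unfolding prod.insert[OF insert.hyps] sum.insert[OF insert.hyps] insert.IH[OF dj] *
      using True by simp
  next
    case False
    then show ?thesis unfolding prod.insert[OF insert.hyps] sum.insert[OF insert.hyps] insert.IH[OF dj] by simp
  qed
qed simp

text \<open>A triangular array: in row \<open>n\<close> the points \<open>S n 1, ..., S n n\<close> are i.i.d. and each is rare.\<close>

locale rare_points = prob_space M for M :: "'m measure" +
  fixes S :: "nat \<Rightarrow> nat \<Rightarrow> 'm \<Rightarrow> real" and G :: "nat \<Rightarrow> real measure" and F :: "real \<Rightarrow> real" and c a :: real
  assumes indep: "\<And>n. indep_vars (\<lambda>_. borel) (S n) UNIV"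
    and law: "\<And>n i. distr M borel (S n i) = G n"
    and nonneg: "AE \<omega> in M. \<forall>n\<ge>1. \<forall>i. S n i \<omega> \<ge> 0"
    and rare: "\<And>y. y > 0 \<Longrightarrow> (\<lambda>n. real n * measure (G n) {0..y}) \<longlonglongrightarrow> F y"
    and bound: "\<And>n y. n \<ge> 1 \<Longrightarrow> y > 0 \<Longrightarrow> real n * measure (G n) {0..y} \<le> c * y powr a"
    and c: "c \<ge> 0"
begin

lemma S_measurable [measurable]: "S n i \<in> borel_measurable M"
  using indep[of n] by (auto simp: indep_vars_def2)

lemma G_sets [simp, measurable_cong]: "sets (G n) = sets borel"
  using law[of n 0] by (metis sets_distr)

lemma G_prob: "prob_space (G n)"
  using law[of n 0] prob_space_distr[of "S n 0" borel] by auto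

lemma prob_G: "A \<in> sets borel \<Longrightarrow> measure (G n) A = prob {\<omega> \<in> space M. S n i \<omega> \<in> A}"
  unfolding law[of n i, symmetric] by (subst measure_distr) (auto simp: vimage_def Int_def conj_commute)

definition weights :: "nat \<Rightarrow> 'm \<Rightarrow> nat \<Rightarrow> real" where
  "weights n \<omega> = order_stat n (\<lambda>j. exp (- S n j \<omega>))"

definition cell_count :: "real \<Rightarrow> nat \<Rightarrow> 'm \<Rightarrow> nat \<Rightarrow> nat" where
  "cell_count h n \<omega> j = card {i \<in> {1..n}. S n i \<omega> \<in> ycell h j}"

lemma weights_measurable [measurable]: "(\<lambda>\<omega>. weights n \<omega> i) \<in> borel_measurable M"
  unfolding weights_def by (rule measurable_order_stat) measurable

lemma cell_count_measurable [measurable]: "(\<lambda>\<omega>. cell_count h n \<omega> j) \<in> measurable M (count_space UNIV)"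
proof -
  have "cell_count h n \<omega> j = (\<Sum>i=1..n. of_bool (S n i \<omega> \<in> ycell h j))" for \<omega>
    by (simp add: cell_count_def Int_def)
  moreover have "(\<lambda>\<omega>. \<Sum>i=1..n. of_bool (S n i \<omega> \<in> ycell h j) :: nat) \<in> measurable M (count_space UNIV)"
    by measurable
  ultimately show ?thesis by simp
qed

lemma AE_weights: "AE \<omega> in M. weight_seq (weights n \<omega>)" if "n \<ge> 1"
  using nonneg
proof eventually_elim
  case (elim \<omega>)
  then show ?case unfolding weights_def using that by (intro weight_seq_order_stat) auto
qed

lemma AE_cell_count: "AE \<omega> in M. \<forall>j. cell_count h n \<omega> j = card {i. weights n \<omega> i \<in> wcell h j}" if "n \<ge> 1"
  using nonneg
proof eventually_elim
  case (elim \<omega>)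
  have "0 \<notin> wcell h j" for j by (simp add: wcell_def not_le)
  then show ?case using elim that by (simp add: weights_def card_order_stat cell_count_def exp_in_wcell_iff)
qed

text \<open>As for the atoms, but with \<open>n\<close> identically distributed points: the mean
  count of a window is \<open>n\<close> times its probability, which \<open>bound\<close> estimates
  uniformly in \<open>n\<close>.\<close>

lemma expectation_sum_sqrt_weights:
  assumes n: "n \<ge> 1"
  shows "(\<integral>\<^sup>+\<omega>. (\<Sum>i. ennreal (sqrt (weights n \<omega> i))) \<partial>M) \<le> ennreal (\<Sum>j. exp (- real j / 2) * (c * (real j + 1) powr a))"
proof -
  let ?I = "\<lambda>j::nat. {0..real j + 1}"
  have "(\<integral>\<^sup>+\<omega>. (\<Sum>i. ennreal (sqrt (weights n \<omega> i))) \<partial>M) = (\<integral>\<^sup>+\<omega>. (\<Sum>i=1..n. ennreal (exp (- S n i \<omega> / 2))) \<partial>M)"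
  proof (rule nn_integral_cong)
    fix \<omega>
    have "sqrt (exp (- y)) = exp (- y / 2)" for y
      by (rule real_sqrt_unique) (simp_all add: power2_eq_square flip: exp_add)
    then show "(\<Sum>i. ennreal (sqrt (weights n \<omega> i))) = (\<Sum>i=1..n. ennreal (exp (- S n i \<omega> / 2)))"
      unfolding weights_def using suminf_order_stat[of "\<lambda>x. ennreal (sqrt x)" n "\<lambda>j. exp (- S n j \<omega>)"] by simp
  qed
  also have "\<dots> = (\<Sum>i=1..n. \<integral>\<^sup>+\<omega>. ennreal (exp (- S n i \<omega> / 2)) \<partial>M)"
    by (rule nn_integral_sum) measurable
  also have "\<dots> \<le> (\<Sum>i=1..n. \<Sum>j. ennreal (exp (- real j / 2)) * ennreal (measure (G n) (?I j)))"
  proof (rule sum_mono)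
    fix i
    have "(\<integral>\<^sup>+\<omega>. ennreal (exp (- S n i \<omega> / 2)) \<partial>M) \<le> (\<integral>\<^sup>+\<omega>. (\<Sum>j. ennreal (exp (- real j / 2)) * indicator (?I j) (S n i \<omega>)) \<partial>M)"
    proof (rule nn_integral_mono_AE, rule AE_mp[OF nonneg], intro AE_I2 impI)
      fix \<omega> assume "\<forall>n\<ge>1. \<forall>i. S n i \<omega> \<ge> 0"
      then show "ennreal (exp (- S n i \<omega> / 2)) \<le> (\<Sum>j. ennreal (exp (- real j / 2)) * indicator (?I j) (S n i \<omega>))"
        using n by (intro exp_half_le_windows) auto
    qed
    also have "\<dots> = (\<Sum>j. ennreal (exp (- real j / 2)) * (\<integral>\<^sup>+\<omega>. indicator (?I j) (S n i \<omega>) \<partial>M))"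
      by (subst nn_integral_suminf) (auto intro!: suminf_cong nn_integral_cmult)
    also have "(\<lambda>j. \<integral>\<^sup>+\<omega>. indicator (?I j) (S n i \<omega>) \<partial>M) = (\<lambda>j. ennreal (measure (G n) (?I j)))"
    proof
      fix j
      have "(\<integral>\<^sup>+\<omega>. indicator (?I j) (S n i \<omega>) \<partial>M) = (\<integral>\<^sup>+\<omega>. indicator {\<omega> \<in> space M. S n i \<omega> \<in> ?I j} \<omega> \<partial>M)"
        by (intro nn_integral_cong) (auto simp: indicator_def)
      also have "\<dots> = emeasure M {\<omega> \<in> space M. S n i \<omega> \<in> ?I j}" by (rule nn_integral_indicator) measurable
      finally show "(\<integral>\<^sup>+\<omega>. indicator (?I j) (S n i \<omega>) \<partial>M) = ennreal (measure (G n) (?I j))"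
        using prob_G[of "?I j" n i] by (simp add: emeasure_eq_measure)
    qed
    finally show "(\<integral>\<^sup>+\<omega>. ennreal (exp (- S n i \<omega> / 2)) \<partial>M) \<le> (\<Sum>j. ennreal (exp (- real j / 2)) * ennreal (measure (G n) (?I j)))" .
  qed
  also have "\<dots> = (\<Sum>j. ennreal (exp (- real j / 2)) * ennreal (real n * measure (G n) (?I j)))"
    by (simp add: ennreal_mult ennreal_of_nat_eq_real_of_nat mult_ac flip: ennreal_suminf_cmult)
  also have "\<dots> \<le> ennreal (\<Sum>j. exp (- real j / 2) * (c * (real j + 1) powr a))"
    using bound[OF n] by (intro windows_bound[OF c] ennreal_leI) auto
  finally show ?thesis .
qed

text \<open>Exchanging the products over cells and points gives one factor \<open>\<zeta>\<close>
  for each point; these are independent with a common mean, so the expectation is an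
  \<open>n\<close>-th power. As \<open>\<zeta>\<close> lies between 0 and 1, so does its
  mean.\<close>

lemma joint_pgf:
  assumes h: "h > 0" and z: "\<And>j. 0 < z j \<and> z j < 1"
  shows "(\<integral>\<omega>. (\<Prod>j<m. z j ^ cell_count h n \<omega> j) \<partial>M) = (1 + (\<Sum>j<m. (z j - 1) * measure (G n) (ycell h j))) ^ n"
    and "\<bar>1 + (\<Sum>j<m. (z j - 1) * measure (G n) (ycell h j))\<bar> \<le> 1"
proof -
  define \<zeta> where "\<zeta> = (\<lambda>y. 1 + (\<Sum>j<m. (z j - 1) * indicator (ycell h j) y))"
  have \<zeta>_prod: "\<zeta> y = (\<Prod>j<m. if y \<in> ycell h j then z j else 1)" for y
    unfolding \<zeta>_def by (rule prod_if_disjoint[OF _ ycell_disjoint[OF h], symmetric]) simp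
  have \<zeta>01: "0 \<le> \<zeta> y" "\<zeta> y \<le> 1" for y unfolding \<zeta>_prod
    by (auto intro!: prod_nonneg prod_le_1 simp: less_imp_le[OF conjunct1[OF z]] less_imp_le[OF conjunct2[OF z]])
  have [measurable]: "\<zeta> \<in> borel_measurable borel" unfolding \<zeta>_def by measurable
  interpret G: prob_space "G n" by (rule G_prob)
  have I: "integrable (G n) (\<lambda>y. (z j - 1) * indicator (ycell h j) y)" for j
    by (intro integrable_mult_right) (auto simp: G.emeasure_eq_measure)
  have "(\<integral>y. \<zeta> y \<partial>G n) = (\<integral>y. 1 \<partial>G n) + (\<integral>y. (\<Sum>j<m. (z j - 1) * indicator (ycell h j) y) \<partial>G n)"
    unfolding \<zeta>_def by (rule Bochner_Integration.integral_add[OF _ Bochner_Integration.integrable_sum[OF I]]) simp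
  also have "(\<integral>y. (\<Sum>j<m. (z j - 1) * indicator (ycell h j) y) \<partial>G n) = (\<Sum>j<m. \<integral>y. (z j - 1) * indicator (ycell h j) y \<partial>G n)"
    by (rule Bochner_Integration.integral_sum[OF I])
  finally have Gint: "(\<integral>y. \<zeta> y \<partial>G n) = 1 + (\<Sum>j<m. (z j - 1) * measure (G n) (ycell h j))"
    using G.prob_space unfolding sets_eq_imp_space_eq[OF G_sets] by (simp add: sets_eq_imp_space_eq[OF G_sets])
  have E: "(\<integral>\<omega>. \<zeta> (S n i \<omega>) \<partial>M) = 1 + (\<Sum>j<m. (z j - 1) * measure (G n) (ycell h j))" for i
  proof -
    have "(\<integral>\<omega>. \<zeta> (S n i \<omega>) \<partial>M) = (\<integral>y. \<zeta> y \<partial>distr M borel (S n i))"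
      by (rule integral_distr[symmetric]) measurable
    then show ?thesis unfolding law Gint .
  qed
  have "0 \<le> (\<integral>\<omega>. \<zeta> (S n 0 \<omega>) \<partial>M)" using \<zeta>01 by (intro integral_nonneg_AE) auto
  moreover have "(\<integral>\<omega>. \<zeta> (S n 0 \<omega>) \<partial>M) \<le> 1"
    using \<zeta>01 by (intro integral_le_const integrable_bounded[where B=1]) auto
  ultimately show "\<bar>1 + (\<Sum>j<m. (z j - 1) * measure (G n) (ycell h j))\<bar> \<le> 1"
    unfolding E by linarith
  have "(\<Prod>j<m. z j ^ cell_count h n \<omega> j) = (\<Prod>i=1..n. \<zeta> (S n i \<omega>))" for \<omega>
    unfolding cell_count_def \<zeta>_prod by (rule prod_power_card) auto
  then have "(\<integral>\<omega>. (\<Prod>j<m. z j ^ cell_count h n \<omega> j) \<partial>M) = (\<integral>\<omega>. (\<Prod>i=1..n. \<zeta> (S n i \<omega>)) \<partial>M)" by simp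
  also have "\<dots> = (\<Prod>i=1..n. \<integral>\<omega>. \<zeta> (S n i \<omega>) \<partial>M)"
  proof (cases "n = 0")
    case False
    have "indep_vars (\<lambda>_. borel) (\<lambda>i \<omega>. \<zeta> (S n i \<omega>)) {1..n}"
      by (rule indep_vars_compose2[OF indep_vars_subset[OF indep]]) auto
    then show ?thesis
      using \<zeta>01 by (intro indep_vars_lebesgue_integral integrable_bounded[where B=1]) auto
  qed (simp add: prob_space)
  also have "\<dots> = (1 + (\<Sum>j<m. (z j - 1) * measure (G n) (ycell h j))) ^ n"
    unfolding E by simp
  finally show "(\<integral>\<omega>. (\<Prod>j<m. z j ^ cell_count h n \<omega> j) \<partial>M) = (1 + (\<Sum>j<m. (z j - 1) * measure (G n) (ycell h j))) ^ n" .
qed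

lemma cell_rate:
  assumes h: "h > 0"
  shows "(\<lambda>n. real n * measure (G n) (ycell h j)) \<longlonglongrightarrow> F (h * (real j + 1)) - (if j = 0 then 0 else F (h * real j))"
proof -
  have "measure (G n) (ycell h j) = measure (G n) {0..h * (real j + 1)} - (if j = 0 then 0 else measure (G n) {0..h * real j})" for n
  proof -
    interpret G: prob_space "G n" by (rule G_prob)
    show ?thesis by (rule measure_ycell[OF h G_sets]) simp
  qed
  moreover have "(\<lambda>n. real n * (measure (G n) {0..h * (real j + 1)} - (if j = 0 then 0 else measure (G n) {0..h * real j})))
      \<longlonglongrightarrow> F (h * (real j + 1)) - (if j = 0 then 0 else F (h * real j))"
  proof (cases "j = 0")
    case True
    then show ?thesis using rare[of h] h by simp
  next
    case False
    then show ?thesis using tendsto_diff[OF rare[of "h * (real j + 1)"] rare[of "h * real j"]] h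
      by (simp add: right_diff_distrib)
  qed
  ultimately show ?thesis by simp
qed

text \<open>A Poisson limit theorem for generating functions: as \<open>n\<close> times the cell
  probabilities converge, the powers in \<open>joint_pgf\<close> fall under
  \<open>one_plus_over_n_power_tendsto_exp\<close>.\<close>

lemma joint_pgf_tendsto:
  assumes h: "h > 0" and z: "\<And>j. 0 < z j \<and> z j < 1" and F: "\<And>j. l j = F (h * (real j + 1)) - (if j = 0 then 0 else F (h * real j))"
  shows "(\<lambda>n. \<integral>\<omega>. (\<Prod>j<m. z j ^ cell_count h n \<omega> j) \<partial>M) \<longlonglongrightarrow> exp (\<Sum>j<m. l j * (z j - 1))"
proof -
  let ?x = "\<lambda>n. \<Sum>j<m. (real n * measure (G n) (ycell h j)) * (z j - 1)"
  have rate: "(\<lambda>n. real n * measure (G n) (ycell h j)) \<longlonglongrightarrow> l j" for j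
    unfolding F by (rule cell_rate[OF h])
  have l0: "0 \<le> l j" for j by (rule LIMSEQ_le_const[OF rate[of j]]) auto
  have eq: "1 + (\<Sum>j<m. (z j - 1) * measure (G n) (ycell h j)) = 1 + ?x n / real n" if "n \<ge> 1" for n
    using that by (simp add: sum_divide_distrib mult_ac)
  have "(\<lambda>n. (1 + ?x n / real n) ^ n) \<longlonglongrightarrow> exp (\<Sum>j<m. l j * (z j - 1))"
  proof (rule one_plus_over_n_power_tendsto_exp)
    show "?x \<longlonglongrightarrow> (\<Sum>j<m. l j * (z j - 1))" by (intro tendsto_intros rate)
    show "\<bar>1 + ?x n / real n\<bar> \<le> 1" if "n \<ge> 1" for n
      unfolding eq[OF that, symmetric] by (rule joint_pgf(2)[OF h z])
    show "(\<Sum>j<m. l j * (z j - 1)) \<le> 0"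
      using l0 z by (intro sum_nonpos mult_nonneg_nonpos) (auto simp: less_imp_le)
  qed
  moreover have "eventually (\<lambda>n. (1 + ?x n / real n) ^ n = (\<integral>\<omega>. (\<Prod>j<m. z j ^ cell_count h n \<omega> j) \<partial>M)) sequentially"
    using eventually_ge_at_top[of 1] by eventually_elim (simp only: joint_pgf(1)[OF h z] eq)
  ultimately show ?thesis by (rule Lim_transform_eventually)
qed

end

section \<open>Convergence of the shares\<close>

definition share :: "nat \<Rightarrow> (nat \<Rightarrow> real) \<Rightarrow> nat \<Rightarrow> real" where
  "share k w i = (if i < k then w i / suminf w else 0)"

text \<open>Compact by Tychonoff, it contains the share vectors of weight sequences and all grid
  share vectors; on it a continuous \<open>f\<close> is uniformly continuous.\<close>

definition share_cube :: "nat \<Rightarrow> (nat \<Rightarrow> real) set" where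
  "share_cube k = {v. \<forall>i. if i < k then 0 \<le> v i \<and> v i \<le> 1 else v i = 0}"

lemma compact_share_cube: "compact (share_cube k)"
proof -
  have "share_cube k = (\<Pi>\<^sub>E i\<in>UNIV. if i < k then {0..1} else {0})"
    by (auto simp: share_cube_def PiE_UNIV_domain Pi_def split: if_splits)
  moreover have "compactin (product_topology (\<lambda>_. euclidean) UNIV) (\<Pi>\<^sub>E i\<in>UNIV. if i < k then {0..1::real} else {0})"
    unfolding compactin_PiE by auto
  ultimately show ?thesis by (simp add: euclidean_product_topology)
qed

lemma uniformly_close_on_share_cube:
  fixes f :: "(nat \<Rightarrow> real) \<Rightarrow> real"
  assumes f: "continuous_on UNIV f" and e: "e > 0"
  obtains \<delta> where "\<delta> > 0"
    "\<And>v v'. v \<in> share_cube k \<Longrightarrow> v' \<in> share_cube k \<Longrightarrow> (\<And>i. i < k \<Longrightarrow> \<bar>v i - v' i\<bar> < \<delta>) \<Longrightarrow> \<bar>f v - f v'\<bar> < e"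
proof -
  have "uniformly_continuous_on (share_cube k) f"
    by (rule compact_uniformly_continuous[OF continuous_on_subset[OF f] compact_share_cube]) simp
  then obtain d where d: "d > 0"
    "\<And>v v'. v \<in> share_cube k \<Longrightarrow> v' \<in> share_cube k \<Longrightarrow> dist v' v < d \<Longrightarrow> dist (f v') (f v) < e"
    unfolding uniformly_continuous_on_def using e by meson
  show ?thesis
  \<comment> \<open>The metric on functions sums truncated coordinate distances with geometric
    weights of total 2, so coordinates within \<open>d / 4\<close> give distance at most
    \<open>d / 2\<close>.\<close>
  proof (rule that[of "d / 4"])
    show "d / 4 > 0" using d by simp
    fix v v' assume v: "v \<in> share_cube k" "v' \<in> share_cube k" and close: "\<And>i. i < k \<Longrightarrow> \<bar>v i - v' i\<bar> < d / 4"
    have all: "dist (v' i) (v i) \<le> d / 4" for i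
      using v close[of i] d(1) by (cases "i < k") (auto simp: share_cube_def dist_real_def abs_minus_commute[of "v' i"] split: if_splits)
    have s: "summable (\<lambda>n. (1/2)^n * (d / 4) :: real)" by (intro summable_mult2) simp
    have "dist v' v = (\<Sum>n. (1/2)^n * min (dist (v' (from_nat n)) (v (from_nat n))) 1)"
      by (simp add: dist_fun_def)
    also have "\<dots> \<le> (\<Sum>n. (1/2)^n * (d / 4))"
    proof (rule suminf_le)
      show "(1/2)^n * min (dist (v' (from_nat n)) (v (from_nat n))) 1 \<le> (1/2)^n * (d / 4)" for n
        using all[of "from_nat n"] by (intro mult_left_mono) auto
      show "summable (\<lambda>n. (1/2)^n * min (dist (v' (from_nat n)) (v (from_nat n))) 1)"
        by (rule summable_comparison_test'[of "\<lambda>n. (1/2)^n"]) (auto simp add: summable_geometric_iff)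
    qed fact
    also have "\<dots> = d / 2" by (subst suminf_mult2[symmetric]) (auto simp: suminf_geometric)
    finally have "dist v' v < d" using d(1) by simp
    from d(2)[OF v this] show "\<bar>f v - f v'\<bar> < e" by (simp add: dist_real_def abs_minus_commute)
  qed
qed

lemma share_in_cube:
  assumes "weight_seq w" shows "share k w \<in> share_cube k"
proof -
  have w: "summable w" "\<And>i. 0 \<le> w i" using weight_seq_summable[OF assms] assms by (auto simp: weight_seq_def)
  have "w i \<le> suminf w" for i using sum_le_suminf[OF w(1), of "{i}"] w(2) by simp
  moreover have "0 \<le> suminf w" using suminf_nonneg[OF w] .
  ultimately have "0 \<le> w i / suminf w \<and> w i / suminf w \<le> 1" for i
    using w(2)[of i] by (cases "suminf w = 0") (auto simp: divide_le_eq_1)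
  then show ?thesis by (auto simp: share_cube_def share_def)
qed

lemma measurable_share:
  assumes [measurable]: "\<And>i. (\<lambda>\<omega>. w \<omega> i) \<in> borel_measurable M"
  shows "(\<lambda>\<omega>. share k (w \<omega>)) \<in> borel_measurable M"
proof (rule measurable_coordinatewise_then_product)
  fix i
  have "(\<lambda>\<omega>. if i < k then w \<omega> i / suminf (w \<omega>) else 0) \<in> borel_measurable M" by measurable
  then show "(\<lambda>\<omega>. share k (w \<omega>) i) \<in> borel_measurable M" by (simp add: share_def)
qed

definition grid_share :: "nat \<Rightarrow> real \<Rightarrow> nat \<Rightarrow> (nat \<Rightarrow> nat) \<Rightarrow> nat \<Rightarrow> real" where
  "grid_share k h m c i = (if i < k then disc_share h m c i else 0)"

lemma grid_share_cong:
  assumes "\<And>j. j < m \<Longrightarrow> c j = c' j" shows "grid_share k h m c = grid_share k h m c'"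
  unfolding grid_share_def fun_eq_iff using disc_share_cong[OF assms, where h=h] by simp

text \<open>Outside a bad event the two share vectors are within \<open>\<delta>\<close> in each
  coordinate, so \<open>f\<close> changes by less than \<open>\<epsilon>\<close>; on it
  \<open>f\<close> changes by at most \<open>2 * B\<close>. The event is bad if the first weight is
  below \<open>\<eta>\<close> or the sum of the roots is large, the latter bounded by Markov's
  inequality.\<close>

lemma (in prob_space) expectation_grid_share_close:
  fixes w :: "'a \<Rightarrow> nat \<Rightarrow> real" and f :: "(nat \<Rightarrow> real) \<Rightarrow> real"
  assumes w[measurable]: "\<And>i. (\<lambda>\<omega>. w \<omega> i) \<in> borel_measurable M"
    and good: "AE \<omega> in M. weight_seq (w \<omega>)"
    and C[measurable]: "\<And>j. (\<lambda>\<omega>. C \<omega> j) \<in> measurable M (count_space UNIV)"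
    and cnt: "AE \<omega> in M. \<forall>j. C \<omega> j = card {i. w \<omega> i \<in> wcell (\<delta> / 8) j}"
    and K: "(\<integral>\<^sup>+\<omega>. (\<Sum>i. ennreal (sqrt (w \<omega> i))) \<partial>M) \<le> ennreal K" "K \<ge> 0"
    and f: "continuous_on UNIV f" "\<And>v. \<bar>f v\<bar> \<le> B"
    and \<delta>: "\<delta> > 0" and \<epsilon>: "\<epsilon> > 0"
      "\<And>v v'. v \<in> share_cube k \<Longrightarrow> v' \<in> share_cube k \<Longrightarrow> (\<And>i. i < k \<Longrightarrow> \<bar>v i - v' i\<bar> < \<delta>) \<Longrightarrow> \<bar>f v - f v'\<bar> < \<epsilon>"
    and m: "m \<ge> 1" and \<eta>: "\<eta> > 0"
  shows "\<bar>(\<integral>\<omega>. f (share k (w \<omega>)) \<partial>M) - (\<integral>\<omega>. f (grid_share k (\<delta> / 8) m (C \<omega>)) \<partial>M)\<bar>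
    \<le> \<epsilon> + 2 * B * (prob {\<omega> \<in> space M. w \<omega> 0 < \<eta>} + K * (4 * exp (- \<delta> * real m / 16) / (\<delta> * \<eta>)))"
proof -
  let ?h = "\<delta> / 8"
  define q where "q = exp (- ?h * real m / 2)"
  \<comment> \<open>Chosen so that a sum of roots below \<open>1 / c\<close> costs less than
    \<open>\<delta> / 2\<close>; the rounding with \<open>h = \<delta> / 8\<close> costs
    \<open>2 * h = \<delta> / 4\<close>, and the total stays below \<open>\<delta>\<close>.\<close>
  define c where "c = 4 * q / (\<delta> * \<eta>)"
  have c: "c > 0" using \<delta> \<eta> by (simp add: c_def q_def)
  have B0: "B \<ge> 0" using f(2)[of undefined] by linarith
  define T where "T = (\<lambda>\<omega>. \<Sum>i. ennreal (sqrt (w \<omega> i)))"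
  have T[measurable]: "T \<in> borel_measurable M" unfolding T_def by measurable
  define bad where "bad = {\<omega> \<in> space M. w \<omega> 0 < \<eta>} \<union> {\<omega> \<in> space M. 1 \<le> ennreal c * T \<omega>}"
  have bad[measurable]: "bad \<in> sets M" unfolding bad_def by measurable
  have "emeasure M {\<omega> \<in> space M. 1 \<le> ennreal c * T \<omega>} \<le> ennreal c * (\<integral>\<^sup>+\<omega>. T \<omega> * indicator (space M) \<omega> \<partial>M)"
    by (rule nn_integral_Markov_inequality) measurable
  also have "(\<integral>\<^sup>+\<omega>. T \<omega> * indicator (space M) \<omega> \<partial>M) = (\<integral>\<^sup>+\<omega>. T \<omega> \<partial>M)"
    by (intro nn_integral_cong) simp
  also have "ennreal c * \<dots> \<le> ennreal c * ennreal K" using K by (intro mult_left_mono) (auto simp: T_def)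
  also have "\<dots> = ennreal (c * K)" using c K(2) by (simp add: ennreal_mult)
  finally have "prob {\<omega> \<in> space M. 1 \<le> ennreal c * T \<omega>} \<le> K * c"
    using c K(2) by (simp add: emeasure_eq_measure mult.commute)
  moreover have "prob bad \<le> prob {\<omega> \<in> space M. w \<omega> 0 < \<eta>} + prob {\<omega> \<in> space M. 1 \<le> ennreal c * T \<omega>}"
    unfolding bad_def by (rule measure_Un_le) auto
  ultimately have pbad: "prob bad \<le> prob {\<omega> \<in> space M. w \<omega> 0 < \<eta>} + K * c" by linarith
  have V[measurable]: "(\<lambda>\<omega>. f (share k (w \<omega>))) \<in> borel_measurable M"
    by (rule measurable_compose[OF measurable_share[OF w] borel_measurable_continuous_onI[OF f(1)]])
  have D[measurable]: "(\<lambda>\<omega>. f (grid_share k ?h m (C \<omega>))) \<in> borel_measurable M"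
    by (rule measurable_finite_dependence[where m=m, OF _ C]) (metis grid_share_cong)
  have I1: "integrable M (\<lambda>\<omega>. f (share k (w \<omega>)))" by (rule integrable_bounded[where B=B]) (auto simp: f(2))
  have I2: "integrable M (\<lambda>\<omega>. f (grid_share k ?h m (C \<omega>)))" by (rule integrable_bounded[where B=B]) (auto simp: f(2))
  have I3: "integrable M (\<lambda>\<omega>. \<epsilon> + 2 * B * indicator bad \<omega>)"
    by (intro Bochner_Integration.integrable_add integrable_mult_right) (auto simp: emeasure_eq_measure)
  have "(\<integral>\<omega>. f (share k (w \<omega>)) \<partial>M) - (\<integral>\<omega>. f (grid_share k ?h m (C \<omega>)) \<partial>M)
      = (\<integral>\<omega>. f (share k (w \<omega>)) - f (grid_share k ?h m (C \<omega>)) \<partial>M)" using I1 I2 by simp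
  also have "\<bar>\<dots>\<bar> \<le> (\<integral>\<omega>. \<epsilon> + 2 * B * indicator bad \<omega> \<partial>M)"
  proof (rule abs_integral_le[OF Bochner_Integration.integrable_diff[OF I1 I2] I3])
    show "AE \<omega> in M. \<bar>f (share k (w \<omega>)) - f (grid_share k ?h m (C \<omega>))\<bar> \<le> \<epsilon> + 2 * B * indicator bad \<omega>"
      using good cnt AE_space
    proof eventually_elim
      case (elim \<omega>)
      show ?case
      proof (cases "\<omega> \<in> bad")
        case True
        then show ?thesis using f(2)[of "share k (w \<omega>)"] f(2)[of "grid_share k ?h m (C \<omega>)"] \<epsilon>(1) by simp
      next
        case False
        let ?S = "\<Sum>i. sqrt (w \<omega> i)"
        have w0: "w \<omega> 0 \<ge> \<eta>" and Tc: "ennreal c * T \<omega> < 1" using False elim by (auto simp: bad_def)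
        have ws: "summable (\<lambda>i. sqrt (w \<omega> i))" "\<And>i. 0 \<le> sqrt (w \<omega> i)" using elim(1) by (auto simp: weight_seq_def)
        have S0: "?S \<ge> 0" using suminf_nonneg[OF ws] .
        have "T \<omega> = ennreal ?S" unfolding T_def using ws by (intro suminf_ennreal2) auto
        then have "ennreal (c * ?S) < 1" using Tc c S0 by (simp add: ennreal_mult)
        then have "c * ?S < 1" by (simp add: ennreal_less_one_iff)
        then have qS: "2 * q * ?S / \<eta> < \<delta> / 2" using \<delta> \<eta> unfolding c_def by (simp add: field_simps)
        have "\<bar>f (share k (w \<omega>)) - f (grid_share k ?h m (C \<omega>))\<bar> < \<epsilon>"
        proof (rule \<epsilon>(2))
          show "share k (w \<omega>) \<in> share_cube k" using elim(1) by (rule share_in_cube)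
          show "grid_share k ?h m (C \<omega>) \<in> share_cube k"
            by (simp add: grid_share_def share_cube_def disc_share_bounds)
          fix i assume i: "i < k"
          have "\<bar>w \<omega> i / suminf (w \<omega>) - disc_share ?h m (C \<omega>) i\<bar> \<le> 2 * ?h + 2 * q * ?S / w \<omega> 0"
            unfolding q_def using elim \<delta> m by (intro share_disc_share_diff) auto
          also have "2 * q * ?S / w \<omega> 0 \<le> 2 * q * ?S / \<eta>"
            using w0 \<eta> S0 by (intro divide_left_mono mult_nonneg_nonneg mult_pos_pos) (auto simp: q_def)
          finally show "\<bar>share k (w \<omega>) i - grid_share k ?h m (C \<omega>) i\<bar> < \<delta>"
            using i qS \<delta> by (simp add: share_def grid_share_def)
        qed
        then show ?thesis using False by simp
      qed
    qed
  qed
  also have "\<dots> = \<epsilon> + 2 * B * prob bad" by (simp add: emeasure_eq_measure prob_space)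
  also have "\<dots> \<le> \<epsilon> + 2 * B * (prob {\<omega> \<in> space M. w \<omega> 0 < \<eta>} + K * c)"
    using pbad B0 by (intro add_left_mono mult_left_mono) auto
  finally show ?thesis by (simp add: c_def q_def mult.commute)
qed

text \<open>This makes smallness of the largest weight an event about finitely many counts, so that
  its probability passes to the limit.\<close>

lemma wcell_counts_0_iff:
  assumes w: "weight_seq w" and h: "h > 0" and c: "\<And>j. c j = card {i. w i \<in> wcell h j}" and m: "m \<ge> 1"
  shows "(\<forall>j<m. c j = 0) \<longleftrightarrow> w 0 < exp (- h * real m)"
proof -
  have "0 < (\<Sum>l\<le>m - 1. c l) \<longleftrightarrow> exp (- h * (real (m - 1) + 1)) \<le> w 0"
    using m by (intro cumulative_count[OF w h, of m]) (auto simp: c)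
  moreover have "(\<Sum>l\<le>m - 1. c l) = 0 \<longleftrightarrow> (\<forall>j<m. c j = 0)" using m by auto
  moreover have "real (m - 1) + 1 = real m" using m by simp
  ultimately show ?thesis by (metis gr0I less_irrefl not_le)
qed

text \<open>Sample and limit are each compared with their grid shares, which are functions of
  finitely many counts and converge. All parameters are chosen before \<open>n\<close>:
  \<open>\<delta>\<close> from uniform continuity of \<open>f\<close>, \<open>\<eta>\<close> from
  the first weight of the limit, then \<open>m\<close> to make the tail term small.\<close>

theorem shares_conv_in_distr:
  fixes w :: "nat \<Rightarrow> 'm \<Rightarrow> nat \<Rightarrow> real" and v :: "'p \<Rightarrow> nat \<Rightarrow> real"
    and C :: "real \<Rightarrow> nat \<Rightarrow> 'm \<Rightarrow> nat \<Rightarrow> nat" and R :: "real \<Rightarrow> 'p \<Rightarrow> nat \<Rightarrow> nat"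
  assumes M: "prob_space M" and P: "prob_space P"
    and w: "\<And>n i. (\<lambda>\<omega>. w n \<omega> i) \<in> borel_measurable M"
    and v: "\<And>i. (\<lambda>\<omega>. v \<omega> i) \<in> borel_measurable P"
    and wg: "\<And>n. n \<ge> 1 \<Longrightarrow> AE \<omega> in M. weight_seq (w n \<omega>)" and vg: "AE \<omega> in P. weight_seq (v \<omega>)"
    and C: "\<And>h n j. (\<lambda>\<omega>. C h n \<omega> j) \<in> measurable M (count_space UNIV)"
    and R: "\<And>h j. (\<lambda>\<omega>. R h \<omega> j) \<in> measurable P (count_space UNIV)"
    and Cc: "\<And>h n. h > 0 \<Longrightarrow> n \<ge> 1 \<Longrightarrow> AE \<omega> in M. \<forall>j. C h n \<omega> j = card {i. w n \<omega> i \<in> wcell h j}"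
    and Rc: "\<And>h. h > 0 \<Longrightarrow> AE \<omega> in P. \<forall>j. R h \<omega> j = card {i. v \<omega> i \<in> wcell h j}"
    and wK: "\<And>n. n \<ge> 1 \<Longrightarrow> (\<integral>\<^sup>+\<omega>. (\<Sum>i. ennreal (sqrt (w n \<omega> i))) \<partial>M) \<le> ennreal K"
    and vK: "(\<integral>\<^sup>+\<omega>. (\<Sum>i. ennreal (sqrt (v \<omega> i))) \<partial>P) \<le> ennreal K" and K: "K \<ge> 0"
    and lim: "\<And>h m (z :: nat \<Rightarrow> real). h > 0 \<Longrightarrow> (\<And>j. 0 < z j \<and> z j < 1) \<Longrightarrow>
      (\<lambda>n. \<integral>\<omega>. (\<Prod>j<m. z j ^ C h n \<omega> j) \<partial>M) \<longlonglongrightarrow> (\<integral>\<omega>. (\<Prod>j<m. z j ^ R h \<omega> j) \<partial>P)"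
  shows "conv_in_distr M (\<lambda>n \<omega>. share k (w n \<omega>)) P (\<lambda>\<omega>. share k (v \<omega>))"
  unfolding conv_in_distr_def
proof (intro allI impI)
  fix f :: "(nat \<Rightarrow> real) \<Rightarrow> real" assume f: "continuous_on UNIV f" and "bounded (range f)"
  then obtain B where B: "B > 0" "\<And>v. \<bar>f v\<bar> \<le> B" by (auto simp: bounded_pos)
  interpret P: prob_space P by fact
  interpret M: prob_space M by fact
  note [measurable] = w v C R
  have glim: "(\<lambda>n. \<integral>\<omega>. g (C h n \<omega>) \<partial>M) \<longlonglongrightarrow> (\<integral>\<omega>. g (R h \<omega>) \<partial>P)"
    if h: "h > 0" and g: "\<And>c c'. (\<And>j. j < m \<Longrightarrow> c j = c' j) \<Longrightarrow> g c = g c'" "\<And>c. \<bar>g c\<bar> \<le> B'"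
    for g :: "(nat \<Rightarrow> nat) \<Rightarrow> real" and m h B'
    by (rule prob_tendsto_imp_expectation_tendsto[OF M P C R joint_pgf_tendsto_imp_prob_tendsto[OF M P C R lim[OF h]] g])
  show "(\<lambda>n. \<integral>\<omega>. f (share k (w n \<omega>)) \<partial>M) \<longlonglongrightarrow> (\<integral>\<omega>. f (share k (v \<omega>)) \<partial>P)"
  proof (rule tendstoI)
    fix e :: real assume e: "e > 0"
    define \<epsilon> where "\<epsilon> = e / 6"
    \<comment> \<open>Two bad probabilities below \<open>p\<close> cost at most
      \<open>2 * B * (2 * p) = e / 6\<close>; with \<open>\<epsilon> = e / 6\<close> each comparison
      costs \<open>e / 3\<close>.\<close>
    define p where "p = e / (24 * B)"
    have \<epsilon>: "\<epsilon> > 0" and p: "p > 0" using e B by (auto simp: \<epsilon>_def p_def)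
    obtain \<delta> where \<delta>: "\<delta> > 0"
      "\<And>v v'. v \<in> share_cube k \<Longrightarrow> v' \<in> share_cube k \<Longrightarrow> (\<And>i. i < k \<Longrightarrow> \<bar>v i - v' i\<bar> < \<delta>) \<Longrightarrow> \<bar>f v - f v'\<bar> < \<epsilon>"
      using uniformly_close_on_share_cube[OF f \<epsilon>] by blast
    \<comment> \<open>The first weight of the limit is almost surely positive, so it falls below
      \<open>exp (- r)\<close> with probability tending to 0.\<close>
    have "(\<lambda>r. P.prob {\<omega> \<in> space P. v \<omega> 0 < exp (- 1 * real r)}) \<longlonglongrightarrow> P.prob (\<Inter>r. {\<omega> \<in> space P. v \<omega> 0 < exp (- 1 * real r)})"
    proof (rule P.finite_Lim_measure_decseq)
      show "decseq (\<lambda>r. {\<omega> \<in> space P. v \<omega> 0 < exp (- 1 * real r)})"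
        unfolding decseq_def by (auto intro: less_le_trans)
    qed auto
    also have "P.prob (\<Inter>r. {\<omega> \<in> space P. v \<omega> 0 < exp (- 1 * real r)}) = 0"
    proof -
      have "AE \<omega> in P. \<omega> \<notin> (\<Inter>r. {\<omega> \<in> space P. v \<omega> 0 < exp (- 1 * real r)})"
        using vg
      proof eventually_elim
        case (elim \<omega>)
        then have v0: "v \<omega> 0 > 0" by (simp add: weight_seq_def)
        obtain r :: nat where "real r > - ln (v \<omega> 0)" using reals_Archimedean2 by blast
        then have "exp (- 1 * real r) < exp (ln (v \<omega> 0))" by simp
        then have "\<not> v \<omega> 0 < exp (- 1 * real r)" using v0 by simp
        then show ?case by blast
      qed
      then show ?thesis by (subst P.prob_eq_0) (auto)
    qed
    finally have "eventually (\<lambda>r. P.prob {\<omega> \<in> space P. v \<omega> 0 < exp (- 1 * real r)} < p) sequentially"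
      using p by (rule order_tendstoD)
    then have "eventually (\<lambda>r. P.prob {\<omega> \<in> space P. v \<omega> 0 < exp (- 1 * real r)} < p \<and> r \<ge> 1) sequentially"
      using eventually_ge_at_top by (rule eventually_conj)
    then obtain r where r: "P.prob {\<omega> \<in> space P. v \<omega> 0 < exp (- 1 * real r)} < p" "r \<ge> 1"
      by (auto simp: eventually_sequentially)
    define \<eta> where "\<eta> = exp (- 1 * real r)"
    have \<eta>: "\<eta> > 0" by (simp add: \<eta>_def)
    have vp: "P.prob {\<omega> \<in> space P. v \<omega> 0 < \<eta>} < p" using r by (simp add: \<eta>_def)
    \<comment> \<open>A separate grid of width 1 is used here: its first \<open>r\<close> cells are
      empty exactly when the first weight is below \<open>\<eta> = exp (- r)\<close>.\<close>
    let ?g = "\<lambda>c :: nat \<Rightarrow> nat. of_bool (\<forall>j<r. c j = 0) :: real"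
    have gm: "(\<lambda>\<omega>. ?g (c \<omega>)) \<in> borel_measurable N"
      if "\<And>j. (\<lambda>\<omega>. c \<omega> j) \<in> measurable N (count_space UNIV)" for c :: "'x \<Rightarrow> nat \<Rightarrow> nat" and N
      by (rule measurable_finite_dependence[where m=r, OF _ that]) auto
    have "(\<integral>\<omega>. ?g (R 1 \<omega>) \<partial>P) = P.prob {\<omega> \<in> space P. v \<omega> 0 < \<eta>}"
    proof -
      have "(\<integral>\<omega>. ?g (R 1 \<omega>) \<partial>P) = (\<integral>\<omega>. indicator {\<omega> \<in> space P. v \<omega> 0 < \<eta>} \<omega> \<partial>P)"
      proof (rule integral_cong_AE)
        show "AE \<omega> in P. ?g (R 1 \<omega>) = indicator {\<omega> \<in> space P. v \<omega> 0 < \<eta>} \<omega>"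
          using vg Rc[OF zero_less_one] AE_space
          by eventually_elim (use r(2) in \<open>simp add: wcell_counts_0_iff[where h=1] \<eta>_def indicator_def\<close>)
      qed (use gm[OF R] in auto)
      then show ?thesis by simp
    qed
    moreover have "(\<integral>\<omega>. ?g (C 1 n \<omega>) \<partial>M) = M.prob {\<omega> \<in> space M. w n \<omega> 0 < \<eta>}" if n: "n \<ge> 1" for n
    proof -
      have "(\<integral>\<omega>. ?g (C 1 n \<omega>) \<partial>M) = (\<integral>\<omega>. indicator {\<omega> \<in> space M. w n \<omega> 0 < \<eta>} \<omega> \<partial>M)"
      proof (rule integral_cong_AE)
        show "AE \<omega> in M. ?g (C 1 n \<omega>) = indicator {\<omega> \<in> space M. w n \<omega> 0 < \<eta>} \<omega>"
          using wg[OF n] Cc[OF zero_less_one n] AE_space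
          by eventually_elim (use r(2) in \<open>simp add: wcell_counts_0_iff[where h=1] \<eta>_def indicator_def\<close>)
      qed (use gm[OF C] in auto)
      then show ?thesis by simp
    qed
    moreover have "(\<lambda>n. \<integral>\<omega>. ?g (C 1 n \<omega>) \<partial>M) \<longlonglongrightarrow> (\<integral>\<omega>. ?g (R 1 \<omega>) \<partial>P)"
      by (rule glim[of 1 r ?g 1]) auto
    ultimately have "eventually (\<lambda>n. (\<integral>\<omega>. ?g (C 1 n \<omega>) \<partial>M) < p) sequentially"
      using vp by (intro order_tendstoD) auto
    then have wp: "eventually (\<lambda>n. M.prob {\<omega> \<in> space M. w n \<omega> 0 < \<eta>} < p) sequentially"
      using eventually_ge_at_top[of 1]
    proof eventually_elim
      case (elim n)
      then show ?case using \<open>\<And>n. n \<ge> 1 \<Longrightarrow> (\<integral>\<omega>. ?g (C 1 n \<omega>) \<partial>M) = _\<close>[of n] by simp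
    qed
    have "(\<lambda>m. K * (4 * exp (- \<delta> * real m / 16) / (\<delta> * \<eta>))) \<longlonglongrightarrow> K * (4 * 0 / (\<delta> * \<eta>))"
    proof (intro tendsto_intros)
      have "(\<lambda>m. exp (- (\<delta> / 16)) ^ m) \<longlonglongrightarrow> 0" using \<delta> by (intro LIMSEQ_power_zero) simp
      then show "(\<lambda>m. exp (- \<delta> * real m / 16)) \<longlonglongrightarrow> 0" by (simp add: exp_of_nat_mult[symmetric] mult.commute)
    qed (use \<delta> \<eta> in auto)
    then have "eventually (\<lambda>m. K * (4 * exp (- \<delta> * real m / 16) / (\<delta> * \<eta>)) < p) sequentially"
      using p by (intro order_tendstoD) auto
    then have "eventually (\<lambda>m. K * (4 * exp (- \<delta> * real m / 16) / (\<delta> * \<eta>)) < p \<and> m \<ge> 1) sequentially"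
      using eventually_ge_at_top by (rule eventually_conj)
    then obtain m where m: "K * (4 * exp (- \<delta> * real m / 16) / (\<delta> * \<eta>)) < p" "m \<ge> 1"
      by (auto simp: eventually_sequentially)
    have h: "\<delta> / 8 > 0" using \<delta> by simp
    let ?G = "\<lambda>c. f (grid_share k (\<delta> / 8) m c)"
    have fin: "\<epsilon> + 2 * B * (x + y) \<le> e / 3" if "x < p" "y < p" for x y
    proof -
      have "2 * B * (x + y) \<le> 2 * B * (p + p)" using that B by (intro mult_left_mono) auto
      also have "\<dots> = e / 6" using B by (simp add: p_def)
      finally show ?thesis by (simp add: \<epsilon>_def)
    qed
    have vclose: "\<bar>(\<integral>\<omega>. f (share k (v \<omega>)) \<partial>P) - (\<integral>\<omega>. ?G (R (\<delta> / 8) \<omega>) \<partial>P)\<bar> \<le> e / 3"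
      by (rule order_trans[OF P.expectation_grid_share_close[OF v vg R Rc[OF h] vK K f B(2) \<delta>(1) \<epsilon> \<delta>(2) m(2) \<eta>] fin[OF vp m(1)]])
    have "(\<lambda>n. \<integral>\<omega>. ?G (C (\<delta> / 8) n \<omega>) \<partial>M) \<longlonglongrightarrow> (\<integral>\<omega>. ?G (R (\<delta> / 8) \<omega>) \<partial>P)"
      by (rule glim[of "\<delta> / 8" m ?G B, OF h _ B(2)]) (metis grid_share_cong)
    then have "eventually (\<lambda>n. dist (\<integral>\<omega>. ?G (C (\<delta> / 8) n \<omega>) \<partial>M) (\<integral>\<omega>. ?G (R (\<delta> / 8) \<omega>) \<partial>P) < e / 3) sequentially"
      using e by (intro tendstoD) auto
    with wp eventually_ge_at_top[of 1]
    show "eventually (\<lambda>n. dist (\<integral>\<omega>. f (share k (w n \<omega>)) \<partial>M) (\<integral>\<omega>. f (share k (v \<omega>)) \<partial>P) < e) sequentially"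
    proof eventually_elim
      case (elim n)
      have "\<bar>(\<integral>\<omega>. f (share k (w n \<omega>)) \<partial>M) - (\<integral>\<omega>. ?G (C (\<delta> / 8) n \<omega>) \<partial>M)\<bar> \<le> e / 3"
        by (rule order_trans[OF M.expectation_grid_share_close[OF w wg[OF elim(2)] C Cc[OF h elim(2)] wK[OF elim(2)] K f B(2) \<delta>(1) \<epsilon> \<delta>(2) m(2) \<eta>] fin[OF elim(1) m(1)]])
      then show ?case using vclose elim(3) unfolding dist_real_def by linarith
    qed
  qed
qed

section \<open>Rescaling and conclusion\<close>

text \<open>Near 0 the limit gives the bound, and from \<open>b\<close> on
  \<open>H t \<le> 1 \<le> (t / b) powr a\<close>. A bound for all \<open>t > 0\<close> is needed
  because, at fixed \<open>n\<close>, the windows reach arbitrarily far.\<close>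

lemma regular_variation_bound:
  fixes H :: "real \<Rightarrow> real"
  assumes lim: "((\<lambda>t. H t / t powr a) \<longlongrightarrow> C) (at_right 0)" and H: "\<And>t. H t \<le> 1" and a: "a > 0"
  obtains c where "c \<ge> 0" "\<And>t. t > 0 \<Longrightarrow> H t \<le> c * t powr a"
proof -
  have "eventually (\<lambda>t. H t / t powr a < \<bar>C\<bar> + 1) (at_right 0)"
    using lim by (rule order_tendstoD) simp
  then obtain b where b: "b > 0" "\<And>t. 0 < t \<Longrightarrow> t < b \<Longrightarrow> H t / t powr a < \<bar>C\<bar> + 1"
    by (auto simp: eventually_at_right_field)
  define c where "c = max (\<bar>C\<bar> + 1) (1 / b powr a)"
  show ?thesis
  proof (rule that[of c])
    show "c \<ge> 0" by (simp add: c_def le_max_iff_disj)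
    fix t :: real assume t: "t > 0"
    show "H t \<le> c * t powr a"
    proof (cases "t < b")
      case True
      then have "H t < (\<bar>C\<bar> + 1) * t powr a" using b(2)[OF t] t by (simp add: pos_divide_less_eq)
      also have "\<dots> \<le> c * t powr a" by (intro mult_right_mono) (auto simp: c_def)
      finally show ?thesis by simp
    next
      case False
      have "H t \<le> 1" by (rule H)
      also have "1 \<le> 1 / b powr a * t powr a"
        using False b(1) a by (simp add: powr_mono2)
      also have "\<dots> \<le> c * t powr a" by (intro mult_right_mono) (auto simp: c_def)
      finally show ?thesis .
    qed
  qed
qed

text \<open>With \<open>\<alpha> a = 1\<close>, \<open>n (y / \<beta> n)\<^sup>a\<close> is \<open>y\<^sup>a\<close> times the \<open>-a\<close>-th power of \<open>\<beta> n / n\<^sup>\<alpha>\<close>.\<close>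

lemma
  fixes H :: "real \<Rightarrow> real" and \<beta> :: "nat \<Rightarrow> real"
  assumes lim: "((\<lambda>t. H t / t powr a) \<longlongrightarrow> C) (at_right 0)" and H: "\<And>t. H t \<le> 1" and a: "a > 0"
    and \<alpha>: "\<alpha> * a = 1" and \<beta>: "\<And>n. \<beta> n > 0" and g: "\<gamma> > 0" and bl: "(\<lambda>n. \<beta> n * real n powr (- \<alpha>)) \<longlonglongrightarrow> \<gamma>"
  shows rescaled_limit: "y > 0 \<Longrightarrow> (\<lambda>n. real n * H (y / \<beta> n)) \<longlonglongrightarrow> C * (y / \<gamma>) powr a"
    and rescaled_bound: "\<exists>c\<ge>0. \<forall>n\<ge>1. \<forall>y>0. real n * H (y / \<beta> n) \<le> c * y powr a"
proof -
  let ?b = "\<lambda>n. \<beta> n * real n powr (- \<alpha>)"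
  have \<alpha>0: "\<alpha> > 0" using \<alpha> a by (metis zero_less_mult_pos2 zero_less_one)
  have scale: "real n * (y / \<beta> n) powr a = y powr a * ?b n powr (- a)" if "n \<ge> 1" "y > 0" for n y
  proof -
    have "?b n powr (- a) = \<beta> n powr (- a) * (real n powr (- \<alpha>)) powr (- a)"
      by (rule powr_mult)
    also have "(real n powr (- \<alpha>)) powr (- a) = real n" using that \<alpha> by (simp add: powr_powr)
    finally have E: "?b n powr (- a) = \<beta> n powr (- a) * real n" .
    show ?thesis unfolding E by (simp add: powr_divide powr_minus_divide)
  qed
  have bp: "(\<lambda>n. ?b n powr (- a)) \<longlonglongrightarrow> \<gamma> powr (- a)"
    using g by (intro tendsto_powr bl tendsto_const) auto
  show "(\<lambda>n. real n * H (y / \<beta> n)) \<longlonglongrightarrow> C * (y / \<gamma>) powr a" if y: "y > 0"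
  proof -
    \<comment> \<open>The limit of \<open>H\<close> is taken at 0 from the right, so
      \<open>y / \<beta> n\<close> must tend to 0: it is a null sequence divided by a sequence with
      limit \<open>\<gamma> > 0\<close>.\<close>
    have "(\<lambda>n. real n powr (- \<alpha>)) \<longlonglongrightarrow> 0"
      using \<alpha>0 by (intro tendsto_neg_powr filterlim_real_sequentially) auto
    then have "(\<lambda>n. y * real n powr (- \<alpha>) / ?b n) \<longlonglongrightarrow> y * 0 / \<gamma>"
      using g by (intro tendsto_intros bl) auto
    moreover have "eventually (\<lambda>n. y * real n powr (- \<alpha>) / ?b n = y / \<beta> n) sequentially"
      using eventually_ge_at_top[of 1] by eventually_elim (use \<beta> in \<open>simp add: less_imp_neq[symmetric]\<close>)
    ultimately have "(\<lambda>n. y / \<beta> n) \<longlonglongrightarrow> y * 0 / \<gamma>" by (rule Lim_transform_eventually)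
    then have "filterlim (\<lambda>n. y / \<beta> n) (at_right 0) sequentially"
      using y \<beta> by (intro tendsto_imp_filterlim_at_right always_eventually) auto
    then have "(\<lambda>n. H (y / \<beta> n) / (y / \<beta> n) powr a) \<longlonglongrightarrow> C" by (rule filterlim_compose[OF lim])
    then have "(\<lambda>n. H (y / \<beta> n) / (y / \<beta> n) powr a * (y powr a * ?b n powr (- a))) \<longlonglongrightarrow> C * (y powr a * \<gamma> powr (- a))"
      by (intro tendsto_intros bp)
    moreover have "eventually (\<lambda>n. H (y / \<beta> n) / (y / \<beta> n) powr a * (y powr a * ?b n powr (- a)) = real n * H (y / \<beta> n)) sequentially"
      using eventually_ge_at_top[of 1]
    proof eventually_elim
      case (elim n)
      have "(y / \<beta> n) powr a > 0" using y \<beta>[of n] by simp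
      then show ?case unfolding scale[OF elim y, symmetric] by simp
    qed
    ultimately have "(\<lambda>n. real n * H (y / \<beta> n)) \<longlonglongrightarrow> C * (y powr a * \<gamma> powr (- a))"
      by (rule Lim_transform_eventually)
    then show ?thesis by (simp add: powr_divide powr_minus_divide)
  qed
  obtain c where c: "c \<ge> 0" "\<And>t. t > 0 \<Longrightarrow> H t \<le> c * t powr a"
    using regular_variation_bound[OF lim H a] by blast
  have "Bseq (\<lambda>n. ?b n powr (- a))" using bp by (rule convergent_imp_Bseq[OF convergentI])
  then obtain K where K: "K > 0" "\<And>n. norm (?b n powr (- a)) \<le> K" unfolding Bseq_def by blast
  show "\<exists>c\<ge>0. \<forall>n\<ge>1. \<forall>y>0. real n * H (y / \<beta> n) \<le> c * y powr a"
  proof (intro exI[of _ "c * K"] conjI allI impI)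
    show "c * K \<ge> 0" using c K by simp
    fix n :: nat and y :: real assume n: "n \<ge> 1" and y: "y > 0"
    have "real n * H (y / \<beta> n) \<le> real n * (c * (y / \<beta> n) powr a)"
      using c(2)[of "y / \<beta> n"] y \<beta>[of n] by (intro mult_left_mono) auto
    also have "\<dots> = c * (y powr a * ?b n powr (- a))" using scale[OF n y] by (simp add: mult_ac)
    also have "\<dots> \<le> c * (y powr a * K)" using K(2)[of n] c(1) by (intro mult_left_mono) auto
    finally show "real n * H (y / \<beta> n) \<le> c * K * y powr a" by (simp add: mult_ac)
  qed
qed

lemma AE_density_sphere_surface:
  fixes \<rho> :: "'a::euclidean_space \<Rightarrow> real"
  assumes "continuous_on (sphere 0 1) \<rho>"
  shows "AE x in density sphere_surface (\<lambda>x. ennreal (\<rho> x)). x \<in> sphere 0 1"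
proof -
  have "(\<lambda>x. indicator (sphere 0 1) x * \<rho> x) \<in> borel_measurable borel"
    using borel_measurable_continuous_on_indicator[OF _ assms] by simp
  then have "(\<lambda>x. ennreal (indicator (sphere 0 1) x * \<rho> x)) \<in> borel_measurable sphere_surface"
    by (simp add: measurable_cong_sets[OF sets_sphere_surface refl])
  moreover have "AE x in sphere_surface. 0 < ennreal (indicator (sphere 0 1) x * \<rho> x) \<longrightarrow> x \<in> sphere 0 1"
    using AE_sphere_surface by eventually_elim simp
  ultimately show ?thesis unfolding density_sphere_surface_restrict[of \<rho>] by (simp only: AE_density)
qed

text \<open>Dividing by the positive total commutes with sorting. Where \<open>desc_stat\<close>
  falls back to 0, for \<open>i \<ge> n\<close> and in particular for \<open>n = 0\<close>, the zero
  padding agrees with it.\<close>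

lemma share_order_stat_attn:
  "share k (order_stat n (\<lambda>j. exp (- (b * (1 - inner q (x j)))))) i =
    (if i < k then desc_stat (i + 1) (map (attn q b x n) [1..<n + 1]) else 0)"
proof (cases "n = 0")
  case True
  then show ?thesis by (simp add: share_def order_stat_def desc_stat_def)
next
  case False
  let ?a = "\<lambda>j. exp (- (b * (1 - inner q (x j))))"
  have Z: "(\<Sum>j=1..n. ?a j) > 0" using False by (intro sum_pos) auto
  have "map (attn q b x n) [1..<n + 1] = map (\<lambda>y. y / (\<Sum>j=1..n. ?a j)) (map ?a [1..<n + 1])"
    by (simp add: attn_def comp_def del: upt_Suc)
  then have "desc_stat (i + 1) (map (attn q b x n) [1..<n + 1]) = order_stat n ?a i / (\<Sum>j=1..n. ?a j)"
    by (simp only: desc_stat_map_divide[OF Z] order_stat_def Suc_eq_plus1)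
  also have "(\<Sum>j=1..n. ?a j) = suminf (order_stat n ?a)"
    by (rule suminf_order_stat[of "\<lambda>x. x" n ?a, symmetric]) simp
  finally have E: "desc_stat (i + 1) (map (attn q b x n) [1..<n + 1]) = order_stat n ?a i / suminf (order_stat n ?a)" .
  show ?thesis unfolding share_def E ..
qed

theorem mainTheorem2:
  fixes M :: "'m measure" and X :: "nat \<Rightarrow> 'm \<Rightarrow> 'a::euclidean_space"
    and \<rho> :: "'a \<Rightarrow> real" and q :: 'a
    and \<beta> :: "nat \<Rightarrow> real" and \<gamma> :: real
    and Lam :: "real measure" and P :: "'p measure" and Y :: "nat \<Rightarrow> 'p \<Rightarrow> real"
    and k :: nat
  defines "d \<equiv> DIM('a)"
  defines "\<alpha> \<equiv> 2 / (real d - 1)"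
  defines "Cq \<equiv> 2 powr (1 / \<alpha>) * sphere_area (d - 1) / (real d - 1) * \<rho> q"
  assumes d2: "d \<ge> 2"
    and q: "q \<in> sphere 0 1"
    and rho_nonneg: "\<forall>x\<in>sphere 0 1. \<rho> x \<ge> 0"
    and rho_prob: "(\<integral>\<^sup>+ x. ennreal (\<rho> x) \<partial>sphere_surface) = 1"
    and rho_C2: "C2_on_sphere \<rho>"
    and rho_q: "\<rho> q > 0"
    and M: "prob_space M"
    and indep: "prob_space.indep_vars M (\<lambda>_. borel) X UNIV"
    and law: "\<forall>i. distr M borel (X i) = density sphere_surface (\<lambda>x. ennreal (\<rho> x))"
    and beta_pos: "\<forall>n. \<beta> n > 0"
    and gamma_pos: "\<gamma> > 0"
    and beta_lim: "(\<lambda>n. \<beta> n * real n powr (- \<alpha>)) \<longlonglongrightarrow> \<gamma>"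
    and Lam_sets: "sets Lam = sets borel"
    and Lam_neg: "emeasure Lam {..<0} = 0"
    and Lam_int: "\<forall>y\<ge>0. emeasure Lam {0..y} = ennreal (Cq * (y / \<gamma>) powr (1 / \<alpha>))"
    and PPP: "poisson_pp_atoms P Lam Y"
    and k: "k \<ge> 1"
  shows "conv_in_distr M
           (\<lambda>n \<omega> i. if i < k
                     then desc_stat (i + 1) (map (attn q (\<beta> n) (\<lambda>j. X j \<omega>) n) [1..<n + 1])
                     else 0)
           P
           (\<lambda>\<omega> i. if i < k
                   then exp (- Y (i + 1) \<omega>) / (\<Sum>j. exp (- Y (j + 1) \<omega>))
                   else 0)"
proof -
  interpret M: prob_space M by fact
  define a where "a = (real d - 1) / 2"
  define \<mu> where "\<mu> = density sphere_surface (\<lambda>x. ennreal (\<rho> x))"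
  define H where "H = (\<lambda>t. measure \<mu> {x. 1 - inner q x \<le> t})"
  define S where "S = (\<lambda>n i \<omega>. \<beta> n * (1 - inner q (X i \<omega>)))"
  define G where "G = (\<lambda>n. distr \<mu> borel (\<lambda>x. \<beta> n * (1 - inner q x)))"
  have a: "a > 0" "1 / \<alpha> = a" "\<alpha> * a = 1" using d2 by (auto simp: a_def \<alpha>_def)
  have cont: "continuous_on (sphere 0 1) \<rho>" using rho_C2 by (rule C2_on_sphere_continuous)
  have X[measurable]: "X i \<in> borel_measurable M" for i using indep by (auto simp: M.indep_vars_def2)
  have \<mu>: "distr M borel (X i) = \<mu>" for i using law by (simp add: \<mu>_def)
  have sets_\<mu>[measurable_cong, simp]: "sets \<mu> = sets borel" by (simp add: \<mu>_def)
  interpret \<mu>: prob_space \<mu> unfolding \<mu>[of 0, symmetric] by (rule M.prob_space_distr) simp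
  have AE\<mu>: "AE x in \<mu>. x \<in> sphere 0 1" unfolding \<mu>_def by (rule AE_density_sphere_surface[OF cont])
  have pos: "\<beta> n * (1 - inner q x) \<ge> 0" if "x \<in> sphere 0 1" for n x
  proof -
    have "inner q x \<le> norm q * norm x" by (rule norm_cauchy_schwarz)
    then show ?thesis using that q beta_pos by (simp add: less_imp_le)
  qed
  have Cq: "Cq = 2 powr a * unit_ball_vol (real d - 1) * \<rho> q"
  proof -
    have "sphere_area (d - 1) / real (d - 1) = unit_ball_vol (real (d - 1))"
      using d2 by (intro sphere_area_eq_unit_ball_vol) simp
    moreover have "real (d - 1) = real d - 1" using d2 by simp
    ultimately have "sphere_area (d - 1) / (real d - 1) = unit_ball_vol (real d - 1)" by simp
    then show ?thesis unfolding Cq_def a(2) by (simp add: times_divide_eq_right[symmetric] del: times_divide_eq_right)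
  qed
  have Hlim: "((\<lambda>t. H t / t powr a) \<longlongrightarrow> Cq) (at_right 0)"
    using cap_density_asymp[OF _ q rho_nonneg cont] d2 unfolding H_def \<mu>_def Cq a_def d_def by simp
  have H1: "H t \<le> 1" for t unfolding H_def by (rule \<mu>.prob_le_1)
  have bp: "\<And>n. \<beta> n > 0" using beta_pos by blast
  have G0: "measure (G n) {0..y} = H (y / \<beta> n)" for n y
  proof -
    have "measure (G n) {0..y} = measure \<mu> {x. \<beta> n * (1 - inner q x) \<in> {0..y}}"
      unfolding G_def by (subst measure_distr) (auto simp: vimage_def sets_eq_imp_space_eq[OF sets_\<mu>])
    also have "\<dots> = H (y / \<beta> n)" unfolding H_def
    proof (rule \<mu>.finite_measure_eq_AE)
      \<comment> \<open>On the sphere \<open>1 - inner q x\<close> is nonnegative, so the left end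
        of \<open>{0..y}\<close> imposes no constraint and the event is a cap.\<close>
      show "AE x in \<mu>. (x \<in> {x. \<beta> n * (1 - inner q x) \<in> {0..y}}) = (x \<in> {x. 1 - inner q x \<le> y / \<beta> n})"
        using AE\<mu>
      proof eventually_elim
        case (elim x)
        then show ?case using pos[of x n] bp[of n] by (simp add: pos_le_divide_eq mult.commute)
      qed
      show "{x. \<beta> n * (1 - inner q x) \<in> {0..y}} \<in> sets \<mu>" by simp
      show "{x. 1 - inner q x \<le> y / \<beta> n} \<in> sets \<mu>" by simp
    qed
    finally show ?thesis .
  qed
  obtain c where c: "c \<ge> 0" "\<And>n y. n \<ge> 1 \<Longrightarrow> y > 0 \<Longrightarrow> real n * H (y / \<beta> n) \<le> c * y powr a"
    using rescaled_bound[OF Hlim H1 a(1,3) bp gamma_pos beta_lim] by blast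
  let ?F = "\<lambda>y. Cq * (y / \<gamma>) powr a"
  interpret S: rare_points M S G ?F c a
  proof
    fix n i
    show "M.indep_vars (\<lambda>_. borel) (S n) UNIV"
      unfolding S_def by (rule M.indep_vars_compose2[OF indep]) auto
    show "distr M borel (S n i) = G n"
      unfolding G_def S_def \<mu>[of i, symmetric] by (subst distr_distr) (auto simp: comp_def)
  next
    have "AE x in distr M borel (X i). x \<in> sphere 0 1" for i unfolding \<mu> by (rule AE\<mu>)
    then have "AE \<omega> in M. \<forall>i. X i \<omega> \<in> sphere 0 1"
      unfolding AE_all_countable using AE_distrD[OF X] by blast
    then show "AE \<omega> in M. \<forall>n\<ge>1. \<forall>i. S n i \<omega> \<ge> 0"
      by eventually_elim (use pos in \<open>auto simp: S_def\<close>)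
  next
    fix y :: real assume y: "y > 0"
    show "(\<lambda>n. real n * measure (G n) {0..y}) \<longlonglongrightarrow> ?F y"
      unfolding G0 by (rule rescaled_limit[OF Hlim H1 a(1,3) bp gamma_pos beta_lim y])
  next
    fix n :: nat and y :: real assume "n \<ge> 1" "y > 0"
    then show "real n * measure (G n) {0..y} \<le> c * y powr a" unfolding G0 by (rule c(2))
  qed (rule c(1))
  have Cq0: "Cq \<ge> 0" unfolding Cq using d2 rho_q by (intro mult_nonneg_nonneg) auto
  \<comment> \<open>\<open>\<gamma>\<close> is pulled out of the power to reach the form
    \<open>c * y powr a\<close> shared with the sample bound.\<close>
  interpret Y: poisson_atoms P Lam Y "Cq / \<gamma> powr a" a
  proof
    fix y :: real assume "y > 0"
    then show "emeasure Lam {0..y} = ennreal (Cq / \<gamma> powr a * y powr a)"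
      using Lam_int gamma_pos unfolding a(2) by (simp add: powr_divide)
  qed (use PPP Lam_sets Cq0 in auto)
  define v where "v = (\<lambda>\<omega> i. exp (- Y (i + 1) \<omega>))"
  have Lam_cell: "measure Lam (ycell h j) = ?F (h * (real j + 1)) - (if j = 0 then 0 else ?F (h * real j))" if h: "h > 0" for h j
  proof -
    have Lam: "measure Lam {0..y} = ?F y" if "y \<ge> 0" for y
      using Lam_int that Cq0 unfolding a(2) by (simp add: measure_def)
    have "measure Lam (ycell h j) = measure Lam {0..h * (real j + 1)} - (if j = 0 then 0 else measure Lam {0..h * real j})"
      by (rule measure_ycell[OF h Lam_sets]) (use Y.Lam_int in auto)
    then show ?thesis using h by (simp add: Lam)
  qed
  let ?K = "\<lambda>c. \<Sum>j. exp (- real j / 2) * (c * (real j + 1) powr a)"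
  \<comment> \<open>One constant for both mean bounds, which are the same series with different
    factors.\<close>
  define K where "K = max 0 (max (?K c) (?K (Cq / \<gamma> powr a)))"
  have "conv_in_distr M (\<lambda>n \<omega>. share k (S.weights n \<omega>)) P (\<lambda>\<omega>. share k (v \<omega>))"
  proof (rule shares_conv_in_distr[where C="S.cell_count" and R="\<lambda>h \<omega> j. Y.count (ycell h j) \<omega>" and K=K])
    show "AE \<omega> in P. weight_seq (v \<omega>)" unfolding v_def by (rule Y.AE_weight_seq)
    show "AE \<omega> in P. \<forall>j. Y.count (ycell h j) \<omega> = card {i. v \<omega> i \<in> wcell h j}" for h
      unfolding v_def by (rule Y.AE_count_eq)
    show "(\<integral>\<^sup>+\<omega>. (\<Sum>i. ennreal (sqrt (S.weights n \<omega> i))) \<partial>M) \<le> ennreal K" if "n \<ge> 1" for n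
      by (rule order_trans[OF S.expectation_sum_sqrt_weights[OF that]]) (auto simp: K_def intro!: ennreal_leI)
    show "(\<integral>\<^sup>+\<omega>. (\<Sum>i. ennreal (sqrt (v \<omega> i))) \<partial>P) \<le> ennreal K"
      unfolding v_def by (rule order_trans[OF Y.expectation_sum_sqrt_weights]) (auto simp: K_def intro!: ennreal_leI)
    show "(\<lambda>n. \<integral>\<omega>. (\<Prod>j<m. z j ^ S.cell_count h n \<omega> j) \<partial>M) \<longlonglongrightarrow> (\<integral>\<omega>. (\<Prod>j<m. z j ^ Y.count (ycell h j) \<omega>) \<partial>P)"
      if h: "h > 0" and z: "\<And>j. 0 < z j \<and> z j < 1" for h m and z :: "nat \<Rightarrow> real"
      unfolding Y.joint_pgf[OF h z] by (rule S.joint_pgf_tendsto[OF h z Lam_cell[OF h]])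
    show "(\<lambda>\<omega>. v \<omega> i) \<in> borel_measurable P" for i unfolding v_def by measurable
    show "(\<lambda>\<omega>. Y.count (ycell h j) \<omega>) \<in> measurable P (count_space UNIV)" for h j
      by (intro Y.count_measurable Y.ycell_ok)
    show "AE \<omega> in M. weight_seq (S.weights n \<omega>)" if "n \<ge> 1" for n using that by (rule S.AE_weights)
    show "AE \<omega> in M. \<forall>j. S.cell_count h n \<omega> j = card {i. S.weights n \<omega> i \<in> wcell h j}" if "n \<ge> 1" for h n
      using that by (rule S.AE_cell_count)
    show "(\<lambda>\<omega>. S.weights n \<omega> i) \<in> borel_measurable M" for n i by (rule S.weights_measurable)
    show "(\<lambda>\<omega>. S.cell_count h n \<omega> j) \<in> measurable M (count_space UNIV)" for h n j by (rule S.cell_count_measurable)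
    show "K \<ge> 0" by (simp add: K_def)
  qed (rule M Y.prob_space_axioms)+
  moreover have eqM: "share k (S.weights n \<omega>) = (\<lambda>i. if i < k
      then desc_stat (i + 1) (map (attn q (\<beta> n) (\<lambda>j. X j \<omega>) n) [1..<n + 1]) else 0)" for n \<omega>
    unfolding S.weights_def unfolding S_def fun_eq_iff by (simp only: share_order_stat_attn simp_thms)
  moreover have eqP: "share k (v \<omega>) = (\<lambda>i. if i < k then exp (- Y (i + 1) \<omega>) / (\<Sum>j. exp (- Y (j + 1) \<omega>)) else 0)" for \<omega>
    unfolding share_def v_def fun_eq_iff by (rule allI) (rule refl)
  ultimately show ?thesis unfolding eqM eqP by (simp only:)
qed

end
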